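(* Assume that $\mu$ and $\nu$ are in convex order, $\mu\preceq_C\nu$, and that $\mu$ is continuous (i.e. $\mu(\{x\})=0$ for all $x\in\mathbb{R}$). Then there exists a unique optimal martingale transport plan $\pi_{\mathrm{HN}}$ for the cost function $c(x,y)=-|y-x|$, i.e. a unique minimizer of $\pi\mapsto\iint -|y-x|\,d\pi(x,y)$ over $\Pi_M(\mu,\nu)$. Moreover, there exist two nondecreasing functions $T_1,T_2:\mathbb{R}\to\mathbb{R}$ such that $T_1(x)\le x\le T_2(x)$ and $\pi_{\mathrm{HN}}$ is concentrated on the graphs of these functions.
   Context: Convex order: two finite Borel measures $\mu,\nu$ on $\mathbb{R}$ with finite first moments satisfy $\mu\preceq_C\nu$ if $\int\varphi\,d\mu\le\int\varphi\,d\nu$ for every convex $\varphi:\mathbb{R}\to\mathbb{R}$. $\Pi_M(\mu,\nu)$ (martingale transport plans) is the set of Borel measures $\pi$ on $\mathbb{R}\times\mathbb{R}$ with first marginal $\mu$, second marginal $\nu$, whose disintegration $(\pi_x)_{x\in\mathbb{R}}$ into probability measures with respect to $\mu$ satisfies $\int y\,d\pi_x(y)=x$ for $\mu$-a.e. $x$.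
   Formalization: T₁, T₂ take values in [−∞,∞] and are finite μ-a.e., instead of being real-valued on all of ℝ: for μ uniform on [0,1] and ν of unbounded support, real nondecreasing T₁, T₂ on ℝ cannot exist, since they would bound the support of ν. *)

theory Defs
  imports "HOL-Probability.Probability"
begin

definition finite_first_moment :: "real measure \<Rightarrow> bool" where
  "finite_first_moment \<mu> \<longleftrightarrow>
     sets \<mu> = sets borel \<and> finite_measure \<mu> \<and> integrable \<mu> (\<lambda>x. x)"

(* A convex function has an affine minorant, so under a finite first moment its negative part is
   integrable while its positive part need not be.  The integral is therefore taken in
   (-\<infinity>, \<infinity>]; the Bochner integral would silently return 0 in the divergent case. *)
definition ext_integral :: "real measure \<Rightarrow> (real \<Rightarrow> real) \<Rightarrow> ereal" where
  "ext_integral \<mu> \<phi> =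
     enn2ereal (\<integral>\<^sup>+x. ennreal (\<phi> x) \<partial>\<mu>) - enn2ereal (\<integral>\<^sup>+x. ennreal (- \<phi> x) \<partial>\<mu>)"

definition convex_order :: "real measure \<Rightarrow> real measure \<Rightarrow> bool" (infix "\<preceq>\<^sub>C" 50) where
  "\<mu> \<preceq>\<^sub>C \<nu> \<longleftrightarrow>
     (\<forall>\<phi> :: real \<Rightarrow> real. convex_on UNIV \<phi> \<longrightarrow> ext_integral \<mu> \<phi> \<le> ext_integral \<nu> \<phi>)"

(* The prescribed values on rectangles determine \<pi>, which is finite whenever \<mu> is. *)
definition disintegration ::
    "(real \<times> real) measure \<Rightarrow> real measure \<Rightarrow> (real \<Rightarrow> real measure) \<Rightarrow> bool" where
  "disintegration \<pi> \<mu> \<kappa> \<longleftrightarrow>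
     \<kappa> \<in> borel \<rightarrow>\<^sub>M prob_algebra borel \<and>
     (\<forall>A\<in>sets borel. \<forall>B\<in>sets borel.
        emeasure \<pi> (A \<times> B) = (\<integral>\<^sup>+x\<in>A. emeasure (\<kappa> x) B \<partial>\<mu>))"

(* The disintegration is unique up to a \<mu>-null set, so asking the barycentre condition of some
   disintegration is the same as asking it of all of them. *)
definition martingale_plans :: "real measure \<Rightarrow> real measure \<Rightarrow> (real \<times> real) measure set" where
  "martingale_plans \<mu> \<nu> =
     {\<pi>. sets \<pi> = sets borel \<and> distr \<pi> borel fst = \<mu> \<and> distr \<pi> borel snd = \<nu> \<and>
          (\<exists>\<kappa>. disintegration \<pi> \<mu> \<kappa> \<and>
               (AE x in \<mu>. integrable (\<kappa> x) (\<lambda>y. y) \<and> (\<integral>y. y \<partial>\<kappa> x) = x))}"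

(* Meant for costs that are integrable under every plan, such as those of at most linear growth
   when both marginals have finite first moments. *)
definition optimal_martingale_plan ::
    "(real \<Rightarrow> real \<Rightarrow> real) \<Rightarrow> real measure \<Rightarrow> real measure \<Rightarrow> (real \<times> real) measure \<Rightarrow> bool" where
  "optimal_martingale_plan c \<mu> \<nu> \<pi> \<longleftrightarrow>
     \<pi> \<in> martingale_plans \<mu> \<nu> \<and>
     (\<forall>\<pi>'\<in>martingale_plans \<mu> \<nu>. (\<integral>(x, y). c x y \<partial>\<pi>) \<le> (\<integral>(x, y). c x y \<partial>\<pi>'))"

(* Extended values are needed for functions that are nondecreasing on all of the real line: if \<mu> is
   the uniform distribution on [0, 1] and the support of \<nu> is unbounded below, then T\<^sub>1 decreases
   to -\<infinity> at 0 from the right, so that T\<^sub>1 0 = -\<infinity>.  Only points (x, y) with y real lie on the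
   graphs; measurability is no issue since the graph of a monotone function is a Borel set. *)
definition concentrated_on_graphs ::
    "(real \<times> real) measure \<Rightarrow> (real \<Rightarrow> ereal) \<Rightarrow> (real \<Rightarrow> ereal) \<Rightarrow> bool" where
  "concentrated_on_graphs \<pi> T\<^sub>1 T\<^sub>2 \<longleftrightarrow> (AE (x, y) in \<pi>. ereal y = T\<^sub>1 x \<or> ereal y = T\<^sub>2 x)"

end

theory Submission
  imports Defs "HOL-Library.Diagonal_Subsequence"
begin

text \<open>Existence of an optimal plan rests on compactness: a bounded sequence of densities has a weak-star
  convergent subsequence, hence a sequence of couplings with fixed marginals converges on
  rectangles, and the tail formula for \<open>(y - x)\<^sup>+\<close> carries the cost and the martingale property to
  the limit.  The same compactness yields a martingale coupling in the first place, from
  approximate ones that are found by separating convex sets after a finite partition of the line.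

  Let \<open>\<pi>\<close> be optimal with kernel \<open>\<kappa>\<close>.  If \<open>x < x' \<le> y'\<close> with \<open>y'\<close> in the support of \<open>\<kappa> x'\<close> and
  some mass of \<open>\<kappa> x\<close> lies above \<open>y'\<close>, then exchanging \<open>y'\<close> with a part of \<open>\<kappa> x\<close> of barycentre \<open>y'\<close>
  keeps the martingale property and increases the expected distance.  So for \<open>x < x'\<close> all of \<open>\<kappa> x\<close>
  lies below the part of \<open>\<kappa> x'\<close> above \<open>x'\<close>, and the mirror image holds on the other side.  The upper
  parts thus span intervals with disjoint interiors, of which only countably many are
  non-degenerate; as \<open>\<mu>\<close> has no atoms, \<open>\<kappa> x\<close> has at most two atoms for almost every \<open>x\<close>, and they
  depend monotonically on \<open>x\<close>.  Uniqueness follows because the average of two optimal plans is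
  optimal, and a measure on two given points is determined by its barycentre.\<close>

section \<open>Weak-star compactness\<close>

text \<open>Compactness is used in a setwise form: convergence is tested on
  \<open>A \<times> {..t}\<close> with \<open>A\<close> an arbitrary Borel set. Bounded densities
  with respect to the fixed measure \<mu> provide this without continuous test functions. Arbitrary
  \<open>A\<close> is what the tail formula needs, because there the first factor
  \<open>H \<inter> {..t}\<close> moves with the threshold. Kernels are built from distribution
  functions at rational points, so that every almost-everywhere requirement is one of countably
  many.

  The obstacle in the exchange argument is that a single pair of points cannot be exchanged: the
  kernel is determined only up to null sets, and single points may carry no mass. Hence an exchange
  is a density on the product of \<pi> with itself, and optimality enters only through a first-order
  condition. What results is an alternative for fixed levels \<open>c\<close> and \<open>d\<close>;
  running through rational levels turns it into a statement about almost every
  \<open>x\<close>.\<close>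

lemma borel_eq_atMost_rat: "(borel :: real measure) = sigma UNIV (range (\<lambda>q::rat. {..real_of_rat q}))"
proof (rule borel_eq_sigmaI1[where X="range (\<lambda>a::real. {..a})" and A=UNIV])
  show "(borel :: real measure) = sigma UNIV (range (\<lambda>a::real. {..a}))"
    by (rule borel_eq_atMost)
  fix x :: "real set" assume "x \<in> range (\<lambda>a::real. {..a})"
  then obtain a where x: "x = {..a}" by blast
  let ?S = "sigma UNIV (range (\<lambda>q::rat. {..real_of_rat q}))"
  have "x = (\<Inter>q\<in>{q. a < of_rat q}. {..real_of_rat q})"
  proof -
    have "z \<le> a" if "\<And>q. a < of_rat q \<Longrightarrow> z \<le> of_rat q" for z
      using that of_rat_dense[of a z] by (meson leD leI)
    then show ?thesis unfolding x by auto
  qed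
  also have "\<dots> \<in> sets ?S"
  proof (rule sets.countable_INT')
    show "{q. a < real_of_rat q} \<noteq> {}"
      using of_rat_dense[of a "a+1"] by auto
  qed auto
  finally show "x \<in> sets ?S" .
qed auto

lemma Int_stable_atMost_rat: "Int_stable (range (\<lambda>q::rat. {..real_of_rat q}))" (is "Int_stable ?G")
proof (rule Int_stableI)
  fix a b assume "a \<in> ?G" "b \<in> ?G"
  then obtain p q where "a = {..real_of_rat p}" "b = {..real_of_rat q}" by blast
  then have "a \<inter> b = {..real_of_rat (min p q)}"
    by (auto simp: min_def of_rat_less_eq)
  then show "a \<inter> b \<in> ?G" by blast
qed

text \<open>Cantor's diagonal argument with compactness of \<open>{- C k..C k}\<close>; the bound
  may depend on the column \<open>k\<close> but not on the row.\<close>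

lemma bounded_double_sequence_diagonal:
  fixes a :: "nat \<Rightarrow> nat \<Rightarrow> real"
  assumes "\<And>n k. \<bar>a n k\<bar> \<le> C k"
  obtains s :: "nat \<Rightarrow> nat" where "strict_mono s" "\<And>k. convergent (\<lambda>n. a (s n) k)"
proof -
  let ?P = "\<lambda>n s. convergent (\<lambda>k. a (s k) n)"
  interpret nat: subseqs ?P
  proof
    fix n and s :: "nat \<Rightarrow> nat" assume s: "strict_mono s"
    have "\<And>k. a (s k) n \<in> {- C n..C n}"
      using assms by (simp add: abs_le_iff minus_le_iff)
    then have "\<exists>l s'. strict_mono s' \<and> ((\<lambda>k. a (s k) n) \<circ> s') \<longlonglongrightarrow> l"
      using compact_Icc compact_imp_seq_compact seq_compactE by metis
    then show "\<exists>r'. strict_mono r' \<and> convergent (\<lambda>k. a ((s \<circ> r') k) n)"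
      by (auto simp: convergent_def comp_def)
  qed
  have "?P n nat.diagseq" for n
  proof -
    \<comment> \<open>Only from index \<open>Suc n\<close> on is the diagonal known to be a
      subsequence of the one chosen for column \<open>n\<close>.\<close>
    have "convergent (\<lambda>k. a ((nat.diagseq \<circ> (+) (Suc n)) k) n)"
      by (rule nat.diagseq_holds) (auto dest: convergent_subseq_convergent simp: comp_def)
    then show ?thesis
      using convergent_ignore_initial_segment[of "\<lambda>k. a (nat.diagseq k) n" "Suc n"]
      by (simp add: comp_def add.commute)
  qed
  then show ?thesis using that nat.subseq_diagseq by blast
qed

text \<open>The Radon-Nikodym derivative obeys the upper bound only almost everywhere; truncation at
  1 gives a version that obeys it at every point, so that later arguments carry no exceptional set
  for it.\<close>

lemma ex_bounded_density:
  assumes "finite_measure M" and sets_eq: "sets N = sets M"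
    and le: "\<And>A. A \<in> sets M \<Longrightarrow> emeasure N A \<le> emeasure M A"
  obtains g :: "'a \<Rightarrow> real" where "g \<in> borel_measurable M" "\<And>x. 0 \<le> g x" "\<And>x. g x \<le> 1"
    "\<And>A. A \<in> sets M \<Longrightarrow> emeasure N A = (\<integral>\<^sup>+x\<in>A. g x \<partial>M)"
    "\<And>A. A \<in> sets M \<Longrightarrow> measure N A = (\<integral>x. indicator A x * g x \<partial>M)"
proof -
  interpret finite_measure M by fact
  have spN: "space N = space M" using sets_eq by (rule sets_eq_imp_space_eq)
  have finN: "finite_measure N"
    by (rule finite_measureI) (metis le emeasure_finite infinity_ennreal_def neq_top_trans sets.top spN)
  have ac: "absolutely_continuous M N"
    unfolding absolutely_continuous_def null_sets_def using le sets_eq by force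
  obtain D where D[measurable]: "D \<in> borel_measurable M" "AE x in M. RN_deriv M N x = ennreal (D x)"
    "\<And>x. 0 \<le> D x"
    by (rule real_RN_deriv[OF finN ac]) (use sets_eq in auto)
  have "density M D = density M (RN_deriv M N)"
    using D(2) by (intro density_cong) auto
  then have dens: "density M D = N"
    using density_RN_deriv[OF ac sets_eq] by simp
  have em: "emeasure N A = (\<integral>\<^sup>+x\<in>A. D x \<partial>M)" if "A \<in> sets M" for A
    using that by (subst dens[symmetric]) (simp add: emeasure_density)
  have int_D: "integrable M D"
  proof (rule integrableI_nonneg)
    have "(\<integral>\<^sup>+x. D x \<partial>M) = emeasure N (space M)"
      by (subst em) (auto intro!: nn_integral_cong)
    then show "(\<integral>\<^sup>+x. D x \<partial>M) < \<infinity>"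
      using finN by (metis finite_measure.emeasure_finite infinity_ennreal_def less_top spN)
  qed (use D in auto)
  have meas: "measure N A = (\<integral>x. indicator A x * D x \<partial>M)" if "A \<in> sets M" for A
  proof -
    have "emeasure N A = ennreal (\<integral>x. indicator A x * D x \<partial>M)"
      unfolding em[OF that] using D that int_D
      by (subst nn_integral_eq_integral[symmetric])
         (auto intro!: nn_integral_cong integrable_mult_indicator[of A M D, simplified] split: split_indicator)
    then show ?thesis using D by (simp add: measure_def)
  qed
  \<comment> \<open>All averages of \<open>D\<close> over sets of positive measure lie in the closed
    interval, so almost all values do.\<close>
  have AE: "AE x in M. D x \<in> {0..1}"
  proof (rule averaging_theorem[OF int_D])
    fix A assume A: "A \<in> sets M" "0 < measure M A"
    have "measure N A \<le> measure M A"
      using le[OF A(1)] finN by (simp add: emeasure_eq_measure finite_measure.emeasure_eq_measure)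
    moreover have "set_lebesgue_integral M A D = measure N A"
      using A by (simp add: meas set_lebesgue_integral_def)
    ultimately show "(1 / measure M A) *\<^sub>R set_lebesgue_integral M A D \<in> {0..1}"
      using A by auto
  qed auto
  show ?thesis
  proof (rule that[of "\<lambda>x. min 1 (D x)"])
    fix A assume A: "A \<in> sets M"
    show "emeasure N A = (\<integral>\<^sup>+x\<in>A. ennreal (min 1 (D x)) \<partial>M)"
      unfolding em[OF A] using AE by (intro nn_integral_cong_AE) auto
    show "measure N A = (\<integral>x. indicator A x * min 1 (D x) \<partial>M)"
      unfolding meas[OF A] using AE A by (intro integral_cong_AE) auto
  qed (use D in auto)
qed

text \<open>Each density is read as a measure below \<open>M\<close>. A diagonal subsequence settles
  all \<open>j\<close> and all rational rays at once; Dynkin's argument then reaches every Borel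
  set, where disjoint unions are handled by Tannery's theorem with the majorant
  \<open>measure M (A i)\<close>. The setwise limit is again a measure below \<open>M\<close>, and
  \<open>g j\<close> is its density.\<close>

lemma weak_star_sequentially_compact:
  fixes f :: "nat \<Rightarrow> nat \<Rightarrow> real \<Rightarrow> real"
  assumes fin: "finite_measure M" and setsM[measurable_cong]: "sets M = sets borel"
    and meas[measurable]: "\<And>n j. f n j \<in> borel_measurable borel"
    and bnd: "\<And>n j x. 0 \<le> f n j x \<and> f n j x \<le> 1"
  obtains s :: "nat \<Rightarrow> nat" and g :: "nat \<Rightarrow> real \<Rightarrow> real" where "strict_mono s"
    "\<And>j. g j \<in> borel_measurable borel" "\<And>j x. 0 \<le> g j x \<and> g j x \<le> 1"
    "\<And>j A. A \<in> sets borel \<Longrightarrow>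
       (\<lambda>n. \<integral>x. indicator A x * f (s n) j x \<partial>M) \<longlonglongrightarrow> (\<integral>x. indicator A x * g j x \<partial>M)"
proof -
  interpret finite_measure M by fact
  have spM[simp]: "space M = UNIV" using sets_eq_imp_space_eq[OF setsM] by simp
  define N where "N n j = density M (f n j)" for n j
  define I where "I n j A = measure (N n j) A" for n j A
  have emN: "emeasure (N n j) A \<le> emeasure M A" if "A \<in> sets borel" for A n j
  proof -
    have "(\<integral>\<^sup>+x. ennreal (f n j x) * indicator A x \<partial>M) \<le> (\<integral>\<^sup>+x. indicator A x \<partial>M)"
      using bnd by (intro nn_integral_mono) (auto split: split_indicator)
    then show ?thesis using that by (simp add: N_def emeasure_density setsM)
  qed
  have finN: "finite_measure (N n j)" for n j
    proof (rule finite_measureI)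
    show "emeasure (N n j) (space (N n j)) \<noteq> \<infinity>"
      using emN[of UNIV n j] emeasure_finite[of UNIV] by (auto simp: N_def top_unique)
  qed
  have I_eq: "I n j A = (\<integral>x. indicator A x * f n j x \<partial>M)" if [measurable]: "A \<in> sets borel" for A n j
  proof -
    have int: "integrable M (\<lambda>x. indicator A x * f n j x)"
      by (rule integrable_const_bound[where B=1]) (use bnd in \<open>auto simp: indicator_def\<close>)
    have "emeasure (N n j) A = ennreal (\<integral>x. indicator A x * f n j x \<partial>M)"
      unfolding N_def by (subst nn_integral_eq_integral[symmetric, OF int])
         (use bnd in \<open>auto simp: emeasure_density intro!: nn_integral_cong split: split_indicator\<close>)
    then show ?thesis using bnd by (simp add: I_def measure_def)
  qed
  have I_nonneg: "0 \<le> I n j A" for n j A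
    unfolding I_def by simp
  have I_le: "I n j A \<le> measure M A" if A: "A \<in> sets borel" for n j A
    using emN[OF A, of n j] finN
    by (simp add: I_def emeasure_eq_measure finite_measure.emeasure_eq_measure)
  \<comment> \<open>\<open>None\<close> adds the whole line to the rays: the complement step of the
    induction subtracts from the total mass, whose limit must exist as well.\<close>
  define gen :: "rat option \<Rightarrow> real set" where
    "gen q = (case q of None \<Rightarrow> UNIV | Some q \<Rightarrow> {..of_rat q})" for q
  have gen_borel: "gen q \<in> sets borel" for q by (auto simp: gen_def split: option.split)
  define ix :: "nat \<Rightarrow> nat \<times> rat option" where "ix = from_nat"
  obtain s :: "nat \<Rightarrow> nat" where s: "strict_mono s"
    "\<And>k. convergent (\<lambda>n. I (s n) (fst (ix k)) (gen (snd (ix k))))"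
    by (rule bounded_double_sequence_diagonal[of "\<lambda>n k. I n (fst (ix k)) (gen (snd (ix k)))"
          "\<lambda>k. measure M (gen (snd (ix k)))"])
       (auto simp: I_nonneg intro!: I_le gen_borel)
  have conv_gen: "convergent (\<lambda>n. I (s n) j (gen q))" for j q
    using s(2)[of "to_nat (j, q)"] by (simp add: ix_def)
  have sm: "summable (\<lambda>i. measure M (A i))"
    if "disjoint_family A" "\<And>i. A i \<in> sets borel" for A :: "nat \<Rightarrow> real set"
    using that by (intro sums_summable[OF finite_measure_UNION]) (auto simp: setsM)
  have tan: "(\<lambda>n. I (s n) j (\<Union>i. A i)) \<longlonglongrightarrow> (\<Sum>i. lim (\<lambda>n. I (s n) j (A i)))"
    if A: "disjoint_family A" "\<And>i. A i \<in> sets borel" "\<And>i. convergent (\<lambda>n. I (s n) j (A i))"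
    for j and A :: "nat \<Rightarrow> real set"
  proof -
    have "(\<lambda>i. I n j (A i)) sums I n j (\<Union>i. A i)" for n
      unfolding I_def using A
      by (intro finite_measure.finite_measure_UNION finN) (auto simp: N_def setsM)
    then have eq: "I n j (\<Union>i. A i) = (\<Sum>i. I n j (A i))" for n
      by (simp add: sums_iff)
    show ?thesis unfolding eq
      by (rule tannerys_theorem[THEN conjunct2, THEN conjunct2, OF _ _ sm[OF A(1,2)]])
         (use A in \<open>auto simp: convergent_LIMSEQ_iff I_nonneg intro!: always_eventually I_le\<close>)
  qed
  have conv: "convergent (\<lambda>n. I (s n) j A)" if "A \<in> sets borel" for j A
  proof -
    let ?G = "range (\<lambda>q::rat. {..real_of_rat q})"
    have eqG: "sets borel = sigma_sets UNIV ?G"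
      by (simp add: borel_eq_atMost_rat)
    have "?G \<subseteq> Pow UNIV" by simp
    from Int_stable_atMost_rat this that[unfolded eqG] show ?thesis
    proof (induction A rule: sigma_sets_induct_disjoint)
      case (basic A)
      then obtain q where "A = gen (Some q)" by (auto simp: gen_def)
      then show ?case using conv_gen by simp
    next
      case empty
      then show ?case by (simp add: I_def convergent_const)
    next
      case (compl A)
      then have A: "A \<in> sets borel" by (simp add: eqG)
      have "I n j (UNIV - A) = I n j (gen None) - I n j A" for n
        unfolding I_def gen_def using A finite_measure.finite_measure_compl[OF finN, of A n j]
        by (simp add: N_def setsM)
      then show ?case using convergent_diff[OF conv_gen[of j None] compl(2)] by simp
    next
      case (union A)
      then show ?case using tan[of A j] eqG by (auto simp: convergent_def)
    qed
  qed
  define L where "L j A = lim (\<lambda>n. I (s n) j A)" for j A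
  have L: "(\<lambda>n. I (s n) j A) \<longlonglongrightarrow> L j A" if "A \<in> sets borel" for j A
    using conv[OF that] by (simp add: L_def convergent_LIMSEQ_iff)
  have L_nonneg: "0 \<le> L j A" if "A \<in> sets borel" for j A
    by (rule LIMSEQ_le_const[OF L[OF that]]) (use I_nonneg in auto)
  have L_le: "L j A \<le> measure M A" if "A \<in> sets borel" for j A
    by (rule LIMSEQ_le_const2[OF L[OF that]]) (use I_le that in auto)
  have "\<exists>g. g \<in> borel_measurable borel \<and> (\<forall>x. 0 \<le> g x \<and> g x \<le> 1) \<and>
          (\<forall>A\<in>sets borel. L j A = (\<integral>x. indicator A x * g x \<partial>M))" for j
  proof -
    define K where "K = measure_of UNIV (sets borel) (\<lambda>A. ennreal (L j A))"
    have setsK: "sets K = sets borel"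
      unfolding K_def by (metis sets.sets_measure_of_eq space_borel)
    have emK: "emeasure K A = ennreal (L j A)" if "A \<in> sets borel" for A
    proof (rule emeasure_measure_of[OF K_def])
      show "countably_additive (sets K) (\<lambda>A. ennreal (L j A))"
      proof (rule countably_additiveI)
        fix A :: "nat \<Rightarrow> real set" assume A: "range A \<subseteq> sets K" "disjoint_family A" "\<Union> (range A) \<in> sets K"
        then have A': "A i \<in> sets borel" for i using setsK by auto
        have "L j (\<Union> (range A)) = (\<Sum>i. L j (A i))"
          using tan[OF A(2) A' conv[OF A']] L[of "\<Union> (range A)" j] A setsK
          by (auto simp: L_def intro: LIMSEQ_unique)
        moreover have "summable (\<lambda>i. L j (A i))"
          by (rule summable_comparison_test'[OF sm[OF A(2) A'], of 0]) (auto simp: L_nonneg L_le A')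
        ultimately show "(\<Sum>i. ennreal (L j (A i))) = ennreal (L j (\<Union> (range A)))"
          by (simp only: suminf_ennreal2[OF L_nonneg[OF A']])
      qed
      show "positive (sets K) (\<lambda>A. ennreal (L j A))"
        by (auto simp: positive_def L_def I_def)
    qed (use that setsK in auto)
    obtain g where g: "g \<in> borel_measurable M" "\<And>x. 0 \<le> g x" "\<And>x. g x \<le> 1"
      "\<And>A. A \<in> sets M \<Longrightarrow> measure K A = (\<integral>x. indicator A x * g x \<partial>M)"
      by (rule ex_bounded_density[OF fin, of K])
         (auto simp: setsK setsM emK emeasure_eq_measure L_le ennreal_leI)
    then show ?thesis
      using emK L_nonneg by (intro exI[of _ g]) (auto simp: setsM measure_def cong: measurable_cong_sets)
  qed
  then obtain g where g: "\<And>j. g j \<in> borel_measurable borel" "\<And>j x. 0 \<le> g j x \<and> g j x \<le> 1"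
    "\<And>j A. A \<in> sets borel \<Longrightarrow> L j A = (\<integral>x. indicator A x * g j x \<partial>M)"
    by metis
  show ?thesis
    by (rule that[OF s(1) g(1,2)]) (use L g(3) in \<open>auto simp: I_eq\<close>)
qed

section \<open>Kernels from rational distribution functions\<close>

text \<open>\<open>H\<close> is the right-continuous extension of \<open>F\<close>: the infimum over
  rationals strictly above \<open>t\<close> forces right continuity, and \<open>right\<close> makes
  the extension agree with \<open>F\<close> at the rationals.\<close>

lemma
  fixes F :: "rat \<Rightarrow> real"
  assumes mono: "\<And>p q. p < q \<Longrightarrow> F p \<le> F q"
    and right: "\<And>q. (\<lambda>n. F (q + 1 / of_nat (Suc n))) \<longlonglongrightarrow> F q"
    and top: "(\<lambda>n. F (of_nat n)) \<longlonglongrightarrow> 1"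
    and bot: "(\<lambda>n. F (- of_nat n)) \<longlonglongrightarrow> 0"
  defines "H \<equiv> \<lambda>t. INF q\<in>{q. t < real_of_rat q}. F q"
  shows rational_cdf_extension: "\<And>q. H (of_rat q) = F q"
    and real_distribution_rational_cdf: "real_distribution (interval_measure H)"
    and measure_rational_cdf: "\<And>t. measure (interval_measure H) {..t} = H t"
proof -
  have F_nonneg: "0 \<le> F q" for q
  proof (rule LIMSEQ_le_const2[OF bot])
    obtain N :: nat where N: "- q < of_nat N" using reals_Archimedean2 by blast
    then have "- of_nat n < q" if "n \<ge> N" for n :: nat
      using that by (meson less_le_trans minus_less_iff of_nat_le_iff)
    then show "\<exists>N. \<forall>n\<ge>N. F (- of_nat n) \<le> F q" using mono by blast
  qed
  have F_le: "F q \<le> 1" for q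
  proof (rule LIMSEQ_le_const[OF top])
    obtain N :: nat where N: "q < of_nat N" using reals_Archimedean2 by blast
    then have "q < of_nat n" if "n \<ge> N" for n :: nat
      using that by (meson less_le_trans of_nat_le_iff)
    then show "\<exists>N. \<forall>n\<ge>N. F q \<le> F (of_nat n)" using mono by blast
  qed
  have ne: "{q. t < real_of_rat q} \<noteq> {}" for t
    using of_rat_dense[of t "t + 1"] by auto
  have bdd: "bdd_below (F ` {q. t < real_of_rat q})" for t
    using F_nonneg by (intro bdd_belowI[of _ 0]) auto
  have H_le: "H t \<le> F q" if "t < of_rat q" for t q
    unfolding H_def using that by (intro cINF_lower bdd) auto
  have H_ge: "u \<le> H t" if "\<And>q. t < of_rat q \<Longrightarrow> u \<le> F q" for t u
    unfolding H_def using that by (intro cINF_greatest ne) auto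
  have H_less: "\<exists>q. t < of_rat q \<and> F q < u" if "H t < u" for t u
    using that unfolding H_def using cINF_less_iff[OF ne bdd, of t u] by auto
  show H_rat: "H (of_rat q) = F q" for q
  proof (rule antisym)
    show "H (of_rat q) \<le> F q"
      by (rule LIMSEQ_le_const[OF right]) (auto intro!: H_le simp: of_rat_less)
    show "F q \<le> H (of_rat q)"
      by (rule H_ge) (auto intro!: mono simp: of_rat_less)
  qed
  have H_mono: "H s \<le> H t" if "s \<le> t" for s t
    using that by (intro H_ge H_le) auto
  have rc: "continuous (at_right a) H" for a
    unfolding continuous_within order_tendsto_iff eventually_at_right[OF less_add_one]
  proof safe
    fix u assume "H a < u"
    then obtain q where "a < of_rat q" "F q < u" using H_less by blast
    then show "\<exists>b>a. \<forall>y>a. y < b \<longrightarrow> H y < u"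
      by (intro exI[of _ "of_rat q"]) (auto intro: le_less_trans[OF H_le])
  next
    fix l assume "l < H a"
    then show "\<exists>b>a. \<forall>y>a. y < b \<longrightarrow> l < H y"
      using less_le_trans[OF _ H_mono] by (intro exI[of _ "a + 1"]) auto
  qed
  have lim_top: "(H \<longlongrightarrow> 1) at_top"
  proof (rule tendsto_at_topI_sequentially_real)
    show "mono H" using H_mono by (simp add: mono_def)
    show "(\<lambda>n. H (real n)) \<longlonglongrightarrow> 1"
      using top H_rat[of "of_nat _"] by simp
  qed
  have lim_bot: "(H \<longlongrightarrow> 0) at_bot"
  proof (rule order_tendstoI)
    fix a :: real assume "a < 0"
    moreover have "0 \<le> H t" for t by (rule H_ge[OF F_nonneg])
    ultimately show "\<forall>\<^sub>F x in at_bot. a < H x"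
      by (intro always_eventually) (metis less_le_trans)
  next
    fix a :: real assume a: "0 < a"
    obtain n :: nat where "F (- of_nat n) < a"
      using order_tendstoD(2)[OF bot a] by (auto simp: eventually_sequentially)
    then have "H (- real n) < a" using H_rat[of "- of_nat n"] by (simp add: of_rat_minus)
    then show "\<forall>\<^sub>F x in at_bot. H x < a"
      unfolding eventually_at_bot_linorder using H_mono le_less_trans by blast
  qed
  show "real_distribution (interval_measure H)"
    by (rule real_distribution_interval_measure[OF H_mono rc lim_bot lim_top])
  show "measure (interval_measure H) {..t} = H t" for t
    by (rule measure_interval_measure_Iic[OF H_mono rc lim_bot])
qed

text \<open>Marginals control only integrals; this turns their convergence into convergence at
  almost every point. Monotonicity provides a pointwise limit, and dominated convergence gives this
  nonnegative limit the integral zero.\<close>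

lemma (in finite_measure) AE_decseq_tendsto_0:
  fixes g :: "nat \<Rightarrow> 'a \<Rightarrow> real"
  assumes [measurable]: "\<And>n. g n \<in> borel_measurable M"
    and dec: "AE x in M. decseq (\<lambda>n. g n x)" and bnd: "AE x in M. \<forall>n. 0 \<le> g n x \<and> g n x \<le> C"
    and lim: "(\<lambda>n. \<integral>x. g n x \<partial>M) \<longlonglongrightarrow> 0"
  shows "AE x in M. (\<lambda>n. g n x) \<longlonglongrightarrow> 0"
proof -
  define G where "G x = lim (\<lambda>n. g n x)" for x
  have G[measurable]: "G \<in> borel_measurable M" unfolding G_def by measurable
  have conv: "AE x in M. (\<lambda>n. g n x) \<longlonglongrightarrow> G x"
    using dec bnd
  proof eventually_elim
    case (elim x)
    then show ?case
      by (metis G_def convergentI convergent_LIMSEQ_iff decseq_convergent)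
  qed
  have nonneg: "AE x in M. 0 \<le> G x"
    using conv bnd by eventually_elim (auto intro: LIMSEQ_le_const)
  have le: "AE x in M. G x \<le> C"
    using conv bnd by eventually_elim (auto intro: LIMSEQ_le_const2)
  have intG: "integrable M G"
    by (rule integrable_const_bound[where B=C]) (use nonneg le in \<open>auto elim: eventually_elim2\<close>)
  have "(\<lambda>n. \<integral>x. g n x \<partial>M) \<longlonglongrightarrow> (\<integral>x. G x \<partial>M)"
    by (rule integral_dominated_convergence[where w="\<lambda>_. C"]) (use conv bnd in auto)
  then have "(\<integral>x. G x \<partial>M) = 0" using lim by (rule LIMSEQ_unique)
  then have "AE x in M. G x = 0"
    using integral_nonneg_eq_0_iff_AE[OF intG nonneg] by simp
  then show ?thesis using conv by eventually_elim simp
qed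

text \<open>Every requirement on a distribution function holds off a null set, and with rational
  arguments there are countably many of them, so one null set serves for all. Measurability of the
  kernel is checked on rational rays, which generate the Borel sets.\<close>

lemma kernel_from_rational_cdf:
  fixes F :: "rat \<Rightarrow> real \<Rightarrow> real"
  assumes fin: "finite_measure M" and setsM[measurable_cong]: "sets M = sets borel"
    and meas[measurable]: "\<And>q. F q \<in> borel_measurable borel"
    and bnd: "\<And>q x. 0 \<le> F q x \<and> F q x \<le> 1"
    and mono: "\<And>p q. p < q \<Longrightarrow> AE x in M. F p x \<le> F q x"
    and right: "\<And>q. (\<lambda>n. \<integral>x. F (q + 1 / of_nat (Suc n)) x \<partial>M) \<longlonglongrightarrow> (\<integral>x. F q x \<partial>M)"
    and top: "(\<lambda>n. \<integral>x. F (of_nat n) x \<partial>M) \<longlonglongrightarrow> measure M UNIV"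
    and bot: "(\<lambda>n. \<integral>x. F (- of_nat n) x \<partial>M) \<longlonglongrightarrow> 0"
  obtains \<kappa> :: "real \<Rightarrow> real measure" where "\<kappa> \<in> borel \<rightarrow>\<^sub>M prob_algebra borel"
    "\<And>q. AE x in M. measure (\<kappa> x) {..of_rat q} = F q x"
proof -
  interpret finite_measure M by fact
  have spM[simp]: "space M = UNIV" using sets_eq_imp_space_eq[OF setsM] by simp
  have int_F[simp]: "integrable M (F q)" for q
    by (rule integrable_const_bound[where B=1]) (use bnd in auto)
  have mono_all: "AE x in M. \<forall>p q. p < q \<longrightarrow> F p x \<le> F q x"
    using mono by (simp add: AE_all_countable)
  define good where "good x \<longleftrightarrow> (\<forall>p q. p < q \<longrightarrow> F p x \<le> F q x) \<and>
    (\<forall>q. (\<lambda>n. F (q + 1 / of_nat (Suc n)) x) \<longlonglongrightarrow> F q x) \<and>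
    (\<lambda>n. F (of_nat n) x) \<longlonglongrightarrow> 1 \<and> (\<lambda>n. F (- of_nat n) x) \<longlonglongrightarrow> 0" for x
  have good_meas[measurable]: "Measurable.pred borel good"
    unfolding good_def by measurable
  have AE_right: "AE x in M. \<forall>q. (\<lambda>n. F (q + 1 / of_nat (Suc n)) x) \<longlonglongrightarrow> F q x"
    unfolding AE_all_countable
  proof
    fix q
    have "AE x in M. (\<lambda>n. F (q + 1 / of_nat (Suc n)) x - F q x) \<longlonglongrightarrow> 0"
    proof (rule AE_decseq_tendsto_0[where C=1])
      show "AE x in M. decseq (\<lambda>n. F (q + 1 / of_nat (Suc n)) x - F q x)"
        using mono_all
      proof eventually_elim
        case (elim x)
        have "q + 1 / of_nat (Suc (Suc n)) < q + 1 / of_nat (Suc n)" for n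
          by (simp add: field_simps)
        then show ?case using elim by (auto simp: decseq_Suc_iff)
      qed
      show "AE x in M. \<forall>n. 0 \<le> F (q + 1 / of_nat (Suc n)) x - F q x \<and> F (q + 1 / of_nat (Suc n)) x - F q x \<le> 1"
        using mono_all
      proof eventually_elim
        case (elim x)
        have "q < q + 1 / of_nat (Suc n)" for n by simp
        then show ?case using elim bnd by (smt (verit))
      qed
      show "(\<lambda>n. \<integral>x. F (q + 1 / of_nat (Suc n)) x - F q x \<partial>M) \<longlonglongrightarrow> 0"
        using tendsto_diff[OF right[of q] tendsto_const[of "\<integral>x. F q x \<partial>M"]] by simp
    qed measurable
    then show "AE x in M. (\<lambda>n. F (q + 1 / of_nat (Suc n)) x) \<longlonglongrightarrow> F q x"
      by eventually_elim (simp add: LIM_zero_iff)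
  qed
  have "AE x in M. (\<lambda>n. 1 - F (of_nat n) x) \<longlonglongrightarrow> 0"
  proof (rule AE_decseq_tendsto_0[where C=1])
    show "AE x in M. decseq (\<lambda>n. 1 - F (of_nat n) x)"
      using mono_all by eventually_elim (auto simp: decseq_Suc_iff)
    show "AE x in M. \<forall>n. 0 \<le> 1 - F (of_nat n) x \<and> 1 - F (of_nat n) x \<le> 1"
      using bnd by auto
    show "(\<lambda>n. \<integral>x. 1 - F (of_nat n) x \<partial>M) \<longlonglongrightarrow> 0"
      using tendsto_diff[OF tendsto_const[of "measure M UNIV"] top] by simp
  qed measurable
  then have AE_top: "AE x in M. (\<lambda>n. F (of_nat n) x) \<longlonglongrightarrow> 1"
  proof eventually_elim
    case (elim x)
    from tendsto_diff[OF tendsto_const[of 1] elim] show ?case by simp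
  qed
  have AE_bot: "AE x in M. (\<lambda>n. F (- of_nat n) x) \<longlonglongrightarrow> 0"
  proof (rule AE_decseq_tendsto_0[where C=1, OF _ _ _ bot])
    show "AE x in M. decseq (\<lambda>n. F (- of_nat n) x)"
      using mono_all by eventually_elim (auto simp: decseq_Suc_iff)
  qed (use bnd in auto)
  have AE_good: "AE x in M. good x"
    using mono_all AE_right AE_top AE_bot by eventually_elim (auto simp: good_def)
  have goodD: "\<And>p q. p < q \<Longrightarrow> F p x \<le> F q x"
      "\<And>q. (\<lambda>n. F (q + 1 / of_nat (Suc n)) x) \<longlonglongrightarrow> F q x"
      "(\<lambda>n. F (of_nat n) x) \<longlonglongrightarrow> 1" "(\<lambda>n. F (- of_nat n) x) \<longlonglongrightarrow> 0" if "good x" for x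
    using that unfolding good_def by simp_all
  \<comment> \<open>At exceptional points the distribution function of the unit mass at 0 is
    substituted, so that \<open>\<kappa> x\<close> is a probability measure for every
    \<open>x\<close>.\<close>
  define F' where "F' q x = (if good x then F q x else if 0 \<le> q then 1 else 0)" for q x
  have [measurable]: "F' q \<in> borel_measurable borel" for q
    unfolding F'_def by measurable
  define H where "H x t = (INF q\<in>{q. t < real_of_rat q}. F' q x)" for x t
  have F'1: "F' p x \<le> F' q x" if "p < q" for p q x
  proof (cases "good x")
    case True
    then show ?thesis using goodD(1)[OF True that] by (simp add: F'_def)
  qed (use that in \<open>auto simp: F'_def\<close>)
  have F'2: "(\<lambda>n. F' (q + 1 / of_nat (Suc n)) x) \<longlonglongrightarrow> F' q x" for q x
  proof (cases "good x \<or> q \<ge> 0")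
    case True
    have "0 \<le> q \<Longrightarrow> 0 \<le> q + 1 / of_nat (Suc n)" for n
      by simp
    then show ?thesis using True goodD(2)
      by (cases "good x") (auto simp: F'_def simp del: of_nat_Suc)
  next
    case False
    then have q: "q < 0" by simp
    obtain N where N: "inverse (of_nat (Suc N)) < - q"
      using reals_Archimedean[of "- real_of_rat q"] q
      by (metis Archimedean_eventually_inverse eventually_sequentially le_refl neg_0_less_iff_less)
    have "q + 1 / of_nat (Suc n) < 0" if "n \<ge> N" for n
    proof -
      have "inverse (of_nat (Suc n)) \<le> (inverse (of_nat (Suc N)) :: rat)"
        using that by (intro le_imp_inverse_le) auto
      then show ?thesis using N by (simp add: inverse_eq_divide)
    qed
    then show ?thesis using False
      by (intro tendsto_eventually eventually_sequentiallyI[of N])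
         (auto simp: F'_def simp del: of_nat_Suc dest: leD)
  qed
  have F'3: "(\<lambda>n. F' (of_nat n) x) \<longlonglongrightarrow> 1" for x
  proof (cases "good x")
    case True
    then show ?thesis using goodD(3)[OF True] by (simp add: F'_def)
  qed (simp add: F'_def)
  have F'4: "(\<lambda>n. F' (- of_nat n) x) \<longlonglongrightarrow> 0" for x
  proof (cases "good x")
    case True
    then show ?thesis using goodD(4)[OF True] by (simp add: F'_def)
  next
    case False
    then show ?thesis
      by (intro tendsto_eventually eventually_sequentiallyI[of 1]) (auto simp: F'_def)
  qed
  note H = rational_cdf_extension real_distribution_rational_cdf measure_rational_cdf
  define \<kappa> where "\<kappa> x = interval_measure (H x)" for x
  have eqG: "sets (borel::real measure) = sigma_sets UNIV (range (\<lambda>q::rat. {..real_of_rat q}))"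
    by (simp add: borel_eq_atMost_rat)
  have setsK: "sets (\<kappa> x) = sets borel" for x by (simp add: \<kappa>_def)
  have distr: "real_distribution (\<kappa> x)" for x
    unfolding \<kappa>_def H_def by (rule H(2)) (use F'1 F'2 F'3 F'4 in auto)
  then have prob: "prob_space (\<kappa> x)" for x
    by (simp add: real_distribution_def)
  have em: "emeasure (\<kappa> x) {..of_rat q} = ennreal (F' q x)" for x q
  proof -
    have "measure (\<kappa> x) {..of_rat q} = H x (of_rat q)"
      unfolding \<kappa>_def H_def by (rule H(3)) (use F'1 F'2 F'3 F'4 in auto)
    also have "\<dots> = F' q x"
      unfolding H_def by (rule H(1)) (use F'1 F'2 F'3 F'4 in auto)
    finally show ?thesis using prob by (simp add: prob_space_def finite_measure.emeasure_eq_measure)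
  qed
  show ?thesis
  proof (rule that)
    show "\<kappa> \<in> borel \<rightarrow>\<^sub>M prob_algebra borel"
    proof (rule measurable_prob_algebra_generated[OF eqG])
      show "Int_stable (range (\<lambda>q::rat. {..real_of_rat q}))"
        by (rule Int_stable_atMost_rat)
    qed (auto simp: prob em setsK)
    show "AE x in M. measure (\<kappa> x) {..of_rat q} = F q x" for q
      using AE_good by eventually_elim (simp add: measure_def em F'_def bnd)
  qed
qed

text \<open>Integrating \<open>F q\<close> gives the distribution function of \<open>N\<close>,
  whose right continuity and limits at infinity supply the three limit conditions. Disintegration
  and limits of couplings both obtain their kernels in this way.\<close>

lemma kernel_from_marginal_cdf:
  fixes F :: "rat \<Rightarrow> real \<Rightarrow> real" and M N :: "real measure"
  assumes fin: "finite_measure M" "sets M = sets borel"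
    and fin_N: "finite_measure N" and sets_N: "sets N = sets borel"
    and mass: "measure N UNIV = measure M UNIV"
    and meas: "\<And>q. F q \<in> borel_measurable borel"
    and bnd: "\<And>q x. 0 \<le> F q x \<and> F q x \<le> 1"
    and mono: "\<And>p q. p < q \<Longrightarrow> AE x in M. F p x \<le> F q x"
    and marg: "\<And>q. (\<integral>x. F q x \<partial>M) = measure N {..of_rat q}"
  obtains \<kappa> :: "real \<Rightarrow> real measure" where "\<kappa> \<in> borel \<rightarrow>\<^sub>M prob_algebra borel"
    "\<And>q. AE x in M. measure (\<kappa> x) {..of_rat q} = F q x"
proof -
  interpret N: finite_borel_measure N
    using fin_N sets_N by (simp add: finite_borel_measure_def finite_borel_measure_axioms_def)
  have marg': "(\<integral>x. F q x \<partial>M) = cdf N (of_rat q)" for q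
    by (simp add: marg cdf_def)
  have right: "(\<lambda>n. \<integral>x. F (q + 1 / of_nat (Suc n)) x \<partial>M) \<longlonglongrightarrow> (\<integral>x. F q x \<partial>M)" for q
  proof -
    have "filterlim (\<lambda>n. real_of_rat q + inverse (of_nat (Suc n))) (at_right (of_rat q)) sequentially"
      unfolding filterlim_at
      using tendsto_add[OF tendsto_const LIMSEQ_inverse_real_of_nat, of "of_rat q"] by simp
    with N.cdf_is_right_cont[of "of_rat q"]
    have "(\<lambda>n. cdf N (real_of_rat q + inverse (of_nat (Suc n)))) \<longlonglongrightarrow> cdf N (of_rat q)"
      unfolding continuous_within by (rule filterlim_compose)
    then show ?thesis unfolding marg'
      by (simp add: of_rat_add of_rat_divide inverse_eq_divide)
  qed
  have top: "(\<lambda>n. \<integral>x. F (of_nat n) x \<partial>M) \<longlonglongrightarrow> measure M UNIV"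
    using N.cdf_lim_infty sets_eq_imp_space_eq[OF sets_N] by (simp add: marg' mass)
  have bot: "(\<lambda>n. \<integral>x. F (- of_nat n) x \<partial>M) \<longlonglongrightarrow> 0"
    using N.cdf_lim_neg_infty by (simp add: marg' of_rat_minus)
  show ?thesis
    by (rule kernel_from_rational_cdf[OF fin meas bnd _ right top bot], erule mono) (rule that, auto)
qed

section \<open>Disintegration\<close>

lemma measure_eqI_atMost_rat:
  fixes M N :: "real measure"
  assumes "finite_measure M" "sets M = sets borel" "sets N = sets borel"
    and eq: "\<And>q::rat. emeasure M {..of_rat q} = emeasure N {..of_rat q}"
  shows "M = N"
proof (rule measure_eqI_generator_eq[OF Int_stable_atMost_rat, where \<Omega>=UNIV and A="\<lambda>n. {..real n}"])
  show "range (\<lambda>n. {..real n}) \<subseteq> range (\<lambda>q::rat. {..real_of_rat q})"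
    by (auto intro: range_eqI[of _ _ "of_nat _"])
  show "(\<Union>n. {..real n}) = UNIV"
    using real_arch_simple by auto
qed (use assms in \<open>auto simp: borel_eq_atMost_rat finite_measure.emeasure_finite\<close>)

lemma measure_eqI_rectangles:
  fixes \<pi> \<pi>' :: "(real \<times> real) measure"
  assumes "finite_measure \<pi>" "sets \<pi> = sets borel" "sets \<pi>' = sets borel"
    and eq: "\<And>A B. A \<in> sets borel \<Longrightarrow> B \<in> sets borel \<Longrightarrow> emeasure \<pi> (A \<times> B) = emeasure \<pi>' (A \<times> B)"
  shows "\<pi> = \<pi>'"
proof (rule measure_eqI_generator_eq[OF Int_stable_pair_measure_generator[of borel borel],
      where \<Omega>=UNIV and A="\<lambda>_. UNIV"])
  have "sets (borel :: (real \<times> real) measure) =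
      sigma_sets UNIV {a \<times> b |a b. a \<in> sets borel \<and> b \<in> sets borel}"
    by (subst borel_prod[symmetric]) (simp add: sets_pair_measure)
  then show "sets \<pi> = sigma_sets UNIV {a \<times> b |a b. a \<in> sets borel \<and> b \<in> sets borel}"
    "sets \<pi>' = sigma_sets UNIV {a \<times> b |a b. a \<in> sets borel \<and> b \<in> sets borel}"
    using assms by auto
  show "range (\<lambda>_. UNIV) \<subseteq> {a \<times> b |a b. a \<in> sets borel \<and> b \<in> sets borel}"
    by (auto intro!: exI[of _ UNIV])
qed (use assms in \<open>auto simp: finite_measure.emeasure_finite\<close>)

text \<open>The semidirect product of \<mu> and \<kappa>.\<close>

definition kernel_plan :: "real measure \<Rightarrow> (real \<Rightarrow> real measure) \<Rightarrow> (real \<times> real) measure" where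
  "kernel_plan \<mu> \<kappa> = \<mu> \<bind> (\<lambda>x. distr (\<kappa> x) borel (Pair x))"

context
  fixes \<mu> :: "real measure" and \<kappa> :: "real \<Rightarrow> real measure"
  assumes sets_mu[measurable_cong]: "sets \<mu> = sets borel"
    and kernel[measurable]: "\<kappa> \<in> borel \<rightarrow>\<^sub>M prob_algebra borel"
begin

lemma kernel_subprob: "\<kappa> \<in> borel \<rightarrow>\<^sub>M subprob_algebra borel"
  using kernel by (rule measurable_prob_algebraD)

lemma
  shows sets_kernel: "sets (\<kappa> x) = sets borel" and prob_space_kernel: "prob_space (\<kappa> x)"
  using measurable_space[OF kernel, of x] by (auto simp: space_prob_algebra)

lemma space_kernel_base: "space \<mu> = UNIV"
  using sets_eq_imp_space_eq[OF sets_mu] by simp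

lemma kernel_pair_measurable: "(\<lambda>x. distr (\<kappa> x) borel (Pair x)) \<in> \<mu> \<rightarrow>\<^sub>M subprob_algebra borel"
proof -
  have "(\<lambda>(x, y). (x, y)) \<in> borel \<Otimes>\<^sub>M borel \<rightarrow>\<^sub>M (borel :: (real \<times> real) measure)"
    by (simp add: borel_prod)
  from measurable_distr2[OF this kernel_subprob] show ?thesis
    using sets_mu by (simp cong: measurable_cong_sets)
qed

lemma sets_kernel_plan: "sets (kernel_plan \<mu> \<kappa>) = sets borel"
  unfolding kernel_plan_def by (rule sets_bind) (auto simp: space_kernel_base)

lemma nn_integral_kernel_plan:
  assumes [measurable]: "f \<in> borel_measurable borel"
  shows "(\<integral>\<^sup>+z. f z \<partial>kernel_plan \<mu> \<kappa>) = (\<integral>\<^sup>+x. \<integral>\<^sup>+y. f (x, y) \<partial>\<kappa> x \<partial>\<mu>)"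
proof -
  have "(\<integral>\<^sup>+z. f z \<partial>kernel_plan \<mu> \<kappa>) = (\<integral>\<^sup>+x. \<integral>\<^sup>+z. f z \<partial>distr (\<kappa> x) borel (Pair x) \<partial>\<mu>)"
    unfolding kernel_plan_def by (rule nn_integral_bind[OF _ kernel_pair_measurable]) simp
  also have "\<dots> = (\<integral>\<^sup>+x. \<integral>\<^sup>+y. f (x, y) \<partial>\<kappa> x \<partial>\<mu>)"
    by (intro nn_integral_cong nn_integral_distr) (auto simp: measurable_cong_sets[OF sets_kernel refl])
  finally show ?thesis .
qed

lemma emeasure_kernel_plan:
  assumes "A \<in> sets borel" "B \<in> sets borel"
  shows "emeasure (kernel_plan \<mu> \<kappa>) (A \<times> B) = (\<integral>\<^sup>+x\<in>A. emeasure (\<kappa> x) B \<partial>\<mu>)"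
proof -
  have AB: "A \<times> B \<in> sets (borel :: (real \<times> real) measure)"
    using assms by (intro borel_Times)
  then have "emeasure (kernel_plan \<mu> \<kappa>) (A \<times> B) = (\<integral>\<^sup>+z. indicator (A \<times> B) z \<partial>kernel_plan \<mu> \<kappa>)"
    by (simp add: sets_kernel_plan)
  also have "\<dots> = (\<integral>\<^sup>+x. \<integral>\<^sup>+y. indicator A x * indicator B y \<partial>\<kappa> x \<partial>\<mu>)"
    using AB by (subst nn_integral_kernel_plan) (auto simp: indicator_times)
  also have "\<dots> = (\<integral>\<^sup>+x\<in>A. emeasure (\<kappa> x) B \<partial>\<mu>)"
    using assms sets_kernel
    by (intro nn_integral_cong) (simp add: nn_integral_cmult_indicator mult.commute)
  finally show ?thesis .
qed

end

text \<open>Rectangles form an intersection-stable generator, and the plan is finite because its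
  total mass is that of \<mu>, every \<open>\<kappa> x\<close> having mass 1.\<close>

lemma disintegration_unique_plan:
  assumes "disintegration \<pi> \<mu> \<kappa>" "finite_measure \<mu>" "sets \<mu> = sets borel" "sets \<pi> = sets borel"
  shows "\<pi> = kernel_plan \<mu> \<kappa>"
proof -
  have ker: "\<kappa> \<in> borel \<rightarrow>\<^sub>M prob_algebra borel"
    using assms(1) by (simp add: disintegration_def)
  have eq: "emeasure \<pi> (A \<times> B) = emeasure (kernel_plan \<mu> \<kappa>) (A \<times> B)"
    if "A \<in> sets borel" "B \<in> sets borel" for A B
    using assms(1) emeasure_kernel_plan[OF assms(3) ker that] that by (simp add: disintegration_def)
  have "emeasure \<pi> UNIV = emeasure \<mu> UNIV"
  proof -
    have "emeasure (\<kappa> x) UNIV = 1" for x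
      using prob_space.emeasure_space_1[OF prob_space_kernel[OF assms(3) ker, of x]]
        sets_eq_imp_space_eq[OF sets_kernel[OF assms(3) ker, of x]] by simp
    then have "emeasure (kernel_plan \<mu> \<kappa>) (UNIV \<times> UNIV) = emeasure \<mu> UNIV"
      by (subst emeasure_kernel_plan[OF assms(3) ker])
         (auto simp: space_kernel_base[OF assms(3) ker])
    then show ?thesis using eq[of UNIV UNIV] by simp
  qed
  then have "finite_measure \<pi>"
    using assms sets_eq_imp_space_eq[OF assms(4)] sets_eq_imp_space_eq[OF assms(3)]
    by (intro finite_measureI) (auto simp: finite_measure.emeasure_finite)
  then show ?thesis
    using assms(4) sets_kernel_plan[OF assms(3) ker] eq by (rule measure_eqI_rectangles)
qed

text \<open>For fixed \<open>t\<close>, the mass of \<open>A \<times> {..t}\<close> is a measure in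
  \<open>A\<close> that lies below \<mu>. The first marginal is required only to be below \<mu>, so
  that sub-couplings are covered as well.\<close>

lemma ex_conditional_cdf:
  assumes fin_mu: "finite_measure \<mu>" and sets_mu: "sets \<mu> = sets borel"
    and sets_pi: "sets \<pi> = sets (borel :: (real \<times> real) measure)"
    and le: "\<And>A. A \<in> sets borel \<Longrightarrow> emeasure \<pi> (A \<times> UNIV) \<le> emeasure \<mu> A"
  shows "\<exists>F :: real \<Rightarrow> real. F \<in> borel_measurable borel \<and> (\<forall>x. 0 \<le> F x \<and> F x \<le> 1) \<and>
     (\<forall>A\<in>sets borel. emeasure \<pi> (A \<times> {..t}) = (\<integral>\<^sup>+x\<in>A. F x \<partial>\<mu>)) \<and>
     (\<forall>A\<in>sets borel. measure \<pi> (A \<times> {..t}) = (\<integral>x. indicator A x * F x \<partial>\<mu>))"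
proof -
  have sp: "space \<pi> = UNIV" using sets_eq_imp_space_eq[OF sets_pi] by simp
  have fst: "fst \<in> \<pi> \<rightarrow>\<^sub>M borel"
    using sets_pi by (simp cong: measurable_cong_sets add: borel_prod[symmetric])
  have rect: "A \<times> B \<in> sets \<pi>" if "A \<in> sets borel" "B \<in> sets borel" for A B :: "real set"
    using that by (simp add: sets_pi borel_Times)
  define N where "N = distr (density \<pi> (indicator (UNIV \<times> {..t}))) borel fst"
  have emN: "emeasure N A = emeasure \<pi> (A \<times> {..t})" if "A \<in> sets borel" for A
  proof -
    have "emeasure N A = (\<integral>\<^sup>+z. indicator (UNIV \<times> {..t}) z * indicator (A \<times> UNIV) z \<partial>\<pi>)"
      unfolding N_def using that rect[OF that, of UNIV] rect[of UNIV "{..t}"] fst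
      by (subst emeasure_distr) (auto simp: emeasure_density vimage_fst sp)
    also have "\<dots> = (\<integral>\<^sup>+z. indicator (A \<times> {..t}) z \<partial>\<pi>)"
      by (intro nn_integral_cong) (auto split: split_indicator)
    finally show ?thesis using rect[OF that, of "{..t}"] by simp
  qed
  have setsN: "sets N = sets \<mu>" by (simp add: N_def sets_mu)
  have leN: "emeasure N A \<le> emeasure \<mu> A" if "A \<in> sets \<mu>" for A
  proof -
    have A: "A \<in> sets borel" using that by (simp add: sets_mu)
    have "emeasure \<pi> (A \<times> {..t}) \<le> emeasure \<pi> (A \<times> UNIV)"
      using rect[OF A, of UNIV] by (intro emeasure_mono) auto
    then show ?thesis using le[OF A] emN[OF A] by simp
  qed
  obtain g :: "real \<Rightarrow> real" where "g \<in> borel_measurable \<mu>" "\<And>x. 0 \<le> g x" "\<And>x. g x \<le> 1"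
    "\<And>A. A \<in> sets \<mu> \<Longrightarrow> emeasure N A = (\<integral>\<^sup>+x\<in>A. g x \<partial>\<mu>)"
    "\<And>A. A \<in> sets \<mu> \<Longrightarrow> measure N A = (\<integral>x. indicator A x * g x \<partial>\<mu>)"
    by (rule ex_bounded_density[OF fin_mu setsN], erule leN) (rule that, auto)
  moreover have "measure N A = measure \<pi> (A \<times> {..t})" if "A \<in> sets borel" for A
    using that by (simp add: measure_def emN)
  moreover have "borel_measurable \<mu> = (borel_measurable borel :: (real \<Rightarrow> real) set)"
    using sets_mu by (rule measurable_cong_sets) simp
  ultimately show ?thesis
    by (intro exI[of _ g]) (simp add: emN sets_mu)
qed

text \<open>The conditional distribution functions at rational thresholds are densities; they
  assemble to a kernel because they are monotone in the threshold off null sets and integrate to the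
  distribution function of the second marginal.\<close>

theorem ex_disintegration:
  assumes fin: "finite_measure \<pi>" and sets_pi[measurable_cong]: "sets \<pi> = sets (borel :: (real \<times> real) measure)"
  obtains \<kappa> where "disintegration \<pi> (distr \<pi> borel fst) \<kappa>"
proof -
  interpret finite_measure \<pi> by fact
  have sp[simp]: "space \<pi> = UNIV" using sets_eq_imp_space_eq[OF sets_pi] by simp
  define \<mu> where "\<mu> = distr \<pi> borel fst"
  have sets_mu[measurable_cong, simp]: "sets \<mu> = sets borel" by (simp add: \<mu>_def)
  have meas_fst[measurable]: "fst \<in> \<pi> \<rightarrow>\<^sub>M borel" and meas_snd[measurable]: "snd \<in> \<pi> \<rightarrow>\<^sub>M borel"
    using sets_pi by (simp_all cong: measurable_cong_sets add: borel_prod[symmetric])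
  have fin_mu: "finite_measure \<mu>" unfolding \<mu>_def by (rule finite_measure_distr) measurable
  have rect: "A \<times> B \<in> sets \<pi>" if "A \<in> sets borel" "B \<in> sets borel" for A B :: "real set"
    using that by (simp add: sets_pi borel_Times)
  have emmu: "emeasure \<mu> A = emeasure \<pi> (A \<times> UNIV)" if "A \<in> sets borel" for A
    unfolding \<mu>_def using that by (subst emeasure_distr) (auto simp: vimage_fst)
  define P where "P q F \<longleftrightarrow> F \<in> borel_measurable borel \<and> (\<forall>x. 0 \<le> F x \<and> F x \<le> 1) \<and>
     (\<forall>A\<in>sets borel. emeasure \<pi> (A \<times> {..of_rat q}) = (\<integral>\<^sup>+x\<in>A. F x \<partial>\<mu>)) \<and>
     (\<forall>A\<in>sets borel. measure \<pi> (A \<times> {..of_rat q}) = (\<integral>x. indicator A x * F x \<partial>\<mu>))"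
    for q and F :: "real \<Rightarrow> real"
  have "\<exists>F. P q F" for q
    unfolding P_def by (rule ex_conditional_cdf[OF fin_mu sets_mu sets_pi]) (simp add: emmu)
  then obtain F where "\<And>q. P q (F q)" by metis
  then have [measurable]: "\<And>q. F q \<in> borel_measurable borel"
    and bnd: "\<And>q x. 0 \<le> F q x \<and> F q x \<le> 1"
    and emF: "\<And>q A. A \<in> sets borel \<Longrightarrow> emeasure \<pi> (A \<times> {..of_rat q}) = (\<integral>\<^sup>+x\<in>A. F q x \<partial>\<mu>)"
    and mF: "\<And>q A. A \<in> sets borel \<Longrightarrow> measure \<pi> (A \<times> {..of_rat q}) = (\<integral>x. indicator A x * F q x \<partial>\<mu>)"
    unfolding P_def by blast+
  interpret mu: finite_measure \<mu> by fact
  have intF: "integrable \<mu> (F q)" for q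
    by (rule mu.integrable_const_bound[where B=1]) (use bnd in auto)
  have int_F: "(\<integral>x. F q x \<partial>\<mu>) = measure \<pi> (UNIV \<times> {..of_rat q})" for q
    using mF[of UNIV q] by simp
  \<comment> \<open>An inequality between the integrals over every \<open>A\<close> is an inequality
    between the densities almost everywhere.\<close>
  have mono: "AE x in \<mu>. F p x \<le> F q x" if pq: "p < q" for p q
  proof -
    have "AE x in \<mu>. 0 \<le> F q x - F p x"
    proof (rule mu.density_nonneg)
      show "integrable \<mu> (\<lambda>x. F q x - F p x)" using intF by simp
      fix A assume "A \<in> sets \<mu>"
      then have A[measurable]: "A \<in> sets borel" by simp
      have i: "integrable \<mu> (\<lambda>x. indicator A x * F q x)" for q
        using integrable_mult_indicator[OF _ intF[of q], of A] A by simp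
      have "set_lebesgue_integral \<mu> A (\<lambda>x. F q x - F p x) =
          measure \<pi> (A \<times> {..of_rat q}) - measure \<pi> (A \<times> {..of_rat p})"
        using i by (simp add: mF[OF A] set_lebesgue_integral_def right_diff_distrib)
      also have "\<dots> \<ge> 0"
      proof -
        have "real_of_rat p \<le> of_rat q" using pq by (simp add: of_rat_less_eq)
        then show ?thesis
          using rect[OF A, of "{..of_rat q}"] by (auto intro!: finite_measure_mono)
      qed
      finally show "0 \<le> set_lebesgue_integral \<mu> A (\<lambda>x. F q x - F p x)" .
    qed
    then show ?thesis by simp
  qed
  define \<nu> where "\<nu> = distr \<pi> borel snd"
  have fin_nu: "finite_measure \<nu>" unfolding \<nu>_def by (rule finite_measure_distr) measurable
  have em_nu: "emeasure \<nu> B = emeasure \<pi> (UNIV \<times> B)" if "B \<in> sets borel" for B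
    unfolding \<nu>_def using that by (subst emeasure_distr) (auto simp: vimage_snd)
  have marg: "(\<integral>x. F q x \<partial>\<mu>) = measure \<nu> {..of_rat q}" for q
    by (simp add: int_F measure_def em_nu)
  have mass: "measure \<nu> UNIV = measure \<mu> UNIV"
    by (simp add: measure_def em_nu emmu)
  obtain \<kappa> :: "real \<Rightarrow> real measure" where ker[measurable]: "\<kappa> \<in> borel \<rightarrow>\<^sub>M prob_algebra borel"
    and \<kappa>: "\<And>q. AE x in \<mu>. measure (\<kappa> x) {..of_rat q} = F q x"
    by (rule kernel_from_marginal_cdf[OF fin_mu sets_mu fin_nu _ mass _ bnd _ marg], simp add: \<nu>_def, simp, erule mono)
      (rule that, auto)
  have "emeasure \<pi> (A \<times> B) = (\<integral>\<^sup>+x\<in>A. emeasure (\<kappa> x) B \<partial>\<mu>)"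
    if A[measurable]: "A \<in> sets borel" and B: "B \<in> sets borel" for A B
  proof -
    have em_snd: "emeasure (distr (density P (indicator (A \<times> UNIV))) borel snd) B = emeasure P (A \<times> B)"
      if [measurable_cong]: "sets P = sets borel" and B[measurable]: "B \<in> sets borel"
      for P :: "(real \<times> real) measure" and B
    proof -
      have AB: "A \<times> B \<in> sets P" "A \<times> UNIV \<in> sets P" using A B that by (auto simp: borel_Times)
      have sP: "space P = UNIV" using sets_eq_imp_space_eq[OF that(1)] by simp
      have "snd -` B = (UNIV::real set) \<times> B" by auto
      moreover have "UNIV \<times> B \<in> sets P" using B that by (auto simp: borel_Times)
      moreover have "snd \<in> P \<rightarrow>\<^sub>M borel"
        using that(1) by (simp cong: measurable_cong_sets add: borel_prod[symmetric])
      ultimately have "emeasure (distr (density P (indicator (A \<times> UNIV))) borel snd) B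
         = (\<integral>\<^sup>+z. indicator (A \<times> UNIV) z * indicator (UNIV \<times> B) z \<partial>P)"
        using B AB by (subst emeasure_distr) (auto simp: emeasure_density sP)
      also have "\<dots> = (\<integral>\<^sup>+z. indicator (A \<times> B) z \<partial>P)"
        by (intro nn_integral_cong) (auto split: split_indicator)
      finally show ?thesis using AB by simp
    qed
    \<comment> \<open>For fixed \<open>A\<close> both sides are finite measures in the second
      coordinate, so agreement on rational rays suffices.\<close>
    have "distr (density \<pi> (indicator (A \<times> UNIV))) borel snd =
        distr (density (kernel_plan \<mu> \<kappa>) (indicator (A \<times> UNIV))) borel snd" (is "?L = ?R")
    proof (rule measure_eqI_atMost_rat)
      have "emeasure ?L UNIV < \<infinity>"
        using em_snd[OF sets_pi, of UNIV] emeasure_finite[of "A \<times> UNIV"] by (simp add: less_top[symmetric])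
      then show "finite_measure ?L" by (intro finite_measureI) simp
      show "emeasure ?L {..of_rat q} = emeasure ?R {..of_rat q}" for q
      proof -
        have "emeasure ?R {..of_rat q} = (\<integral>\<^sup>+x\<in>A. emeasure (\<kappa> x) {..of_rat q} \<partial>\<mu>)"
          using em_snd[OF sets_kernel_plan[OF sets_mu ker]] emeasure_kernel_plan[OF sets_mu ker A]
          by simp
        also have "\<dots> = (\<integral>\<^sup>+x\<in>A. F q x \<partial>\<mu>)"
          using \<kappa>[of q] prob_space_kernel[OF sets_mu ker]
          by (intro nn_integral_cong_AE)
             (auto simp: prob_space_def finite_measure.emeasure_eq_measure)
        also have "\<dots> = emeasure ?L {..of_rat q}"
          using em_snd[OF sets_pi] emF[OF A] by simp
        finally show ?thesis ..
      qed
    qed auto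
    then show ?thesis
      using em_snd[OF sets_pi B] em_snd[OF sets_kernel_plan[OF sets_mu ker] B]
        emeasure_kernel_plan[OF sets_mu ker A B] by simp
  qed
  then have "disintegration \<pi> \<mu> \<kappa>" using ker by (auto simp: disintegration_def)
  then show ?thesis using that by (simp add: \<mu>_def)
qed

section \<open>Martingale couplings\<close>

lemma finite_first_momentD:
  assumes "finite_first_moment \<mu>"
  shows "finite_measure \<mu>" "sets \<mu> = sets borel" "space \<mu> = UNIV" "integrable \<mu> (\<lambda>x. x)"
  using assms sets_eq_imp_space_eq[of \<mu> borel] by (auto simp: finite_first_moment_def)

text \<open>Fubini for a kernel, reduced to the nonnegative case by the parts \<open>P\<close> and
  \<open>N\<close>. The inner integral may diverge on a null set of \<open>x\<close>, so it equals
  the difference of the parts only almost everywhere.\<close>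

lemma integral_kernel_plan:
  fixes f :: "real \<times> real \<Rightarrow> real"
  assumes sets_mu[measurable_cong]: "sets \<mu> = sets borel" and ker: "\<kappa> \<in> borel \<rightarrow>\<^sub>M prob_algebra borel"
    and f[measurable]: "f \<in> borel_measurable borel" and int: "integrable (kernel_plan \<mu> \<kappa>) f"
  shows "AE x in \<mu>. integrable (\<kappa> x) (\<lambda>y. f (x, y))"
    and "integrable \<mu> (\<lambda>x. \<integral>y. f (x, y) \<partial>\<kappa> x)"
    and "(\<integral>z. f z \<partial>kernel_plan \<mu> \<kappa>) = (\<integral>x. \<integral>y. f (x, y) \<partial>\<kappa> x \<partial>\<mu>)"
proof -
  note sub[measurable] = measurable_prob_algebraD[OF ker]
  have sk: "sets (\<kappa> x) = sets borel" for x by (rule sets_kernel[OF sets_mu ker])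
  have sect: "(\<lambda>y. g (x, y)) \<in> borel_measurable (\<kappa> x)"
    if "g \<in> borel_measurable borel" for g :: "real \<times> real \<Rightarrow> ennreal" and x
    using that unfolding borel_prod[symmetric] by (simp cong: measurable_cong_sets add: sk)
  have sect': "(\<lambda>y. f (x, y)) \<in> borel_measurable (\<kappa> x)" for x
    using f unfolding borel_prod[symmetric] by (simp cong: measurable_cong_sets add: sk)
  have inner_meas: "(\<lambda>x. \<integral>\<^sup>+y. g (x, y) \<partial>\<kappa> x) \<in> borel_measurable \<mu>"
    if g: "g \<in> borel_measurable borel" for g :: "real \<times> real \<Rightarrow> ennreal"
  proof -
    have "(\<lambda>(x, y). g (x, y)) \<in> borel_measurable (borel \<Otimes>\<^sub>M borel)"
      using g by (simp add: borel_prod)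
    from nn_integral_measurable_subprob_algebra2[OF this sub] show ?thesis
      by (simp cong: measurable_cong_sets add: sets_mu)
  qed
  note nn = nn_integral_kernel_plan[OF sets_mu ker]
  have fin_abs: "(\<integral>\<^sup>+x. \<integral>\<^sup>+y. ennreal (norm (f (x, y))) \<partial>\<kappa> x \<partial>\<mu>) < \<infinity>"
    using int nn[of "\<lambda>z. ennreal (norm (f z))"] by (simp add: integrable_iff_bounded)
  have AE_fin: "AE x in \<mu>. (\<integral>\<^sup>+y. ennreal (norm (f (x, y))) \<partial>\<kappa> x) \<noteq> \<infinity>"
    using fin_abs by (intro nn_integral_noteq_infinite inner_meas) auto
  show AE_int: "AE x in \<mu>. integrable (\<kappa> x) (\<lambda>y. f (x, y))"
    using AE_fin by eventually_elim (auto simp: integrable_iff_bounded sect' top.not_eq_extremum)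
  define P where "P x = (\<integral>\<^sup>+y. ennreal (f (x, y)) \<partial>\<kappa> x)" for x
  define N where "N x = (\<integral>\<^sup>+y. ennreal (- f (x, y)) \<partial>\<kappa> x)" for x
  have [measurable]: "P \<in> borel_measurable \<mu>" "N \<in> borel_measurable \<mu>"
    unfolding P_def N_def using inner_meas[of "\<lambda>z. ennreal (f z)"] inner_meas[of "\<lambda>z. ennreal (- f z)"] by simp_all
  have AE_PN: "AE x in \<mu>. P x \<noteq> \<infinity> \<and> N x \<noteq> \<infinity> \<and> (\<integral>y. f (x, y) \<partial>\<kappa> x) = enn2real (P x) - enn2real (N x)"
    using AE_int by eventually_elim (auto simp: real_lebesgue_integral_def real_integrable_def P_def N_def)
  have IP: "(\<integral>\<^sup>+x. P x \<partial>\<mu>) = (\<integral>\<^sup>+z. ennreal (f z) \<partial>kernel_plan \<mu> \<kappa>)"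
    and IN: "(\<integral>\<^sup>+x. N x \<partial>\<mu>) = (\<integral>\<^sup>+z. ennreal (- f z) \<partial>kernel_plan \<mu> \<kappa>)"
    unfolding P_def N_def by (simp_all add: nn)
  have fin_PN: "(\<integral>\<^sup>+x. P x \<partial>\<mu>) \<noteq> \<infinity>" "(\<integral>\<^sup>+x. N x \<partial>\<mu>) \<noteq> \<infinity>"
    using int unfolding IP IN by (simp_all add: real_integrable_def)
  have enn: "(\<integral>\<^sup>+x. ennreal (enn2real (Q x)) \<partial>\<mu>) = (\<integral>\<^sup>+x. Q x \<partial>\<mu>)" if "AE x in \<mu>. Q x \<noteq> \<infinity>" for Q
    using that by (intro nn_integral_cong_AE) (auto elim!: eventually_mono simp: less_top)
  have iP: "integrable \<mu> (\<lambda>x. enn2real (P x))" and iN: "integrable \<mu> (\<lambda>x. enn2real (N x))"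
    using enn[of P] enn[of N] AE_PN fin_PN
    by (auto intro!: integrableI_nonneg simp: less_top)
  have eP: "(\<integral>x. enn2real (P x) \<partial>\<mu>) = enn2real (\<integral>\<^sup>+x. P x \<partial>\<mu>)"
    and eN: "(\<integral>x. enn2real (N x) \<partial>\<mu>) = enn2real (\<integral>\<^sup>+x. N x \<partial>\<mu>)"
    using enn[of P] enn[of N] AE_PN by (auto simp: integral_eq_nn_integral)
  \<comment> \<open>Agreement almost everywhere with a function of \<open>P\<close> and
    \<open>N\<close> does not by itself make the inner integral measurable, so this is shown
    directly.\<close>
  have inner_borel[measurable]: "(\<lambda>x. \<integral>y. f (x, y) \<partial>\<kappa> x) \<in> borel_measurable \<mu>"
  proof -
    have "(\<lambda>x. \<integral>z. f z \<partial>distr (\<kappa> x) borel (Pair x)) \<in> borel_measurable \<mu>"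
      by (rule measurable_compose[OF kernel_pair_measurable[OF sets_mu ker] integral_measurable_subprob_algebra]) simp
    moreover have "(\<integral>z. f z \<partial>distr (\<kappa> x) borel (Pair x)) = (\<integral>y. f (x, y) \<partial>\<kappa> x)" for x
      by (rule integral_distr) (simp_all add: measurable_cong_sets[OF sk refl])
    ultimately show ?thesis by simp
  qed
  show "integrable \<mu> (\<lambda>x. \<integral>y. f (x, y) \<partial>\<kappa> x)"
  proof (rule integrable_cong_AE_imp)
    show "integrable \<mu> (\<lambda>x. enn2real (P x) - enn2real (N x))" using iP iN by simp
    show "AE x in \<mu>. enn2real (P x) - enn2real (N x) = (\<integral>y. f (x, y) \<partial>\<kappa> x)"
      using AE_PN by eventually_elim simp
  qed simp
  have "(\<integral>x. \<integral>y. f (x, y) \<partial>\<kappa> x \<partial>\<mu>) = (\<integral>x. enn2real (P x) - enn2real (N x) \<partial>\<mu>)"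
    using AE_PN by (intro integral_cong_AE) auto
  also have "\<dots> = enn2real (\<integral>\<^sup>+x. P x \<partial>\<mu>) - enn2real (\<integral>\<^sup>+x. N x \<partial>\<mu>)"
    using iP iN by (simp add: eP eN)
  also have "\<dots> = (\<integral>z. f z \<partial>kernel_plan \<mu> \<kappa>)"
    using int by (simp add: IP IN real_lebesgue_integral_def)
  finally show "(\<integral>z. f z \<partial>kernel_plan \<mu> \<kappa>) = (\<integral>x. \<integral>y. f (x, y) \<partial>\<kappa> x \<partial>\<mu>)" ..
qed

text \<open>The positive and negative parts of \<open>h\<close> are densities of two finite measures
  that agree on rational rays, hence on all Borel sets. Countably many tests thus decide whether a
  conditional mean vanishes.\<close>

lemma AE_eq_0_if_integral_atMost_eq_0:
  fixes h :: "real \<Rightarrow> real"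
  assumes "finite_measure M" and setsM[measurable_cong]: "sets M = sets borel" and int: "integrable M h"
    and zero: "\<And>q::rat. (\<integral>x. indicator {..of_rat q} x * h x \<partial>M) = 0"
  shows "AE x in M. h x = 0"
proof -
  interpret finite_measure M by fact
  have [measurable]: "h \<in> borel_measurable M" using int by simp
  have spM: "space M = UNIV" using sets_eq_imp_space_eq[OF setsM] by simp
  \<comment> \<open>With \<open>c\<close> equal to 1 or -1 this covers the positive and the negative
    part.\<close>
  have em: "emeasure (density M (\<lambda>x. ennreal (c * h x))) A = ennreal (\<integral>x. indicator A x * max 0 (c * h x) \<partial>M)"
    and iA: "integrable M (\<lambda>x. indicator A x * max 0 (c * h x))"
    if [measurable]: "A \<in> sets borel" for A c
  proof -
    show *: "integrable M (\<lambda>x. indicator A x * max 0 (c * h x))"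
      using int by (intro Bochner_Integration.integrable_bound[OF integrable_mult_right[OF int, of c]])
        (auto simp: indicator_def abs_mult intro!: AE_I2 order_trans[OF abs_ge_self eq_refl])
    show "emeasure (density M (\<lambda>x. ennreal (c * h x))) A = ennreal (\<integral>x. indicator A x * max 0 (c * h x) \<partial>M)"
      by (subst nn_integral_eq_integral[symmetric, OF *])
         (auto simp: emeasure_density setsM intro!: nn_integral_cong split: split_indicator)
  qed
  have diff: "(\<integral>x. indicator A x * max 0 (1 * h x) \<partial>M) - (\<integral>x. indicator A x * max 0 (-1 * h x) \<partial>M)
      = (\<integral>x. indicator A x * h x \<partial>M)" if "A \<in> sets borel" for A
    by (subst Bochner_Integration.integral_diff[symmetric, OF iA[OF that] iA[OF that]])
       (auto intro!: Bochner_Integration.integral_cong simp: indicator_def)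
  have eq: "density M (\<lambda>x. ennreal (1 * h x)) = density M (\<lambda>x. ennreal (-1 * h x))"
  proof (rule measure_eqI_atMost_rat)
    show "finite_measure (density M (\<lambda>x. ennreal (1 * h x)))"
      using em[of UNIV 1] by (intro finite_measureI) (auto simp: spM)
    show "emeasure (density M (\<lambda>x. ennreal (1 * h x))) {..of_rat q}
        = emeasure (density M (\<lambda>x. ennreal (-1 * h x))) {..of_rat q}" for q
      using zero[of q] diff[of "{..of_rat q}"] by (simp only: em[of "{..of_rat q}"] atMost_borel) simp
  qed (auto simp: setsM)
  show ?thesis
  proof (rule density_zero[OF int])
    fix A assume "A \<in> sets M"
    then have A: "A \<in> sets borel" by (simp add: setsM)
    have "ennreal (\<integral>x. indicator A x * max 0 (1 * h x) \<partial>M) = ennreal (\<integral>x. indicator A x * max 0 (-1 * h x) \<partial>M)"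
      using em[OF A, of 1] em[OF A, of "-1"] eq by metis
    then have "(\<integral>x. indicator A x * max 0 (1 * h x) \<partial>M) = (\<integral>x. indicator A x * max 0 (-1 * h x) \<partial>M)"
      by (subst (asm) ennreal_inj) (auto intro!: Bochner_Integration.integral_nonneg)
    then show "set_lebesgue_integral M A h = 0"
      using diff[OF A] by (simp add: set_lebesgue_integral_def)
  qed
qed

section \<open>Couplings and the martingale constraints as linear equations\<close>

definition couplings :: "real measure \<Rightarrow> real measure \<Rightarrow> (real \<times> real) measure set" where
  "couplings \<mu> \<nu> = {\<pi>. sets \<pi> = sets borel \<and> distr \<pi> borel fst = \<mu> \<and> distr \<pi> borel snd = \<nu>}"

lemma measurable_fst_snd_borel:
  assumes "sets \<pi> = sets (borel :: (real \<times> real) measure)"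
  shows "fst \<in> \<pi> \<rightarrow>\<^sub>M borel" "snd \<in> \<pi> \<rightarrow>\<^sub>M borel"
  using assms by (simp_all cong: measurable_cong_sets add: borel_prod[symmetric])

lemma couplingsI:
  assumes "sets \<pi> = sets borel" "sets \<mu> = sets borel" "sets \<nu> = sets borel"
    and "\<And>A. A \<in> sets borel \<Longrightarrow> emeasure \<pi> (A \<times> UNIV) = emeasure \<mu> A"
    and "\<And>B. B \<in> sets borel \<Longrightarrow> emeasure \<pi> (UNIV \<times> B) = emeasure \<nu> B"
  shows "\<pi> \<in> couplings \<mu> \<nu>"
proof -
  have sp: "space \<pi> = UNIV" using sets_eq_imp_space_eq[OF assms(1)] by simp
  show ?thesis
    unfolding couplings_def using assms measurable_fst_snd_borel[OF assms(1)]
    by (auto intro!: measure_eqI simp: emeasure_distr sp vimage_fst vimage_snd)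
qed

context
  fixes \<mu> \<nu> :: "real measure" and \<pi> :: "(real \<times> real) measure"
  assumes mom: "finite_first_moment \<mu>" "finite_first_moment \<nu>" and coup: "\<pi> \<in> couplings \<mu> \<nu>"
begin

lemma sets_coupling: "sets \<pi> = sets borel" and distr_fst_coupling: "distr \<pi> borel fst = \<mu>"
  and distr_snd_coupling: "distr \<pi> borel snd = \<nu>"
  using coup by (auto simp: couplings_def)

lemmas measurable_coupling = measurable_fst_snd_borel[OF sets_coupling]

lemma space_coupling: "space \<pi> = UNIV"
  using sets_eq_imp_space_eq[OF sets_coupling] by simp

lemma emeasure_coupling_fst: "A \<in> sets borel \<Longrightarrow> emeasure \<pi> (A \<times> UNIV) = emeasure \<mu> A"
  and emeasure_coupling_snd: "A \<in> sets borel \<Longrightarrow> emeasure \<pi> (UNIV \<times> A) = emeasure \<nu> A"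
  unfolding distr_fst_coupling[symmetric] distr_snd_coupling[symmetric]
  using measurable_coupling by (auto simp: emeasure_distr space_coupling vimage_fst vimage_snd)

lemma finite_measure_coupling: "finite_measure \<pi>"
  using emeasure_coupling_fst[of UNIV] finite_first_momentD[OF mom(1)]
  by (intro finite_measureI) (auto simp: space_coupling finite_measure.emeasure_finite)

lemma integrable_coupling_fst: "integrable \<pi> fst" and integrable_coupling_snd: "integrable \<pi> snd"
proof -
  have "integrable (distr \<pi> borel fst) (\<lambda>x. x)" "integrable (distr \<pi> borel snd) (\<lambda>x. x)"
    unfolding distr_fst_coupling distr_snd_coupling
    by (rule finite_first_momentD(4)[OF mom(1)] finite_first_momentD(4)[OF mom(2)])+
  then show "integrable \<pi> fst" "integrable \<pi> snd"
    using integrable_distr[OF measurable_coupling(1), of "\<lambda>x. x"]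
      integrable_distr[OF measurable_coupling(2), of "\<lambda>x. x"] by blast+
qed

lemma integrable_coupling_diff: "integrable \<pi> (\<lambda>z. snd z - fst z)"
  using integrable_coupling_fst integrable_coupling_snd by simp

lemma integrable_coupling_indicator_diff:
  assumes "A \<in> sets borel"
  shows "integrable \<pi> (\<lambda>z. indicator A (fst z) * (snd z - fst z))"
proof -
  note [measurable] = measurable_coupling assms
  show ?thesis
    by (rule Bochner_Integration.integrable_bound[OF integrable_coupling_diff]) (auto simp: indicator_def)
qed

text \<open>The constraints say that \<open>h x\<close>, the barycentre of \<open>\<kappa> x\<close>
  minus \<open>x\<close>, integrates to zero over every rational ray; hence it vanishes almost
  everywhere.\<close>

lemma kernel_barycentre:
  assumes ker: "\<kappa> \<in> borel \<rightarrow>\<^sub>M prob_algebra borel" and eq: "\<pi> = kernel_plan \<mu> \<kappa>"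
    and zero: "\<And>q::rat. (\<integral>z. indicator {..of_rat q} (fst z) * (snd z - fst z) \<partial>\<pi>) = 0"
  shows "AE x in \<mu>. integrable (\<kappa> x) (\<lambda>y. y) \<and> (\<integral>y. y \<partial>\<kappa> x) = x"
proof -
  note \<mu> = finite_first_momentD[OF mom(1)]
  have [measurable]: "fst \<in> borel_measurable (borel :: (real \<times> real) measure)" "snd \<in> borel_measurable (borel :: (real \<times> real) measure)"
    by (rule measurable_fst_snd_borel[OF refl])+
  note I = integral_kernel_plan[OF \<mu>(2) ker, folded eq]
  define h where "h x = (\<integral>y. y - x \<partial>\<kappa> x)" for x
  have D: "AE x in \<mu>. integrable (\<kappa> x) (\<lambda>y. y - x)" "integrable \<mu> h"
    using I(1,2)[OF _ integrable_coupling_diff] by (simp_all add: h_def[abs_def])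
  have "AE x in \<mu>. h x = 0"
  proof (rule AE_eq_0_if_integral_atMost_eq_0[OF \<mu>(1,2) D(2)])
    fix q :: rat
    have "(\<integral>z. indicator {..of_rat q} (fst z) * (snd z - fst z) \<partial>\<pi>) =
        (\<integral>x. \<integral>y. indicator {..of_rat q} x * (y - x) \<partial>\<kappa> x \<partial>\<mu>)"
      using I(3)[OF _ integrable_coupling_indicator_diff[of "{..of_rat q}"]] by simp
    then show "(\<integral>x. indicator {..of_rat q} x * h x \<partial>\<mu>) = 0"
      using zero[of q] by (simp add: h_def)
  qed
  then show ?thesis
    using D(1)
  proof eventually_elim
    case (elim x)
    interpret prob_space "\<kappa> x" by (rule prob_space_kernel[OF \<mu>(2) ker])
    have "integrable (\<kappa> x) (\<lambda>y. (y - x) + x)"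
      using elim(2) by (intro Bochner_Integration.integrable_add) auto
    then have i: "integrable (\<kappa> x) (\<lambda>y. y)" by simp
    then have "h x = (\<integral>y. y \<partial>\<kappa> x) - x"
      unfolding h_def by (simp add: prob_space)
    then show ?case using i elim(1) by simp
  qed
qed

text \<open>The martingale property becomes a countable family of linear equations in the plan. In
  this form it passes to limits, exchanges and averages.\<close>

lemma martingale_planI:
  assumes zero: "\<And>q::rat. (\<integral>z. indicator {..of_rat q} (fst z) * (snd z - fst z) \<partial>\<pi>) = 0"
  shows "\<pi> \<in> martingale_plans \<mu> \<nu>"
proof -
  note \<mu> = finite_first_momentD[OF mom(1)]
  obtain \<kappa> where \<kappa>: "disintegration \<pi> \<mu> \<kappa>"
    using ex_disintegration[OF finite_measure_coupling sets_coupling] by (auto simp: distr_fst_coupling)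
  have ker: "\<kappa> \<in> borel \<rightarrow>\<^sub>M prob_algebra borel" using \<kappa> by (simp add: disintegration_def)
  have eq: "\<pi> = kernel_plan \<mu> \<kappa>"
    by (rule disintegration_unique_plan[OF \<kappa> \<mu>(1,2) sets_coupling])
  show ?thesis
    using \<kappa> kernel_barycentre[OF ker eq zero] sets_coupling distr_fst_coupling distr_snd_coupling
    by (auto simp: martingale_plans_def)
qed

end

lemma martingale_planD:
  assumes mom: "finite_first_moment \<mu>" "finite_first_moment \<nu>" and \<pi>: "\<pi> \<in> martingale_plans \<mu> \<nu>"
  obtains \<kappa> where "\<pi> \<in> couplings \<mu> \<nu>" "\<kappa> \<in> borel \<rightarrow>\<^sub>M prob_algebra borel" "\<pi> = kernel_plan \<mu> \<kappa>"
    "AE x in \<mu>. integrable (\<kappa> x) (\<lambda>y. y) \<and> (\<integral>y. y \<partial>\<kappa> x) = x"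
proof -
  have c: "\<pi> \<in> couplings \<mu> \<nu>" using \<pi> by (auto simp: martingale_plans_def couplings_def)
  obtain \<kappa> where \<kappa>: "disintegration \<pi> \<mu> \<kappa>" "AE x in \<mu>. integrable (\<kappa> x) (\<lambda>y. y) \<and> (\<integral>y. y \<partial>\<kappa> x) = x"
    using \<pi> by (auto simp: martingale_plans_def)
  show ?thesis
    using that[OF c _ _ \<kappa>(2)] \<kappa>(1) disintegration_unique_plan[OF \<kappa>(1)] finite_first_momentD[OF mom(1)]
      sets_coupling[OF mom c] by (auto simp: disintegration_def)
qed

text \<open>The converse of \<open>martingale_planI\<close>, by which the constraints of given plans
  are handed on to limits and averages.\<close>

lemma martingale_plan_integral_zero:
  assumes mom: "finite_first_moment \<mu>" "finite_first_moment \<nu>" and \<pi>: "\<pi> \<in> martingale_plans \<mu> \<nu>"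
    and A: "A \<in> sets borel"
  shows "(\<integral>z. indicator A (fst z) * (snd z - fst z) \<partial>\<pi>) = 0"
proof -
  obtain \<kappa> where c: "\<pi> \<in> couplings \<mu> \<nu>" and ker: "\<kappa> \<in> borel \<rightarrow>\<^sub>M prob_algebra borel"
    and eq: "\<pi> = kernel_plan \<mu> \<kappa>" and bary: "AE x in \<mu>. integrable (\<kappa> x) (\<lambda>y. y) \<and> (\<integral>y. y \<partial>\<kappa> x) = x"
    by (rule martingale_planD[OF mom \<pi>])
  note \<mu> = finite_first_momentD[OF mom(1)]
  have [measurable]: "fst \<in> borel_measurable (borel :: (real \<times> real) measure)" "snd \<in> borel_measurable (borel :: (real \<times> real) measure)"
    by (rule measurable_fst_snd_borel[OF refl])+
  note I = integral_kernel_plan[OF \<mu>(2) ker, folded eq]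
  note ii = integrable_coupling_indicator_diff[OF mom c A]
  have "(\<integral>z. indicator A (fst z) * (snd z - fst z) \<partial>\<pi>) = (\<integral>x. \<integral>y. indicator A x * (y - x) \<partial>\<kappa> x \<partial>\<mu>)"
    using I(3)[OF _ ii] A by simp
  also have "\<dots> = (\<integral>x. 0 \<partial>\<mu>)"
  proof (rule integral_cong_AE)
    show "AE x in \<mu>. (\<integral>y. indicator A x * (y - x) \<partial>\<kappa> x) = 0"
      using bary
    proof eventually_elim
      case (elim x)
      interpret prob_space "\<kappa> x" by (rule prob_space_kernel[OF \<mu>(2) ker])
      show ?case using elim by (simp add: prob_space)
    qed
    show "(\<lambda>x. \<integral>y. indicator A x * (y - x) \<partial>\<kappa> x) \<in> borel_measurable \<mu>"
      using I(2)[OF _ ii] A by simp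
  qed simp
  finally show ?thesis by simp
qed

section \<open>Couplings and tail integrals\<close>

text \<open>The positive part of \<open>b - a\<close> is the length of \<open>{a..<b}\<close>, and
  Fubini exchanges this length with the measure. The half-open interval produces the sets
  \<open>{..t}\<close> and \<open>{t<..}\<close>, on which couplings will be known to
  converge.\<close>

lemma
  fixes a b :: "'a \<Rightarrow> real"
  assumes M: "sigma_finite_measure M" and [measurable]: "a \<in> borel_measurable M" "b \<in> borel_measurable M"
  shows nn_integral_layer_cake:
      "(\<integral>\<^sup>+z. ennreal (b z - a z) \<partial>M) = (\<integral>\<^sup>+t. emeasure M {z\<in>space M. a z \<le> t \<and> t < b z} \<partial>lborel)"
    and measurable_layer_cake: "(\<lambda>t. emeasure M {z\<in>space M. a z \<le> t \<and> t < b z}) \<in> borel_measurable lborel"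
proof -
  interpret M: sigma_finite_measure M by fact
  interpret pair_sigma_finite M lborel ..
  define f :: "'a \<times> real \<Rightarrow> ennreal" where "f = (\<lambda>(z, t). indicator {z. a (fst z) \<le> snd z \<and> snd z < b (fst z)} (z, t))"
  have f[measurable]: "f \<in> borel_measurable (M \<Otimes>\<^sub>M lborel)"
  proof -
    have [measurable]: "Measurable.pred (M \<Otimes>\<^sub>M lborel) (\<lambda>z. a (fst z) \<le> snd z \<and> snd z < b (fst z))"
      by measurable
    have "(\<lambda>z. indicator {z. a (fst z) \<le> snd z \<and> snd z < b (fst z)} z :: ennreal) \<in> borel_measurable (M \<Otimes>\<^sub>M lborel)"
      by (simp add: indicator_def)
    then show ?thesis by (simp add: f_def case_prod_beta')
  qed
  have 1: "(\<integral>\<^sup>+z. f (z, t) \<partial>M) = emeasure M {z\<in>space M. a z \<le> t \<and> t < b z}" for t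
  proof -
    have "(\<integral>\<^sup>+z. f (z, t) \<partial>M) = (\<integral>\<^sup>+z. indicator {z\<in>space M. a z \<le> t \<and> t < b z} z \<partial>M)"
      by (intro nn_integral_cong) (auto simp: f_def split: split_indicator)
    then show ?thesis by simp
  qed
  have 2: "(\<integral>\<^sup>+t. f (z, t) \<partial>lborel) = ennreal (b z - a z)" for z
  proof -
    have "(\<integral>\<^sup>+t. f (z, t) \<partial>lborel) = (\<integral>\<^sup>+t. indicator {a z..<b z} t \<partial>lborel)"
      by (intro nn_integral_cong) (auto simp: f_def split: split_indicator)
    then show ?thesis by (cases "a z \<le> b z") (auto simp: ennreal_neg)
  qed
  show "(\<integral>\<^sup>+z. ennreal (b z - a z) \<partial>M) = (\<integral>\<^sup>+t. emeasure M {z\<in>space M. a z \<le> t \<and> t < b z} \<partial>lborel)"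
    using Fubini[OF f] by (simp add: 1 2)
  have "(\<lambda>t. \<integral>\<^sup>+z. f (z, t) \<partial>M) \<in> borel_measurable lborel"
    using measurable_pair_swap[OF f] by (rule M.borel_measurable_nn_integral)
  then show "(\<lambda>t. emeasure M {z\<in>space M. a z \<le> t \<and> t < b z}) \<in> borel_measurable lborel"
    by (simp add: 1)
qed

text \<open>Gluing an approximate splitting misses some mass, so the marginals are bounded from
  above only. Upper bounds are also what a tail estimate common to all plans requires.\<close>

definition sub_couplings :: "real measure \<Rightarrow> real measure \<Rightarrow> (real \<times> real) measure set" where
  "sub_couplings \<mu> \<nu> = {\<pi>. sets \<pi> = sets borel \<and>
     (\<forall>A\<in>sets borel. emeasure \<pi> (A \<times> UNIV) \<le> emeasure \<mu> A) \<and>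
     (\<forall>B\<in>sets borel. emeasure \<pi> (UNIV \<times> B) \<le> emeasure \<nu> B)}"

lemma sub_couplingsD:
  assumes "\<pi> \<in> sub_couplings \<mu> \<nu>"
  shows "sets \<pi> = sets borel" "space \<pi> = UNIV"
    "A \<in> sets borel \<Longrightarrow> emeasure \<pi> (A \<times> UNIV) \<le> emeasure \<mu> A"
    "A \<in> sets borel \<Longrightarrow> emeasure \<pi> (UNIV \<times> A) \<le> emeasure \<nu> A"
  using assms sets_eq_imp_space_eq[of \<pi> borel] by (auto simp: sub_couplings_def)

lemma coupling_is_sub_coupling:
  assumes "finite_first_moment \<mu>" "finite_first_moment \<nu>" "\<pi> \<in> couplings \<mu> \<nu>"
  shows "\<pi> \<in> sub_couplings \<mu> \<nu>"
  using emeasure_coupling_fst[OF assms] emeasure_coupling_snd[OF assms] sets_coupling[OF assms]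
  by (auto simp: sub_couplings_def)

lemma finite_measure_sub_coupling:
  assumes "finite_measure \<mu>" "\<pi> \<in> sub_couplings \<mu> \<nu>"
  shows "finite_measure \<pi>"
proof (rule finite_measureI)
  have "emeasure \<pi> (UNIV \<times> UNIV) \<le> emeasure \<mu> UNIV"
    using assms(2) by (intro sub_couplingsD) auto
  then show "emeasure \<pi> (space \<pi>) \<noteq> \<infinity>"
    using finite_measure.emeasure_finite[OF assms(1), of UNIV] sub_couplingsD(2)[OF assms(2)]
    by (auto simp: top_unique)
qed

lemma emeasure_sub_coupling_le:
  assumes "\<pi> \<in> sub_couplings \<mu> \<nu>" "A \<in> sets borel" "B \<in> sets borel"
  shows "emeasure \<pi> (A \<times> B) \<le> emeasure \<mu> A" "emeasure \<pi> (A \<times> B) \<le> emeasure \<nu> B"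
proof -
  have "emeasure \<pi> (A \<times> B) \<le> emeasure \<pi> (A \<times> UNIV)" "emeasure \<pi> (A \<times> B) \<le> emeasure \<pi> (UNIV \<times> B)"
    using assms by (auto intro!: emeasure_mono simp: sub_couplingsD(1) borel_Times)
  then show "emeasure \<pi> (A \<times> B) \<le> emeasure \<mu> A" "emeasure \<pi> (A \<times> B) \<le> emeasure \<nu> B"
    using sub_couplingsD(3,4)[OF assms(1)] assms(2,3) order_trans by blast+
qed

context
  fixes \<mu> \<nu> :: "real measure"
  assumes mom: "finite_first_moment \<mu>" "finite_first_moment \<nu>"
begin

lemmas fst_moment = finite_first_momentD[OF mom(1)] and snd_moment = finite_first_momentD[OF mom(2)]

lemma layer_up:
  assumes \<pi>: "\<pi> \<in> sub_couplings \<mu> \<nu>" and [measurable]: "H \<in> sets borel"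
  shows "(\<integral>\<^sup>+z. ennreal (indicator H (fst z) * (snd z - fst z)) \<partial>\<pi>) =
      (\<integral>\<^sup>+t. emeasure \<pi> ((H \<inter> {..t}) \<times> {t<..}) \<partial>lborel)"
    and "(\<lambda>t. emeasure \<pi> ((H \<inter> {..t}) \<times> {t<..})) \<in> borel_measurable lborel"
proof -
  note [measurable] = measurable_fst_snd_borel[OF sub_couplingsD(1)[OF \<pi>]]
  interpret finite_measure \<pi> by (rule finite_measure_sub_coupling[OF fst_moment(1) \<pi>])
  have sf: "sigma_finite_measure \<pi>" ..
  \<comment> \<open>Outside \<open>H\<close> both end points are \<open>fst z\<close>, so that such
    points contribute no layer.\<close>
  let ?b = "\<lambda>z. if fst z \<in> H then snd z else fst z"
  have eq: "{z \<in> space \<pi>. fst z \<le> t \<and> t < ?b z} = (H \<inter> {..t}) \<times> {t<..}" for t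
    by (auto simp: sub_couplingsD(2)[OF \<pi>] split: if_splits)
  have "(\<integral>\<^sup>+z. ennreal (indicator H (fst z) * (snd z - fst z)) \<partial>\<pi>) = (\<integral>\<^sup>+z. ennreal (?b z - fst z) \<partial>\<pi>)"
    by (intro nn_integral_cong) (auto simp: indicator_def)
  then show "(\<integral>\<^sup>+z. ennreal (indicator H (fst z) * (snd z - fst z)) \<partial>\<pi>) =
      (\<integral>\<^sup>+t. emeasure \<pi> ((H \<inter> {..t}) \<times> {t<..}) \<partial>lborel)"
    by (subst (asm) nn_integral_layer_cake[OF sf]) (simp_all add: eq)
  show "(\<lambda>t. emeasure \<pi> ((H \<inter> {..t}) \<times> {t<..})) \<in> borel_measurable lborel"
    using measurable_layer_cake[OF sf, of fst ?b] by (simp add: eq)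
qed

lemma layer_down:
  assumes \<pi>: "\<pi> \<in> sub_couplings \<mu> \<nu>" and [measurable]: "H \<in> sets borel"
  shows "(\<integral>\<^sup>+z. ennreal (- (indicator H (fst z) * (snd z - fst z))) \<partial>\<pi>) =
      (\<integral>\<^sup>+t. emeasure \<pi> ((H \<inter> {t<..}) \<times> {..t}) \<partial>lborel)"
    and "(\<lambda>t. emeasure \<pi> ((H \<inter> {t<..}) \<times> {..t})) \<in> borel_measurable lborel"
proof -
  note [measurable] = measurable_fst_snd_borel[OF sub_couplingsD(1)[OF \<pi>]]
  interpret finite_measure \<pi> by (rule finite_measure_sub_coupling[OF fst_moment(1) \<pi>])
  have sf: "sigma_finite_measure \<pi>" ..
  let ?a = "\<lambda>z. if fst z \<in> H then snd z else fst z"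
  have eq: "{z \<in> space \<pi>. ?a z \<le> t \<and> t < fst z} = (H \<inter> {t<..}) \<times> {..t}" for t
    by (auto simp: sub_couplingsD(2)[OF \<pi>] split: if_splits)
  have "(\<integral>\<^sup>+z. ennreal (- (indicator H (fst z) * (snd z - fst z))) \<partial>\<pi>) = (\<integral>\<^sup>+z. ennreal (fst z - ?a z) \<partial>\<pi>)"
    by (intro nn_integral_cong) (auto simp: indicator_def)
  then show "(\<integral>\<^sup>+z. ennreal (- (indicator H (fst z) * (snd z - fst z))) \<partial>\<pi>) =
      (\<integral>\<^sup>+t. emeasure \<pi> ((H \<inter> {t<..}) \<times> {..t}) \<partial>lborel)"
    by (subst (asm) nn_integral_layer_cake[OF sf]) (simp_all add: eq)
  show "(\<lambda>t. emeasure \<pi> ((H \<inter> {t<..}) \<times> {..t})) \<in> borel_measurable lborel"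
    using measurable_layer_cake[OF sf, of ?a fst] by (simp add: eq)
qed

lemma tail_integrable:
  assumes "finite_first_moment \<rho>"
  shows "(\<integral>\<^sup>+t. emeasure \<rho> {y. 0 \<le> t \<and> t < y} \<partial>lborel) < \<infinity>"
    "(\<lambda>t. emeasure \<rho> {y. 0 \<le> t \<and> t < y}) \<in> borel_measurable lborel"
    "(\<integral>\<^sup>+t. emeasure \<rho> {x. x \<le> t \<and> t < 0} \<partial>lborel) < \<infinity>"
    "(\<lambda>t. emeasure \<rho> {x. x \<le> t \<and> t < 0}) \<in> borel_measurable lborel"
proof -
  note \<rho> = finite_first_momentD[OF assms]
  interpret finite_measure \<rho> by (rule \<rho>(1))
  have sf: "sigma_finite_measure \<rho>" ..
  have [measurable]: "(\<lambda>x. x) \<in> borel_measurable \<rho>" using \<rho>(4) by (rule borel_measurable_integrable)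
  have 1: "(\<integral>\<^sup>+y. ennreal (y - 0) \<partial>\<rho>) < \<infinity>" "(\<integral>\<^sup>+y. ennreal (0 - y) \<partial>\<rho>) < \<infinity>"
    using \<rho>(4) by (auto simp: real_integrable_def less_top)
  show "(\<integral>\<^sup>+t. emeasure \<rho> {y. 0 \<le> t \<and> t < y} \<partial>lborel) < \<infinity>"
    "(\<integral>\<^sup>+t. emeasure \<rho> {x. x \<le> t \<and> t < 0} \<partial>lborel) < \<infinity>"
    using 1 nn_integral_layer_cake[OF sf, of "\<lambda>_. 0" "\<lambda>y. y"] nn_integral_layer_cake[OF sf, of "\<lambda>y. y" "\<lambda>_. 0"]
    by (simp_all add: \<rho>(3))
  show "(\<lambda>t. emeasure \<rho> {y. 0 \<le> t \<and> t < y}) \<in> borel_measurable lborel"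
    "(\<lambda>t. emeasure \<rho> {x. x \<le> t \<and> t < 0}) \<in> borel_measurable lborel"
    using measurable_layer_cake[OF sf, of "\<lambda>_. 0" "\<lambda>y. y"] measurable_layer_cake[OF sf, of "\<lambda>y. y" "\<lambda>_. 0"]
    by (simp_all add: \<rho>(3))
qed

text \<open>A majorant for the layers of all sub-couplings at once, integrable in \<open>t\<close>
  thanks to the first moments. The first bracket bounds upward moves across \<open>t\<close>, the
  second downward ones; upper tails serve for \<open>0 \<le> t\<close> and lower tails for
  \<open>t < 0\<close>.\<close>

definition layer_bound :: "real \<Rightarrow> ennreal" where
  "layer_bound t = (emeasure \<nu> {y. 0 \<le> t \<and> t < y} + emeasure \<mu> {x. x \<le> t \<and> t < 0}) +
     (emeasure \<mu> {y. 0 \<le> t \<and> t < y} + emeasure \<nu> {x. x \<le> t \<and> t < 0})"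

lemma layer_bound_measurable: "layer_bound \<in> borel_measurable lborel"
  unfolding layer_bound_def[abs_def]
  by (intro borel_measurable_add tail_integrable(2,4) mom)

lemma layer_bound_integrable: "(\<integral>\<^sup>+t. layer_bound t \<partial>lborel) < \<infinity>"
  unfolding layer_bound_def[abs_def]
  using tail_integrable(1,3)[OF mom(1)] tail_integrable(1,3)[OF mom(2)]
  by (simp add: nn_integral_add[OF borel_measurable_add[OF tail_integrable(2)[OF mom(2)] tail_integrable(4)[OF mom(1)]]
                  borel_measurable_add[OF tail_integrable(2)[OF mom(1)] tail_integrable(4)[OF mom(2)]]]
        nn_integral_add[OF tail_integrable(2)[OF mom(2)] tail_integrable(4)[OF mom(1)]]
        nn_integral_add[OF tail_integrable(2)[OF mom(1)] tail_integrable(4)[OF mom(2)]])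

lemma layer_le_bound:
  assumes \<pi>: "\<pi> \<in> sub_couplings \<mu> \<nu>" and H: "H \<in> sets borel"
  shows "emeasure \<pi> ((H \<inter> {..t}) \<times> {t<..}) \<le> layer_bound t"
    and "emeasure \<pi> ((H \<inter> {t<..}) \<times> {..t}) \<le> layer_bound t"
proof -
  note le = emeasure_sub_coupling_le[OF \<pi>]
  have mono: "emeasure \<mu> (H \<inter> {..t}) \<le> emeasure \<mu> {..t}" "emeasure \<mu> (H \<inter> {t<..}) \<le> emeasure \<mu> {t<..}"
    by (rule emeasure_mono; simp add: fst_moment(2))+
  have "emeasure \<pi> ((H \<inter> {..t}) \<times> {t<..}) \<le> emeasure \<nu> {y. 0 \<le> t \<and> t < y} + emeasure \<mu> {x. x \<le> t \<and> t < 0}"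
  proof (cases "0 \<le> t")
    case True
    have "emeasure \<pi> ((H \<inter> {..t}) \<times> {t<..}) \<le> emeasure \<nu> {t<..}" using H by (intro le) auto
    then show ?thesis using True by (simp add: greaterThan_def)
  next
    case False
    have "emeasure \<pi> ((H \<inter> {..t}) \<times> {t<..}) \<le> emeasure \<mu> (H \<inter> {..t})" using H by (intro le) auto
    then show ?thesis using False mono(1) by (simp add: atMost_def)
  qed
  then show "emeasure \<pi> ((H \<inter> {..t}) \<times> {t<..}) \<le> layer_bound t"
    unfolding layer_bound_def by (rule order_trans) simp
  have "emeasure \<pi> ((H \<inter> {t<..}) \<times> {..t}) \<le> emeasure \<mu> {y. 0 \<le> t \<and> t < y} + emeasure \<nu> {x. x \<le> t \<and> t < 0}"
  proof (cases "0 \<le> t")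
    case True
    have "emeasure \<pi> ((H \<inter> {t<..}) \<times> {..t}) \<le> emeasure \<mu> (H \<inter> {t<..})" using H by (intro le) auto
    then show ?thesis using True mono(2) by (simp add: greaterThan_def)
  next
    case False
    have "emeasure \<pi> ((H \<inter> {t<..}) \<times> {..t}) \<le> emeasure \<nu> {..t}" using H by (intro le) auto
    then show ?thesis using False by (simp add: atMost_def)
  qed
  then show "emeasure \<pi> ((H \<inter> {t<..}) \<times> {..t}) \<le> layer_bound t"
    unfolding layer_bound_def by (rule order_trans) simp
qed

lemma integrable_sub_coupling:
  assumes \<pi>: "\<pi> \<in> sub_couplings \<mu> \<nu>" and H[measurable]: "H \<in> sets borel"
  shows "integrable \<pi> (\<lambda>z. indicator H (fst z) * (snd z - fst z))"
proof -
  note [measurable] = measurable_fst_snd_borel[OF sub_couplingsD(1)[OF \<pi>]]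
  have "(\<integral>\<^sup>+t. emeasure \<pi> ((H \<inter> {..t}) \<times> {t<..}) \<partial>lborel) \<le> (\<integral>\<^sup>+t. layer_bound t \<partial>lborel)"
    "(\<integral>\<^sup>+t. emeasure \<pi> ((H \<inter> {t<..}) \<times> {..t}) \<partial>lborel) \<le> (\<integral>\<^sup>+t. layer_bound t \<partial>lborel)"
    by (auto intro!: nn_integral_mono layer_le_bound \<pi> H)
  then show ?thesis
    using layer_bound_integrable unfolding real_integrable_def layer_up(1)[OF \<pi> H] layer_down(1)[OF \<pi> H]
    by (auto simp: top_unique)
qed

text \<open>Dominated convergence in the threshold \<open>t\<close>, with \<open>layer_bound\<close>
  as majorant. The first factors \<open>H \<inter> {..t}\<close> and
  \<open>H \<inter> {t<..}\<close> vary with \<open>t\<close>, which is where convergence for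
  arbitrary Borel \<open>A\<close> enters.\<close>

lemma
  assumes \<pi>n: "\<And>n. \<pi>n n \<in> sub_couplings \<mu> \<nu>" and \<pi>: "\<pi> \<in> couplings \<mu> \<nu>"
    and conv: "\<And>A t. A \<in> sets borel \<Longrightarrow> (\<lambda>n. measure (\<pi>n n) (A \<times> {..t})) \<longlonglongrightarrow> measure \<pi> (A \<times> {..t})"
    and convU: "\<And>A. A \<in> sets borel \<Longrightarrow> (\<lambda>n. measure (\<pi>n n) (A \<times> UNIV)) \<longlonglongrightarrow> measure \<pi> (A \<times> UNIV)"
    and H[measurable]: "H \<in> sets borel"
  shows tendsto_integral_diff: "(\<lambda>n. \<integral>z. indicator H (fst z) * (snd z - fst z) \<partial>\<pi>n n) \<longlonglongrightarrow>
           (\<integral>z. indicator H (fst z) * (snd z - fst z) \<partial>\<pi>)"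
    and tendsto_integral_abs_diff: "(\<lambda>n. \<integral>z. \<bar>snd z - fst z\<bar> \<partial>\<pi>n n) \<longlonglongrightarrow> (\<integral>z. \<bar>snd z - fst z\<bar> \<partial>\<pi>)"
proof -
  have \<pi>': "\<pi> \<in> sub_couplings \<mu> \<nu>" by (rule coupling_is_sub_coupling[OF mom \<pi>])
  have fin: "finite_measure \<rho>" if "\<rho> \<in> sub_couplings \<mu> \<nu>" for \<rho>
    using that by (rule finite_measure_sub_coupling[OF fst_moment(1)])
  have em: "emeasure \<rho> C = ennreal (measure \<rho> C)" if "\<rho> \<in> sub_couplings \<mu> \<nu>" for \<rho> C
    using fin[OF that] by (rule finite_measure.emeasure_eq_measure)
  \<comment> \<open>Strips above \<open>t\<close> are differences, so their convergence draws on
    \<open>convU\<close> besides \<open>conv\<close>.\<close>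
  have diff: "measure \<rho> (A \<times> {t<..}) = measure \<rho> (A \<times> UNIV) - measure \<rho> (A \<times> {..t})"
    if \<rho>: "\<rho> \<in> sub_couplings \<mu> \<nu>" and A: "A \<in> sets borel" for \<rho> A t
  proof -
    have "measure \<rho> (A \<times> UNIV - A \<times> {..t}) = measure \<rho> (A \<times> UNIV) - measure \<rho> (A \<times> {..t})"
      using A by (intro finite_measure.finite_measure_Diff[OF fin[OF \<rho>]]) (auto simp: sub_couplingsD(1)[OF \<rho>] borel_Times)
    moreover have "A \<times> UNIV - A \<times> {..t} = A \<times> {t<..}" by auto
    ultimately show ?thesis by simp
  qed
  have up: "(\<lambda>n. \<integral>\<^sup>+z. ennreal (indicator H (fst z) * (snd z - fst z)) \<partial>\<pi>n n) \<longlonglongrightarrow>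
           (\<integral>\<^sup>+z. ennreal (indicator H (fst z) * (snd z - fst z)) \<partial>\<pi>)" if H: "H \<in> sets borel" for H
    unfolding layer_up(1)[OF \<pi>n H] layer_up(1)[OF \<pi>' H]
  proof (rule nn_integral_dominated_convergence[where w=layer_bound])
    show "AE t in lborel. (\<lambda>n. emeasure (\<pi>n n) ((H \<inter> {..t}) \<times> {t<..})) \<longlonglongrightarrow> emeasure \<pi> ((H \<inter> {..t}) \<times> {t<..})"
    proof (rule AE_I2)
      fix t
      have A: "H \<inter> {..t} \<in> sets borel" using H by simp
      show "(\<lambda>n. emeasure (\<pi>n n) ((H \<inter> {..t}) \<times> {t<..})) \<longlonglongrightarrow> emeasure \<pi> ((H \<inter> {..t}) \<times> {t<..})"
        unfolding em[OF \<pi>n] em[OF \<pi>'] diff[OF \<pi>n A] diff[OF \<pi>' A]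
        by (intro tendsto_ennrealI tendsto_diff conv convU A)
    qed
  qed (use layer_up(2)[OF \<pi>n H] layer_up(2)[OF \<pi>' H] layer_bound_measurable layer_bound_integrable
         layer_le_bound(1)[OF \<pi>n H] in auto)
  have down: "(\<lambda>n. \<integral>\<^sup>+z. ennreal (- (indicator H (fst z) * (snd z - fst z))) \<partial>\<pi>n n) \<longlonglongrightarrow>
           (\<integral>\<^sup>+z. ennreal (- (indicator H (fst z) * (snd z - fst z))) \<partial>\<pi>)" if H: "H \<in> sets borel" for H
    unfolding layer_down(1)[OF \<pi>n H] layer_down(1)[OF \<pi>' H]
  proof (rule nn_integral_dominated_convergence[where w=layer_bound])
    show "AE t in lborel. (\<lambda>n. emeasure (\<pi>n n) ((H \<inter> {t<..}) \<times> {..t})) \<longlonglongrightarrow> emeasure \<pi> ((H \<inter> {t<..}) \<times> {..t})"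
    proof (rule AE_I2)
      fix t
      have A: "H \<inter> {t<..} \<in> sets borel" using H by simp
      show "(\<lambda>n. emeasure (\<pi>n n) ((H \<inter> {t<..}) \<times> {..t})) \<longlonglongrightarrow> emeasure \<pi> ((H \<inter> {t<..}) \<times> {..t})"
        unfolding em[OF \<pi>n] em[OF \<pi>'] by (intro tendsto_ennrealI conv A)
    qed
  qed (use layer_down(2)[OF \<pi>n H] layer_down(2)[OF \<pi>' H] layer_bound_measurable layer_bound_integrable
         layer_le_bound(2)[OF \<pi>n H] in auto)
  have fin_int: "(\<integral>\<^sup>+z. ennreal (indicator H (fst z) * (snd z - fst z)) \<partial>\<rho>) \<noteq> \<infinity>"
    "(\<integral>\<^sup>+z. ennreal (- (indicator H (fst z) * (snd z - fst z))) \<partial>\<rho>) \<noteq> \<infinity>"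
    if "\<rho> \<in> sub_couplings \<mu> \<nu>" "H \<in> sets borel" for \<rho> H
    using integrable_sub_coupling[OF that] by (auto simp: real_integrable_def)
  have Up: "(\<lambda>n. enn2real (\<integral>\<^sup>+z. ennreal (indicator H (fst z) * (snd z - fst z)) \<partial>\<pi>n n)) \<longlonglongrightarrow>
        enn2real (\<integral>\<^sup>+z. ennreal (indicator H (fst z) * (snd z - fst z)) \<partial>\<pi>)"
    and Down: "(\<lambda>n. enn2real (\<integral>\<^sup>+z. ennreal (- (indicator H (fst z) * (snd z - fst z))) \<partial>\<pi>n n)) \<longlonglongrightarrow>
        enn2real (\<integral>\<^sup>+z. ennreal (- (indicator H (fst z) * (snd z - fst z))) \<partial>\<pi>)" if "H \<in> sets borel" for H
    using up[OF that] down[OF that] fin_int[OF \<pi>' that] by (auto intro!: tendsto_enn2real simp: less_top)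
  have split: "(\<integral>z. indicator H (fst z) * (snd z - fst z) \<partial>\<rho>) =
      enn2real (\<integral>\<^sup>+z. ennreal (indicator H (fst z) * (snd z - fst z)) \<partial>\<rho>) -
      enn2real (\<integral>\<^sup>+z. ennreal (- (indicator H (fst z) * (snd z - fst z))) \<partial>\<rho>)"
    if "\<rho> \<in> sub_couplings \<mu> \<nu>" for \<rho>
    by (rule real_lebesgue_integral_def[OF integrable_sub_coupling[OF that H]])
  show "(\<lambda>n. \<integral>z. indicator H (fst z) * (snd z - fst z) \<partial>\<pi>n n) \<longlonglongrightarrow>
           (\<integral>z. indicator H (fst z) * (snd z - fst z) \<partial>\<pi>)"
    unfolding split[OF \<pi>n] split[OF \<pi>'] by (intro tendsto_diff Up Down H)
  \<comment> \<open>The distance is the sum of the upward and downward parts for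
    \<open>H = UNIV\<close>.\<close>
  have split_abs: "(\<integral>z. \<bar>snd z - fst z\<bar> \<partial>\<rho>) =
      enn2real (\<integral>\<^sup>+z. ennreal (indicator UNIV (fst z) * (snd z - fst z)) \<partial>\<rho>) +
      enn2real (\<integral>\<^sup>+z. ennreal (- (indicator UNIV (fst z) * (snd z - fst z))) \<partial>\<rho>)"
    if \<rho>: "\<rho> \<in> sub_couplings \<mu> \<nu>" for \<rho>
  proof -
    note [measurable] = measurable_fst_snd_borel[OF sub_couplingsD(1)[OF \<rho>]]
    have "(\<integral>\<^sup>+z. ennreal \<bar>snd z - fst z\<bar> \<partial>\<rho>) =
      (\<integral>\<^sup>+z. ennreal (snd z - fst z) + ennreal (- (snd z - fst z)) \<partial>\<rho>)"
      by (intro nn_integral_cong) (auto simp: abs_if ennreal_neg)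
    also have "\<dots> = (\<integral>\<^sup>+z. ennreal (snd z - fst z) \<partial>\<rho>) + (\<integral>\<^sup>+z. ennreal (- (snd z - fst z)) \<partial>\<rho>)"
      by (rule nn_integral_add) measurable
    finally show ?thesis
      using fin_int[OF \<rho>, of UNIV] by (simp add: integral_eq_nn_integral enn2real_plus less_top)
  qed
  show "(\<lambda>n. \<integral>z. \<bar>snd z - fst z\<bar> \<partial>\<pi>n n) \<longlonglongrightarrow> (\<integral>z. \<bar>snd z - fst z\<bar> \<partial>\<pi>)"
    unfolding split_abs[OF \<pi>n] split_abs[OF \<pi>'] by (intro tendsto_add Up Down) auto
qed

end

section \<open>Compactness of couplings\<close>

context
  fixes \<mu> \<nu> :: "real measure"
  assumes mom: "finite_first_moment \<mu>" "finite_first_moment \<nu>"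
begin

text \<open>Mass missing over \<open>A\<close> cannot exceed the total missing mass, because the
  complement of \<open>A\<close> is not overfull. Convergence of the total mass alone therefore
  restores both marginals in the limit.\<close>

lemma sub_coupling_deficit:
  assumes \<pi>: "\<pi> \<in> sub_couplings \<mu> \<nu>" and A: "A \<in> sets borel"
  shows "measure \<mu> A - measure \<pi> (A \<times> UNIV) \<le> measure \<mu> UNIV - measure \<pi> UNIV"
    "measure \<pi> (A \<times> UNIV) \<le> measure \<mu> A"
    "measure \<nu> A - measure \<pi> (UNIV \<times> A) \<le> measure \<nu> UNIV - measure \<pi> UNIV"
    "measure \<pi> (UNIV \<times> A) \<le> measure \<nu> A"
proof -
  note \<mu> = finite_first_momentD[OF mom(1)] and \<nu> = finite_first_momentD[OF mom(2)]
  interpret mu: finite_measure \<mu> by (rule \<mu>)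
  interpret nu: finite_measure \<nu> by (rule \<nu>)
  interpret pi: finite_measure \<pi> by (rule finite_measure_sub_coupling[OF \<mu>(1) \<pi>])
  have le: "measure \<pi> (B \<times> UNIV) \<le> measure \<mu> B" "measure \<pi> (UNIV \<times> B) \<le> measure \<nu> B"
    if "B \<in> sets borel" for B
    using sub_couplingsD(3,4)[OF \<pi> that]
    by (simp_all add: mu.emeasure_eq_measure nu.emeasure_eq_measure pi.emeasure_eq_measure)
  then show "measure \<pi> (A \<times> UNIV) \<le> measure \<mu> A" "measure \<pi> (UNIV \<times> A) \<le> measure \<nu> A"
    using A by auto
  have rect: "B \<times> C \<in> sets \<pi>" if "B \<in> sets borel" "C \<in> sets borel" for B C :: "real set"
    using that by (simp add: sub_couplingsD(1)[OF \<pi>] borel_Times)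
  have cA: "UNIV - A \<in> sets borel" using A by auto
  have "measure \<pi> (UNIV - A \<times> UNIV) = measure \<pi> UNIV - measure \<pi> (A \<times> UNIV)"
    using pi.finite_measure_compl[OF rect[OF A, of UNIV]] by (simp add: sub_couplingsD(2)[OF \<pi>])
  moreover have "UNIV - A \<times> UNIV = (UNIV - A) \<times> (UNIV :: real set)" by auto
  moreover have "measure \<mu> (UNIV - A) = measure \<mu> UNIV - measure \<mu> A"
    using mu.finite_measure_compl[of A] A by (simp add: \<mu>(2,3))
  ultimately show "measure \<mu> A - measure \<pi> (A \<times> UNIV) \<le> measure \<mu> UNIV - measure \<pi> UNIV"
    using le(1)[OF cA] by simp
  have "measure \<pi> (UNIV - UNIV \<times> A) = measure \<pi> UNIV - measure \<pi> (UNIV \<times> A)"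
    using pi.finite_measure_compl[OF rect[OF _ A, of UNIV]] by (simp add: sub_couplingsD(2)[OF \<pi>])
  moreover have "UNIV - UNIV \<times> A = (UNIV :: real set) \<times> (UNIV - A)" by auto
  moreover have "measure \<nu> (UNIV - A) = measure \<nu> UNIV - measure \<nu> A"
    using nu.finite_measure_compl[of A] A by (simp add: \<nu>(2,3))
  ultimately show "measure \<nu> A - measure \<pi> (UNIV \<times> A) \<le> measure \<nu> UNIV - measure \<pi> UNIV"
    using le(2)[OF cA] by simp
qed

lemma tendsto_sub_coupling_marginal:
  assumes \<pi>n: "\<And>n. \<pi>n n \<in> sub_couplings \<mu> \<nu>" and mass: "measure \<mu> UNIV = measure \<nu> UNIV"
    and total: "(\<lambda>n. measure (\<pi>n n) UNIV) \<longlonglongrightarrow> measure \<mu> UNIV" and A: "A \<in> sets borel"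
  shows "(\<lambda>n. measure (\<pi>n n) (A \<times> UNIV)) \<longlonglongrightarrow> measure \<mu> A"
    "(\<lambda>n. measure (\<pi>n n) (UNIV \<times> A)) \<longlonglongrightarrow> measure \<nu> A"
proof -
  have lim0: "(\<lambda>n. measure \<mu> UNIV - measure (\<pi>n n) UNIV) \<longlonglongrightarrow> 0"
    using tendsto_diff[OF tendsto_const total, of "measure \<mu> UNIV"] by simp
  show "(\<lambda>n. measure (\<pi>n n) (A \<times> UNIV)) \<longlonglongrightarrow> measure \<mu> A"
  proof (rule real_tendsto_sandwich[OF _ _ _ tendsto_const])
    show "(\<lambda>n. measure \<mu> A - (measure \<mu> UNIV - measure (\<pi>n n) UNIV)) \<longlonglongrightarrow> measure \<mu> A"
      using tendsto_diff[OF tendsto_const lim0, of "measure \<mu> A"] by simp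
    show "\<forall>\<^sub>F n in sequentially. measure \<mu> A - (measure \<mu> UNIV - measure (\<pi>n n) UNIV) \<le> measure (\<pi>n n) (A \<times> UNIV)"
      using sub_coupling_deficit(1)[OF \<pi>n A] by (intro always_eventually) (simp add: algebra_simps)
  qed (use sub_coupling_deficit(2)[OF \<pi>n A] in auto)
  show "(\<lambda>n. measure (\<pi>n n) (UNIV \<times> A)) \<longlonglongrightarrow> measure \<nu> A"
  proof (rule real_tendsto_sandwich[OF _ _ _ tendsto_const])
    show "(\<lambda>n. measure \<nu> A - (measure \<nu> UNIV - measure (\<pi>n n) UNIV)) \<longlonglongrightarrow> measure \<nu> A"
      using tendsto_diff[OF tendsto_const lim0[unfolded mass], of "measure \<nu> A"] by simp
    show "\<forall>\<^sub>F n in sequentially. measure \<nu> A - (measure \<nu> UNIV - measure (\<pi>n n) UNIV) \<le> measure (\<pi>n n) (UNIV \<times> A)"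
      using sub_coupling_deficit(3)[OF \<pi>n A] mass by (intro always_eventually) (simp add: algebra_simps)
  qed (use sub_coupling_deficit(4)[OF \<pi>n A] in auto)
qed

text \<open>Weak-star limits of the conditional distribution functions have the integrals prescribed
  by \<nu>, so they form a kernel and no mass escapes to infinity. Irrational thresholds are filled
  in by right continuity of the distribution function of \<nu>.\<close>

theorem sub_couplings_sequentially_compact:
  assumes \<pi>n: "\<And>n. \<pi>n n \<in> sub_couplings \<mu> \<nu>" and mass: "measure \<mu> UNIV = measure \<nu> UNIV"
    and total: "(\<lambda>n. measure (\<pi>n n) UNIV) \<longlonglongrightarrow> measure \<mu> UNIV"
  obtains s :: "nat \<Rightarrow> nat" and \<pi> where "strict_mono s" "\<pi> \<in> couplings \<mu> \<nu>"
    "\<And>A t. A \<in> sets borel \<Longrightarrow> (\<lambda>n. measure (\<pi>n (s n)) (A \<times> {..t})) \<longlonglongrightarrow> measure \<pi> (A \<times> {..t})"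
    "\<And>A. A \<in> sets borel \<Longrightarrow> (\<lambda>n. measure (\<pi>n (s n)) (A \<times> UNIV)) \<longlonglongrightarrow> measure \<pi> (A \<times> UNIV)"
proof -
  note \<mu> = finite_first_momentD[OF mom(1)] and \<nu> = finite_first_momentD[OF mom(2)]
  interpret mu: finite_measure \<mu> by (rule \<mu>)
  interpret nu: finite_measure \<nu> by (rule \<nu>)
  note [measurable_cong] = \<mu>(2) \<nu>(2)
  have fin: "finite_measure \<rho>" if "\<rho> \<in> sub_couplings \<mu> \<nu>" for \<rho>
    using that by (rule finite_measure_sub_coupling[OF \<mu>(1)])
  have rect: "B \<times> C \<in> sets \<rho>" if "\<rho> \<in> sub_couplings \<mu> \<nu>" "B \<in> sets borel" "C \<in> sets borel"
    for B C :: "real set" and \<rho>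
    using that(2,3) by (simp add: sub_couplingsD(1)[OF that(1)] borel_Times)
  define P where "P n j f \<longleftrightarrow> f \<in> borel_measurable borel \<and> (\<forall>x. 0 \<le> f x \<and> f x \<le> 1) \<and>
     (\<forall>A\<in>sets borel. measure (\<pi>n n) (A \<times> {..of_rat (from_nat j)}) = (\<integral>x. indicator A x * f x \<partial>\<mu>))"
    for n j and f :: "real \<Rightarrow> real"
  have "\<exists>f. P n j f" for n j
    using ex_conditional_cdf[OF \<mu>(1,2) sub_couplingsD(1)[OF \<pi>n] sub_couplingsD(3)[OF \<pi>n], of n "of_rat (from_nat j)"]
    unfolding P_def by blast
  then obtain f where "\<And>n j. P n j (f n j)" by metis
  then have f_meas: "\<And>n j. f n j \<in> borel_measurable borel" and f_bnd: "\<And>n j x. 0 \<le> f n j x \<and> f n j x \<le> 1"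
    and mf: "\<And>n j A. A \<in> sets borel \<Longrightarrow>
       measure (\<pi>n n) (A \<times> {..of_rat (from_nat j)}) = (\<integral>x. indicator A x * f n j x \<partial>\<mu>)"
    unfolding P_def by blast+
  obtain s g where s: "strict_mono (s :: nat \<Rightarrow> nat)" and g_meas: "\<And>j. g j \<in> borel_measurable borel"
    and g_bnd: "\<And>j x. 0 \<le> g j x \<and> g j x \<le> (1::real)"
    and lim_g: "\<And>j A. A \<in> sets borel \<Longrightarrow>
       (\<lambda>n. \<integral>x. indicator A x * f (s n) j x \<partial>\<mu>) \<longlonglongrightarrow> (\<integral>x. indicator A x * g j x \<partial>\<mu>)"
    by (rule weak_star_sequentially_compact[OF \<mu>(1,2), of f, OF f_meas f_bnd]) (rule that, auto)
  define F where "F q = g (to_nat q)" for q :: rat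
  have F_meas[measurable]: "F q \<in> borel_measurable borel" and F_bnd: "0 \<le> F q x \<and> F q x \<le> 1" for q x
    using g_meas g_bnd by (auto simp: F_def)
  have lim_F: "(\<lambda>n. measure (\<pi>n (s n)) (A \<times> {..of_rat q})) \<longlonglongrightarrow> (\<integral>x. indicator A x * F q x \<partial>\<mu>)"
    if "A \<in> sets borel" for A q
    using lim_g[OF that, of "to_nat q"] mf[OF that, of _ "to_nat q"] by (simp add: F_def)
  have total_s: "(\<lambda>n. measure (\<pi>n (s n)) UNIV) \<longlonglongrightarrow> measure \<mu> UNIV"
    using LIMSEQ_subseq_LIMSEQ[OF total s] by (simp add: comp_def)
  note lim_marg = tendsto_sub_coupling_marginal[of "\<lambda>n. \<pi>n (s n)", OF \<pi>n mass total_s]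
  have marg: "(\<integral>x. F q x \<partial>\<mu>) = measure \<nu> {..of_rat q}" for q
    using LIMSEQ_unique[OF lim_F[of UNIV q] lim_marg(2)[of "{..of_rat q}"]] by simp
  have intF: "integrable \<mu> (F q)" for q
    by (rule mu.integrable_const_bound[where B=1]) (use F_bnd in auto)
  have iF: "integrable \<mu> (\<lambda>x. indicator A x * F q x)" if "A \<in> sets borel" for A q
    using integrable_mult_indicator[OF _ intF[of q], of A] that by (simp add: \<mu>(2))
  \<comment> \<open>The weak-star limit is not a pointwise one; monotonicity passes to it through
    the integrals over each \<open>A\<close>.\<close>
  have mono: "AE x in \<mu>. F p x \<le> F q x" if pq: "p < q" for p q
  proof -
    have "AE x in \<mu>. 0 \<le> F q x - F p x"
    proof (rule mu.density_nonneg)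
      show "integrable \<mu> (\<lambda>x. F q x - F p x)" using intF by simp
      fix A assume "A \<in> sets \<mu>"
      then have A: "A \<in> sets borel" by (simp add: \<mu>(2))
      have r: "real_of_rat p \<le> of_rat q" using pq by (simp add: of_rat_less_eq)
      have "(\<integral>x. indicator A x * F p x \<partial>\<mu>) \<le> (\<integral>x. indicator A x * F q x \<partial>\<mu>)"
      proof (rule LIMSEQ_le[OF lim_F[OF A] lim_F[OF A]])
        have "measure (\<pi>n (s n)) (A \<times> {..of_rat p}) \<le> measure (\<pi>n (s n)) (A \<times> {..of_rat q})" for n
          using r A rect[OF \<pi>n] by (intro finite_measure.finite_measure_mono[OF fin[OF \<pi>n]]) auto
        then show "\<exists>N. \<forall>n\<ge>N. measure (\<pi>n (s n)) (A \<times> {..of_rat p}) \<le> measure (\<pi>n (s n)) (A \<times> {..of_rat q})"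
          by blast
      qed
      then show "0 \<le> set_lebesgue_integral \<mu> A (\<lambda>x. F q x - F p x)"
        using iF[OF A] by (simp add: set_lebesgue_integral_def right_diff_distrib)
    qed
    then show ?thesis by simp
  qed
  obtain \<kappa> :: "real \<Rightarrow> real measure" where ker: "\<kappa> \<in> borel \<rightarrow>\<^sub>M prob_algebra borel"
    and \<kappa>: "\<And>q. AE x in \<mu>. measure (\<kappa> x) {..of_rat q} = F q x"
    by (rule kernel_from_marginal_cdf[OF \<mu>(1,2) \<nu>(1,2) mass[symmetric] F_meas F_bnd _ marg], erule mono) (rule that, auto)
  define \<pi> where "\<pi> = kernel_plan \<mu> \<kappa>"
  note em_pi = emeasure_kernel_plan[OF \<mu>(2) ker, folded \<pi>_def]
  have sets_pi: "sets \<pi> = sets borel" unfolding \<pi>_def by (rule sets_kernel_plan[OF \<mu>(2) ker])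
  have prob: "prob_space (\<kappa> x)" and sk: "sets (\<kappa> x) = sets borel" for x
    using prob_space_kernel[OF \<mu>(2) ker] sets_kernel[OF \<mu>(2) ker] by auto
  have meas_rat: "measure \<pi> (A \<times> {..of_rat q}) = (\<integral>x. indicator A x * F q x \<partial>\<mu>)"
    and em_rat: "emeasure \<pi> (A \<times> {..of_rat q}) = ennreal (\<integral>x. indicator A x * F q x \<partial>\<mu>)"
    if A[measurable]: "A \<in> sets borel" for A q
  proof -
    have "emeasure \<pi> (A \<times> {..of_rat q}) = (\<integral>\<^sup>+x\<in>A. emeasure (\<kappa> x) {..of_rat q} \<partial>\<mu>)"
      by (rule em_pi) auto
    also have "\<dots> = (\<integral>\<^sup>+x. ennreal (indicator A x * F q x) \<partial>\<mu>)"
      using \<kappa>[of q] prob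
      by (intro nn_integral_cong_AE)
         (auto simp: prob_space_def finite_measure.emeasure_eq_measure split: split_indicator)
    also have "\<dots> = ennreal (\<integral>x. indicator A x * F q x \<partial>\<mu>)"
      using iF[OF A] F_bnd by (intro nn_integral_eq_integral) auto
    finally show "emeasure \<pi> (A \<times> {..of_rat q}) = ennreal (\<integral>x. indicator A x * F q x \<partial>\<mu>)" .
    then show "measure \<pi> (A \<times> {..of_rat q}) = (\<integral>x. indicator A x * F q x \<partial>\<mu>)"
      using F_bnd by (simp add: measure_def)
  qed
  have fst_pi: "emeasure \<pi> (A \<times> UNIV) = emeasure \<mu> A" if "A \<in> sets borel" for A
  proof -
    have "emeasure (\<kappa> x) UNIV = 1" for x
      using prob_space.emeasure_space_1[OF prob, of x] sets_eq_imp_space_eq[OF sk, of x] by simp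
    then show ?thesis using em_pi[OF that, of UNIV] that by (simp add: \<mu>(2))
  qed
  have sp: "space \<pi> = UNIV" using sets_eq_imp_space_eq[OF sets_pi] by simp
  have snd_pi: "emeasure (distr \<pi> borel snd) B = emeasure \<pi> (UNIV \<times> B)" if "B \<in> sets borel" for B
    using that measurable_fst_snd_borel(2)[OF sets_pi] by (simp add: emeasure_distr sp vimage_snd)
  have "\<nu> = distr \<pi> borel snd"
  proof (rule measure_eqI_atMost_rat[OF \<nu>(1,2)])
    show "emeasure \<nu> {..of_rat q} = emeasure (distr \<pi> borel snd) {..of_rat q}" for q
      using em_rat[of UNIV q] marg[of q] by (simp add: snd_pi nu.emeasure_eq_measure)
  qed simp
  then have coup: "\<pi> \<in> couplings \<mu> \<nu>"
    using fst_pi snd_pi by (intro couplingsI[OF sets_pi \<mu>(2) \<nu>(2)]) auto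
  note sub_pi = coupling_is_sub_coupling[OF mom coup]
  have lim_rat: "(\<lambda>n. measure (\<pi>n (s n)) (A \<times> {..of_rat q})) \<longlonglongrightarrow> measure \<pi> (A \<times> {..of_rat q})"
    if "A \<in> sets borel" for A q
    using lim_F[OF that] meas_rat[OF that] by simp
  \<comment> \<open>A strip \<open>A \<times> {t<..u}\<close> has at most the mass that \<nu> gives
    to \<open>{t<..u}\<close>, uniformly over all sub-couplings; replacing \<open>t\<close> by a
    nearby rational thus costs little for all \<open>n\<close> simultaneously.\<close>
  have close: "\<bar>measure \<rho> (A \<times> {..u}) - measure \<rho> (A \<times> {..t})\<bar> \<le> measure \<nu> {..u} - measure \<nu> {..t}"
    if \<rho>: "\<rho> \<in> sub_couplings \<mu> \<nu>" and A: "A \<in> sets borel" and tu: "t \<le> u" for \<rho> A t u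
  proof -
    interpret r: finite_measure \<rho> by (rule fin[OF \<rho>])
    have eq: "A \<times> {..u} - A \<times> {..t} = A \<times> {t<..u}" "{..u} - {..t} = {t<..u}" by auto
    have sub: "A \<times> {..t} \<subseteq> A \<times> {..u}" using tu by auto
    have "measure \<rho> (A \<times> {t<..u}) = measure \<rho> (A \<times> {..u}) - measure \<rho> (A \<times> {..t})"
      unfolding eq(1)[symmetric] using sub by (intro r.finite_measure_Diff rect[OF \<rho> A]) auto
    moreover have "measure \<nu> {t<..u} = measure \<nu> {..u} - measure \<nu> {..t}"
      unfolding eq(2)[symmetric] using tu by (intro nu.finite_measure_Diff) (auto simp: \<nu>(2))
    moreover have "measure \<rho> (A \<times> {t<..u}) \<le> measure \<nu> {t<..u}"
      using emeasure_sub_coupling_le(2)[OF \<rho> A, of "{t<..u}"]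
      by (simp add: r.emeasure_eq_measure nu.emeasure_eq_measure)
    ultimately show ?thesis by (smt (verit) measure_nonneg)
  qed
  have "(\<lambda>n. measure (\<pi>n (s n)) (A \<times> {..t})) \<longlonglongrightarrow> measure \<pi> (A \<times> {..t})" if A: "A \<in> sets borel" for A t
  proof (rule LIMSEQ_I)
    fix e :: real assume e: "0 < e"
    interpret N: finite_borel_measure \<nu>
      using \<nu>(1,2) by (simp add: finite_borel_measure_def finite_borel_measure_axioms_def)
    have "(cdf \<nu> \<longlongrightarrow> cdf \<nu> t) (at_right t)"
      using N.cdf_is_right_cont[of t] by (simp add: continuous_within)
    moreover have "cdf \<nu> t < cdf \<nu> t + e / 3" using e by simp
    ultimately have "\<forall>\<^sub>F u in at_right t. cdf \<nu> u < cdf \<nu> t + e / 3"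
      by (rule order_tendstoD(2))
    then obtain b where b: "t < b" "\<And>u. t < u \<Longrightarrow> u < b \<Longrightarrow> cdf \<nu> u < cdf \<nu> t + e / 3"
      by (auto simp: eventually_at_right[OF less_add_one])
    obtain q where q: "t < of_rat q" "real_of_rat q < b"
      using of_rat_dense[OF b(1)] by blast
    then have small: "measure \<nu> {..of_rat q} - measure \<nu> {..t} < e / 3"
      using b(2)[OF q] by (simp add: cdf_def)
    obtain no where no: "\<And>n. n \<ge> no \<Longrightarrow>
        \<bar>measure (\<pi>n (s n)) (A \<times> {..of_rat q}) - measure \<pi> (A \<times> {..of_rat q})\<bar> < e / 3"
      using LIMSEQ_D[OF lim_rat[OF A, of q], of "e / 3"] e unfolding real_norm_def by force
    have "\<bar>measure (\<pi>n (s n)) (A \<times> {..t}) - measure \<pi> (A \<times> {..t})\<bar> < e" if "n \<ge> no" for n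
      using no[OF that] small close[OF \<pi>n[of "s n"] A less_imp_le[OF q(1)]] close[OF sub_pi A less_imp_le[OF q(1)]]
      by linarith
    then show "\<exists>no. \<forall>n\<ge>no. norm (measure (\<pi>n (s n)) (A \<times> {..t}) - measure \<pi> (A \<times> {..t})) < e"
      by auto
  qed
  moreover have "(\<lambda>n. measure (\<pi>n (s n)) (A \<times> UNIV)) \<longlonglongrightarrow> measure \<pi> (A \<times> UNIV)" if "A \<in> sets borel" for A
    using lim_marg(1)[OF that] fst_pi[OF that] by (simp add: measure_def)
  ultimately show ?thesis by (rule that[OF s coup])
qed

end

section \<open>Existence of an optimal martingale coupling\<close>

lemma ext_integral_integrable:
  assumes "integrable \<mu> \<phi>"
  shows "ext_integral \<mu> \<phi> = ereal (\<integral>x. \<phi> x \<partial>\<mu>)"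
proof -
  have fin: "(\<integral>\<^sup>+x. ennreal (\<phi> x) \<partial>\<mu>) \<noteq> \<infinity>" "(\<integral>\<^sup>+x. ennreal (- \<phi> x) \<partial>\<mu>) \<noteq> \<infinity>"
    using assms by (auto simp: real_integrable_def)
  have "enn2ereal a = ereal (enn2real a)" if "a \<noteq> \<infinity>" for a
    using that by (cases a) (auto simp: enn2ereal_ennreal)
  then show ?thesis
    using fin unfolding ext_integral_def real_lebesgue_integral_def[OF assms] by simp
qed

lemma convex_order_integral_le:
  assumes "\<mu> \<preceq>\<^sub>C \<nu>" "convex_on UNIV \<phi>" "integrable \<mu> \<phi>" "integrable \<nu> \<phi>"
  shows "(\<integral>x. \<phi> x \<partial>\<mu>) \<le> (\<integral>x. \<phi> x \<partial>\<nu>)"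
  using assms unfolding convex_order_def by (auto simp: ext_integral_integrable)

text \<open>Both constants 1 and -1 are convex functions.\<close>

lemma convex_order_mass:
  assumes mom: "finite_first_moment \<mu>" "finite_first_moment \<nu>" and ord: "\<mu> \<preceq>\<^sub>C \<nu>"
  shows "measure \<mu> UNIV = measure \<nu> UNIV"
proof -
  note \<mu> = finite_first_momentD[OF mom(1)] and \<nu> = finite_first_momentD[OF mom(2)]
  interpret mu: finite_measure \<mu> by (rule \<mu>)
  interpret nu: finite_measure \<nu> by (rule \<nu>)
  have "(\<integral>x. c \<partial>\<mu>) \<le> (\<integral>x. c \<partial>\<nu>)" for c :: real
    by (rule convex_order_integral_le[OF ord]) (auto simp: convex_on_def simp flip: distrib_right)
  from this[of 1] this[of "-1"] show ?thesis by (simp add: \<mu>(3) \<nu>(3))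
qed

section \<open>Duality with piecewise affine convex functions\<close>

lemma convex_on_Max_affine:
  fixes a c :: "'i \<Rightarrow> real"
  assumes "finite I" "I \<noteq> {}"
  shows "convex_on UNIV (\<lambda>y::real. Max ((\<lambda>i. a i + c i * y) ` I))"
proof (rule convex_onI)
  fix t x y :: real assume t: "0 < t" "t < 1"
  let ?M = "\<lambda>y. Max ((\<lambda>i. a i + c i * y) ` I)"
  have le: "a i + c i * y \<le> ?M y" if "i \<in> I" for i y
    using assms that by (intro Max_ge) auto
  show "?M ((1 - t) *\<^sub>R x + t *\<^sub>R y) \<le> (1 - t) * ?M x + t * ?M y"
  proof (rule Max.boundedI)
    fix v assume "v \<in> (\<lambda>i. a i + c i * ((1 - t) *\<^sub>R x + t *\<^sub>R y)) ` I"
    then obtain i where i: "i \<in> I" "v = a i + c i * ((1 - t) *\<^sub>R x + t *\<^sub>R y)" by blast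
    then have "v = (1 - t) * (a i + c i * x) + t * (a i + c i * y)" by (simp add: algebra_simps)
    also have "\<dots> \<le> (1 - t) * ?M x + t * ?M y"
      using t le[OF i(1)] by (intro add_mono mult_left_mono) auto
    finally show "v \<le> (1 - t) * ?M x + t * ?M y" .
  qed (use assms in auto)
qed simp

lemma integrable_Max_affine:
  fixes a c :: "'i \<Rightarrow> real"
  assumes "finite I" "I \<noteq> {}" "finite_first_moment \<rho>"
  shows "integrable \<rho> (\<lambda>y::real. Max ((\<lambda>i. a i + c i * y) ` I))"
proof -
  note \<rho> = finite_first_momentD[OF assms(3)]
  interpret finite_measure \<rho> by (rule \<rho>)
  have [measurable]: "(\<lambda>y. y) \<in> borel_measurable \<rho>" using \<rho>(4) by (rule borel_measurable_integrable)
  show ?thesis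
  proof (rule Bochner_Integration.integrable_bound)
    show "integrable \<rho> (\<lambda>y. \<Sum>i\<in>I. \<bar>a i + c i * y\<bar>)"
      using \<rho>(4) by simp
    show "(\<lambda>y. Max ((\<lambda>i. a i + c i * y) ` I)) \<in> borel_measurable \<rho>"
      using assms(1) by measurable
    have "\<bar>Max ((\<lambda>i. a i + c i * y) ` I)\<bar> \<le> (\<Sum>i\<in>I. \<bar>a i + c i * y\<bar>)" for y
    proof -
      have "Max ((\<lambda>i. a i + c i * y) ` I) \<in> (\<lambda>i. a i + c i * y) ` I"
        using assms by (intro Max_in) auto
      then obtain i where "i \<in> I" "Max ((\<lambda>i. a i + c i * y) ` I) = a i + c i * y" by blast
      then show ?thesis
        using assms(1) member_le_sum[of i I "\<lambda>i. \<bar>a i + c i * y\<bar>"] by simp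
    qed
    then show "AE y in \<rho>. norm (Max ((\<lambda>i. a i + c i * y) ` I)) \<le> norm (\<Sum>i\<in>I. \<bar>a i + c i * y\<bar>)"
      by (auto simp: sum_nonneg)
  qed
qed

text \<open>If no approximate splitting existed, the residual of a nearly optimal one would give the
  coefficients of a piecewise linear convex function that separates: moving towards the partition
  that selects the largest affine piece decreases the residual.\<close>

lemma approximate_splitting:
  fixes m b :: "'i \<Rightarrow> real"
  assumes I: "finite I" "I \<noteq> {}" and mom: "finite_first_moment \<nu>"
    and dom: "\<And>a c. (\<Sum>i\<in>I. a i * m i + c i * b i) \<le> (\<integral>y. Max ((\<lambda>i. a i + c i * y) ` I) \<partial>\<nu>)"
    and "0 < \<epsilon>"
  obtains \<phi> :: "'i \<Rightarrow> real \<Rightarrow> real" where "\<And>i. i \<in> I \<Longrightarrow> \<phi> i \<in> borel_measurable borel"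
    "\<And>i y. i \<in> I \<Longrightarrow> 0 \<le> \<phi> i y" "\<And>y. (\<Sum>i\<in>I. \<phi> i y) = 1"
    "\<And>i. i \<in> I \<Longrightarrow> \<bar>(\<integral>y. \<phi> i y \<partial>\<nu>) - m i\<bar> \<le> \<epsilon>" "\<And>i. i \<in> I \<Longrightarrow> \<bar>(\<integral>y. y * \<phi> i y \<partial>\<nu>) - b i\<bar> \<le> \<epsilon>"
proof -
  note \<nu> = finite_first_momentD[OF mom]
  interpret finite_measure \<nu> by (rule \<nu>)
  note [measurable_cong] = \<nu>(2)
  \<comment> \<open>Partitions of unity: \<open>\<phi> i\<close> is the share of \<nu> allotted to
    the index \<open>i\<close>, and \<open>A\<close>, \<open>C\<close> are the residuals in mass and
    first moment.\<close>
  define \<Phi> where "\<Phi> = {\<phi> :: 'i \<Rightarrow> real \<Rightarrow> real. (\<forall>i\<in>I. \<phi> i \<in> borel_measurable borel) \<and> (\<forall>i\<in>I. \<forall>y. 0 \<le> \<phi> i y) \<and>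
      (\<forall>y. (\<Sum>i\<in>I. \<phi> i y) = 1)}"
  define A where "A \<phi> i = m i - (\<integral>y. \<phi> i y \<partial>\<nu>)" for \<phi> i
  define C where "C \<phi> i = b i - (\<integral>y. y * \<phi> i y \<partial>\<nu>)" for \<phi> i
  define V where "V \<phi> = (\<Sum>i\<in>I. (A \<phi> i)\<^sup>2 + (C \<phi> i)\<^sup>2)" for \<phi>
  have le1: "\<phi> i y \<le> 1" if "\<phi> \<in> \<Phi>" "i \<in> I" for \<phi> i y
    using that member_le_sum[of i I "\<lambda>i. \<phi> i y"] I(1) by (auto simp: \<Phi>_def)
  have nonneg: "0 \<le> \<phi> i y" if "\<phi> \<in> \<Phi>" "i \<in> I" for \<phi> i y
    using that by (auto simp: \<Phi>_def)
  have meas: "\<phi> i \<in> borel_measurable borel" if "\<phi> \<in> \<Phi>" "i \<in> I" for \<phi> i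
    using that by (auto simp: \<Phi>_def)
  have int1: "integrable \<nu> (\<phi> i)" if "\<phi> \<in> \<Phi>" "i \<in> I" for \<phi> i
    using nonneg[OF that] le1[OF that] meas[OF that] by (intro integrable_const_bound[where B=1]) auto
  have int2: "integrable \<nu> (\<lambda>y. y * \<phi> i y)" if "\<phi> \<in> \<Phi>" "i \<in> I" for \<phi> i
    using nonneg[OF that] le1[OF that] meas[OF that]
    by (intro Bochner_Integration.integrable_bound[OF \<nu>(4)]) (auto simp: abs_mult intro!: mult_left_le)
  have bnd1: "\<bar>\<integral>y. \<phi> i y \<partial>\<nu>\<bar> \<le> measure \<nu> UNIV" if "\<phi> \<in> \<Phi>" "i \<in> I" for \<phi> i
  proof -
    have "(\<integral>y. \<phi> i y \<partial>\<nu>) \<le> (\<integral>y. 1 \<partial>\<nu>)" using int1[OF that] le1[OF that] by (intro integral_mono) auto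
    moreover have "0 \<le> (\<integral>y. \<phi> i y \<partial>\<nu>)" using nonneg[OF that] by (intro Bochner_Integration.integral_nonneg) auto
    ultimately show ?thesis by (simp add: \<nu>(3))
  qed
  have bnd2: "\<bar>\<integral>y. y * \<phi> i y \<partial>\<nu>\<bar> \<le> (\<integral>y. \<bar>y\<bar> \<partial>\<nu>)" if "\<phi> \<in> \<Phi>" "i \<in> I" for \<phi> i
  proof -
    have "\<bar>\<integral>y. y * \<phi> i y \<partial>\<nu>\<bar> \<le> (\<integral>y. \<bar>y * \<phi> i y\<bar> \<partial>\<nu>)" by (rule integral_abs_bound)
    also have "\<dots> \<le> (\<integral>y. \<bar>y\<bar> \<partial>\<nu>)"
    proof (rule integral_mono)
      show "\<bar>y * \<phi> i y\<bar> \<le> \<bar>y\<bar>" for y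
        using nonneg[OF that, of y] le1[OF that, of y] by (simp add: abs_mult mult_left_le)
    qed (rule integrable_abs[OF int2[OF that]] integrable_abs[OF \<nu>(4)])+
    finally show ?thesis .
  qed
  define K where "K = (\<Sum>i\<in>I. (2 * measure \<nu> UNIV)\<^sup>2 + (2 * (\<integral>y. \<bar>y\<bar> \<partial>\<nu>))\<^sup>2)"
  have K: "(\<Sum>i\<in>I. (A \<psi> i - A \<phi> i)\<^sup>2 + (C \<psi> i - C \<phi> i)\<^sup>2) \<le> K" if "\<phi> \<in> \<Phi>" "\<psi> \<in> \<Phi>" for \<phi> \<psi>
    unfolding K_def
  proof (intro sum_mono add_mono)
    fix i assume i: "i \<in> I"
    have "\<bar>A \<psi> i - A \<phi> i\<bar> \<le> \<bar>2 * measure \<nu> UNIV\<bar>"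
      using bnd1[OF that(1) i] bnd1[OF that(2) i] unfolding A_def by linarith
    then show "(A \<psi> i - A \<phi> i)\<^sup>2 \<le> (2 * measure \<nu> UNIV)\<^sup>2" by (simp only: abs_le_square_iff)
    have "\<bar>C \<psi> i - C \<phi> i\<bar> \<le> \<bar>2 * (\<integral>y. \<bar>y\<bar> \<partial>\<nu>)\<bar>"
      using bnd2[OF that(1) i] bnd2[OF that(2) i] unfolding C_def by linarith
    then show "(C \<psi> i - C \<phi> i)\<^sup>2 \<le> (2 * (\<integral>y. \<bar>y\<bar> \<partial>\<nu>))\<^sup>2" by (simp only: abs_le_square_iff)
  qed
  have V_nonneg: "0 \<le> V \<phi>" for \<phi> unfolding V_def by (intro sum_nonneg) auto
  have ne: "\<Phi> \<noteq> {}"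
  proof -
    have "(\<lambda>i y. 1 / card I) \<in> \<Phi>" using I by (auto simp: \<Phi>_def)
    then show ?thesis by blast
  qed
  \<comment> \<open>Only \<open>d \<le> 0\<close> is shown, not that the infimum is attained; hence
    the tolerance \<epsilon>.\<close>
  define d where "d = (INF \<phi>\<in>\<Phi>. V \<phi>)"
  have bdd: "bdd_below (V ` \<Phi>)" using V_nonneg by (intro bdd_belowI[of _ 0]) auto
  have d_le: "d \<le> V \<phi>" if "\<phi> \<in> \<Phi>" for \<phi> unfolding d_def using that bdd by (rule cINF_lower[rotated])
  \<comment> \<open>With \<open>u\<close> the residual vector of \<phi> and \<open>v\<close> that of
    the best response \<psi>, a move by \<open>t\<close> has squared residual
    \<open>(1 - 2t) |u|^2 + 2t <u,v> + t^2 |v - u|^2\<close>. Here \<open><u,v>\<close> is at most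
    0, and \<open>K\<close> bounds the last square uniformly.\<close>
  have improve: "d \<le> (1 - 2 * t) * V \<phi> + t\<^sup>2 * K" if \<phi>: "\<phi> \<in> \<Phi>" and t: "0 < t" "t < 1" for \<phi> t
  proof -
    define best where "best i y \<longleftrightarrow> (\<forall>j\<in>I. A \<phi> j + C \<phi> j * y \<le> A \<phi> i + C \<phi> i * y)" for i y
    \<comment> \<open>Ties between maximal affine pieces are split evenly, which keeps the shares
      measurable with sum 1.\<close>
    define \<psi> where "\<psi> i y = (if best i y then 1 else 0) / (\<Sum>j\<in>I. if best j y then 1 else (0::real))" for i y
    let ?M = "\<lambda>y. Max ((\<lambda>i. A \<phi> i + C \<phi> i * y) ` I)"
    have [measurable]: "Measurable.pred borel (best i)" for i
      unfolding best_def[abs_def] using I(1) by measurable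
    have ex_best: "\<exists>i\<in>I. best i y" for y
    proof -
      have "?M y \<in> (\<lambda>i. A \<phi> i + C \<phi> i * y) ` I" using I by (intro Max_in) auto
      then obtain i where i: "i \<in> I" "?M y = A \<phi> i + C \<phi> i * y" by blast
      then have "best i y" unfolding best_def using I Max_ge[of "(\<lambda>i. A \<phi> i + C \<phi> i * y) ` I"] by auto
      then show ?thesis using i by blast
    qed
    have best_eq: "A \<phi> i + C \<phi> i * y = ?M y" if "i \<in> I" "best i y" for i y
      using that I by (intro antisym Max_ge) (auto simp: best_def)
    have pos: "0 < (\<Sum>j\<in>I. if best j y then 1 else (0::real))" for y
      using ex_best[of y] I(1) by (auto intro!: sum_pos2)
    have \<psi>: "\<psi> \<in> \<Phi>"
    proof -
      have "(\<Sum>i\<in>I. \<psi> i y) = 1" for y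
        unfolding \<psi>_def sum_divide_distrib[symmetric] using pos[of y] by simp
      moreover have "0 \<le> \<psi> i y" for i y using pos[of y] by (simp add: \<psi>_def)
      moreover have "\<psi> i \<in> borel_measurable borel" for i unfolding \<psi>_def[abs_def] by measurable
      ultimately show ?thesis by (auto simp: \<Phi>_def)
    qed
    have sum_\<psi>: "(\<Sum>i\<in>I. \<psi> i y * (A \<phi> i + C \<phi> i * y)) = ?M y" for y
    proof -
      have "(\<Sum>i\<in>I. \<psi> i y * (A \<phi> i + C \<phi> i * y)) = (\<Sum>i\<in>I. \<psi> i y * ?M y)"
        using best_eq by (intro sum.cong) (auto simp: \<psi>_def)
      also have "\<dots> = ?M y" using \<psi> by (simp add: \<Phi>_def flip: sum_distrib_right)
      finally show ?thesis .
    qed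
    \<comment> \<open>The residual of \<phi> itself supplies the coefficients in \<open>dom\<close>;
      the outcome is the nonpositive inner product with the residual of \<psi>.\<close>
    have "(\<Sum>i\<in>I. A \<phi> i * m i + C \<phi> i * b i) \<le> (\<integral>y. (\<Sum>i\<in>I. \<psi> i y * (A \<phi> i + C \<phi> i * y)) \<partial>\<nu>)"
      unfolding sum_\<psi> by (rule dom)
    also have "\<dots> = (\<Sum>i\<in>I. \<integral>y. A \<phi> i * \<psi> i y + C \<phi> i * (y * \<psi> i y) \<partial>\<nu>)"
    proof -
      have "(\<integral>y. (\<Sum>i\<in>I. \<psi> i y * (A \<phi> i + C \<phi> i * y)) \<partial>\<nu>) = (\<integral>y. (\<Sum>i\<in>I. A \<phi> i * \<psi> i y + C \<phi> i * (y * \<psi> i y)) \<partial>\<nu>)"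
        by (intro Bochner_Integration.integral_cong sum.cong) (auto simp: algebra_simps)
      also have "\<dots> = (\<Sum>i\<in>I. \<integral>y. A \<phi> i * \<psi> i y + C \<phi> i * (y * \<psi> i y) \<partial>\<nu>)"
        using int1[OF \<psi>] int2[OF \<psi>] by (intro Bochner_Integration.integral_sum) auto
      finally show ?thesis .
    qed
    also have "\<dots> = (\<Sum>i\<in>I. A \<phi> i * (m i - A \<psi> i) + C \<phi> i * (b i - C \<psi> i))"
      using int1[OF \<psi>] int2[OF \<psi>] by (intro sum.cong) (auto simp: A_def C_def)
    finally have "0 \<le> (\<Sum>i\<in>I. A \<phi> i * (m i - A \<psi> i) + C \<phi> i * (b i - C \<psi> i)) - (\<Sum>i\<in>I. A \<phi> i * m i + C \<phi> i * b i)"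
      by simp
    also have "\<dots> = - (\<Sum>i\<in>I. A \<phi> i * A \<psi> i + C \<phi> i * C \<psi> i)"
      unfolding sum_negf[symmetric] sum_subtractf[symmetric] by (intro sum.cong) (auto simp: algebra_simps)
    finally have neg: "(\<Sum>i\<in>I. A \<phi> i * A \<psi> i + C \<phi> i * C \<psi> i) \<le> 0" by simp
    define \<xi> where "\<xi> i y = (1 - t) * \<phi> i y + t * \<psi> i y" for i y
    have \<xi>: "\<xi> \<in> \<Phi>"
    proof -
      have "(\<Sum>i\<in>I. \<xi> i y) = 1" for y
        using \<phi> \<psi> by (simp add: \<xi>_def sum.distrib \<Phi>_def flip: sum_distrib_left)
      moreover have "0 \<le> \<xi> i y" if "i \<in> I" for i y
        using t nonneg[OF \<phi> that, of y] nonneg[OF \<psi> that, of y] by (simp add: \<xi>_def)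
      moreover have "\<xi> i \<in> borel_measurable borel" if "i \<in> I" for i
        unfolding \<xi>_def[abs_def] using meas[OF \<phi> that] meas[OF \<psi> that] by measurable
      ultimately show ?thesis by (auto simp: \<Phi>_def)
    qed
    have A\<xi>: "A \<xi> i = A \<phi> i + t * (A \<psi> i - A \<phi> i)" and C\<xi>: "C \<xi> i = C \<phi> i + t * (C \<psi> i - C \<phi> i)" if "i \<in> I" for i
    proof -
      have "(\<integral>y. \<xi> i y \<partial>\<nu>) = (1 - t) * (\<integral>y. \<phi> i y \<partial>\<nu>) + t * (\<integral>y. \<psi> i y \<partial>\<nu>)"
        unfolding \<xi>_def using int1[OF \<phi> that] int1[OF \<psi> that] by simp
      then show "A \<xi> i = A \<phi> i + t * (A \<psi> i - A \<phi> i)" by (simp add: A_def algebra_simps)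
      have "(\<integral>y. y * \<xi> i y \<partial>\<nu>) = (\<integral>y. (1 - t) * (y * \<phi> i y) + t * (y * \<psi> i y) \<partial>\<nu>)"
        unfolding \<xi>_def by (intro Bochner_Integration.integral_cong) (auto simp: algebra_simps)
      also have "\<dots> = (1 - t) * (\<integral>y. y * \<phi> i y \<partial>\<nu>) + t * (\<integral>y. y * \<psi> i y \<partial>\<nu>)"
        using int2[OF \<phi> that] int2[OF \<psi> that] by simp
      finally show "C \<xi> i = C \<phi> i + t * (C \<psi> i - C \<phi> i)" by (simp add: C_def algebra_simps)
    qed
    have "V \<xi> = (\<Sum>i\<in>I. (1 - 2 * t) * ((A \<phi> i)\<^sup>2 + (C \<phi> i)\<^sup>2) + 2 * t * (A \<phi> i * A \<psi> i + C \<phi> i * C \<psi> i)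
        + t\<^sup>2 * ((A \<psi> i - A \<phi> i)\<^sup>2 + (C \<psi> i - C \<phi> i)\<^sup>2))"
      unfolding V_def by (intro sum.cong) (simp_all add: A\<xi> C\<xi> power2_eq_square algebra_simps)
    also have "\<dots> = (1 - 2 * t) * V \<phi> + 2 * t * (\<Sum>i\<in>I. A \<phi> i * A \<psi> i + C \<phi> i * C \<psi> i)
        + t\<^sup>2 * (\<Sum>i\<in>I. (A \<psi> i - A \<phi> i)\<^sup>2 + (C \<psi> i - C \<phi> i)\<^sup>2)"
      unfolding V_def by (simp only: sum_distrib_left sum.distrib[symmetric])
    also have "\<dots> \<le> (1 - 2 * t) * V \<phi> + 0 + t\<^sup>2 * K"
    proof -
      have "2 * t * (\<Sum>i\<in>I. A \<phi> i * A \<psi> i + C \<phi> i * C \<psi> i) \<le> 0"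
        by (rule mult_nonneg_nonpos[OF _ neg]) (use t in simp)
      moreover have "t\<^sup>2 * (\<Sum>i\<in>I. (A \<psi> i - A \<phi> i)\<^sup>2 + (C \<psi> i - C \<phi> i)\<^sup>2) \<le> t\<^sup>2 * K"
        by (rule mult_left_mono[OF K[OF \<phi> \<psi>]]) simp
      ultimately show ?thesis by linarith
    qed
    finally show ?thesis using d_le[OF \<xi>] by simp
  qed
  have K_nonneg: "0 \<le> K" unfolding K_def by (intro sum_nonneg) auto
  \<comment> \<open>The infimum over \<phi> in \<open>improve\<close> gives
    \<open>2 * d \<le> t * K\<close>; the restriction \<open>t < 1 / 2\<close> keeps the factor
    \<open>1 - 2 * t\<close> positive.\<close>
  have "d \<le> t * K" if t: "0 < t" "t < 1 / 2" for t
  proof -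
    have "(d - t\<^sup>2 * K) / (1 - 2 * t) \<le> d"
    proof (subst d_def, rule cINF_greatest[OF ne])
      fix \<phi> assume "\<phi> \<in> \<Phi>"
      from improve[OF this, of t] t show "(d - t\<^sup>2 * K) / (1 - 2 * t) \<le> V \<phi>"
        by (simp add: field_simps)
    qed
    then have "d - t\<^sup>2 * K \<le> d * (1 - 2 * t)" using t by (simp add: pos_divide_le_eq)
    then have "2 * (t * d) \<le> t * (t * K)" by (simp add: algebra_simps power2_eq_square)
    then have "2 * d \<le> t * K" using t by (simp add: mult.left_commute[of 2])
    moreover have "0 \<le> t * K" using t K_nonneg by simp
    ultimately show ?thesis by linarith
  qed
  then have "d \<le> 0"
    by (intro tendsto_lowerbound[of "\<lambda>t. t * K" _ "at_right 0"])
       (auto intro!: tendsto_eq_intros simp: eventually_at_right_field intro!: exI[of _ "1/2"])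
  then have "d < \<epsilon>\<^sup>2" using \<open>0 < \<epsilon>\<close> by (meson le_less_trans zero_less_power)
  then obtain \<phi> where \<phi>: "\<phi> \<in> \<Phi>" "V \<phi> < \<epsilon>\<^sup>2"
    unfolding d_def using cINF_less_iff[OF ne bdd] by auto
  have "\<bar>A \<phi> i\<bar> \<le> \<epsilon> \<and> \<bar>C \<phi> i\<bar> \<le> \<epsilon>" if i: "i \<in> I" for i
  proof -
    have "(A \<phi> i)\<^sup>2 + (C \<phi> i)\<^sup>2 \<le> V \<phi>"
      unfolding V_def using I(1) i by (intro member_le_sum) auto
    then have "(A \<phi> i)\<^sup>2 \<le> \<epsilon>\<^sup>2" "(C \<phi> i)\<^sup>2 \<le> \<epsilon>\<^sup>2"
      using \<phi>(2) zero_le_power2[of "A \<phi> i"] zero_le_power2[of "C \<phi> i"] by linarith+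
    then show ?thesis using \<open>0 < \<epsilon>\<close> by (simp add: abs_le_square_iff[symmetric])
  qed
  then show ?thesis
    using \<phi>(1) by (intro that[of \<phi>]) (auto simp: \<Phi>_def A_def C_def abs_minus_commute)
qed

section \<open>Approximate martingale couplings over a finite partition\<close>

lemma (in pair_sigma_finite)
  fixes u :: "'a \<Rightarrow> real" and v :: "'b \<Rightarrow> real"
  assumes u: "integrable M1 u" and v: "integrable M2 v"
  shows integrable_pair_product: "integrable (M1 \<Otimes>\<^sub>M M2) (\<lambda>z. u (fst z) * v (snd z))"
    and integral_pair_product: "(\<integral>z. u (fst z) * v (snd z) \<partial>(M1 \<Otimes>\<^sub>M M2)) = (\<integral>x. u x \<partial>M1) * (\<integral>y. v y \<partial>M2)"
proof -
  have [measurable]: "u \<in> borel_measurable M1" "v \<in> borel_measurable M2"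
    using u v by auto
  show int: "integrable (M1 \<Otimes>\<^sub>M M2) (\<lambda>z. u (fst z) * v (snd z))"
  proof (rule Fubini_integrable)
    show "integrable M1 (\<lambda>x. \<integral>y. norm (u (fst (x, y)) * v (snd (x, y))) \<partial>M2)"
      using u by (simp add: abs_mult)
    show "AE x in M1. integrable M2 (\<lambda>y. u (fst (x, y)) * v (snd (x, y)))"
      using v by simp
  qed measurable
  show "(\<integral>z. u (fst z) * v (snd z) \<partial>(M1 \<Otimes>\<^sub>M M2)) = (\<integral>x. u x \<partial>M1) * (\<integral>y. v y \<partial>M2)"
    using integral_fst'[OF int] by simp
qed

lemma (in finite_measure) integrable_mult_bounded:
  fixes f g :: "'a \<Rightarrow> real"
  assumes f: "integrable M f" and [measurable]: "g \<in> borel_measurable M" and g: "\<And>x. 0 \<le> g x" "\<And>x. g x \<le> 1"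
  shows "integrable M (\<lambda>x. g x * f x)" "integrable M (\<lambda>x. f x * g x)" "integrable M g"
proof -
  have [measurable]: "f \<in> borel_measurable M" using f by simp
  show *: "integrable M (\<lambda>x. g x * f x)"
    by (rule Bochner_Integration.integrable_bound[OF f]) (use g in \<open>auto simp: abs_mult intro!: mult_left_le_one_le\<close>)
  then show "integrable M (\<lambda>x. f x * g x)" by (simp add: mult.commute)
  show "integrable M g" by (rule integrable_const_bound[where B=1]) (use g in auto)
qed

text \<open>\<nu> is split into parts with densities \<open>\<phi> i\<close> whose masses and first
  moments nearly match those of \<mu> on the cells \<open>E i\<close>. Within each cell the two are
  coupled independently, and \<open>h\<close> is the resulting density with respect to the product
  measure. The constraint is controlled for all unions of cells because rational rays will be such
  unions.\<close>

lemma approximate_martingale: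
  fixes E :: "'i \<Rightarrow> real set"
  assumes mom: "finite_first_moment \<mu>" "finite_first_moment \<nu>" and ord: "\<mu> \<preceq>\<^sub>C \<nu>"
    and J: "finite J" and E: "\<And>i. i \<in> J \<Longrightarrow> E i \<in> sets borel" and disj: "disjoint_family_on E J"
    and cover: "(\<Union>i\<in>J. E i) = UNIV" and \<epsilon>: "0 < \<epsilon>"
  obtains \<pi> where "\<pi> \<in> sub_couplings \<mu> \<nu>" "measure \<mu> UNIV - \<epsilon> \<le> measure \<pi> UNIV"
    "\<And>K. K \<subseteq> J \<Longrightarrow> \<bar>\<integral>z. indicator (\<Union>i\<in>K. E i) (fst z) * (snd z - fst z) \<partial>\<pi>\<bar> \<le> \<epsilon>"
proof -
  note \<mu> = finite_first_momentD[OF mom(1)] and \<nu> = finite_first_momentD[OF mom(2)]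
  interpret mu: finite_measure \<mu> by (rule \<mu>)
  interpret nu: finite_measure \<nu> by (rule \<nu>)
  interpret P: pair_sigma_finite \<mu> \<nu> ..
  note [measurable_cong] = \<mu>(2) \<nu>(2)
  \<comment> \<open>Cells of mass zero are dropped so that errors can be measured relative to
    \<open>m i\<close>.\<close>
  define I where "I = {i\<in>J. 0 < measure \<mu> (E i)}"
  have fin_I: "finite I" and I_J: "I \<subseteq> J" using J by (auto simp: I_def)
  have EI[measurable]: "E i \<in> sets borel" if "i \<in> I" for i using E I_J that by auto
  define m where "m i = measure \<mu> (E i)" for i
  define b where "b i = (\<integral>x. indicator (E i) x * x \<partial>\<mu>)" for i
  have m_pos: "0 < m i" if "i \<in> I" for i using that by (simp add: I_def m_def)
  have int_E: "integrable \<mu> (\<lambda>x. indicator (E i) x * x)" "integrable \<mu> (indicator (E i) :: real \<Rightarrow> real)"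
    and m_eq: "(\<integral>x. indicator (E i) x \<partial>\<mu>) = m i" if "i \<in> I" for i
  proof -
    have ind: "(indicator (E i) :: real \<Rightarrow> real) \<in> borel_measurable \<mu>" using EI[OF that] by measurable
    show "integrable \<mu> (\<lambda>x. indicator (E i) x * x)" "integrable \<mu> (indicator (E i) :: real \<Rightarrow> real)"
      by (rule mu.integrable_mult_bounded(1,3)[OF \<mu>(4) ind]; simp add: indicator_def)+
    show "(\<integral>x. indicator (E i) x \<partial>\<mu>) = m i" by (simp add: m_def \<mu>(3))
  qed
  have AE_E: "AE x in \<mu>. (\<Sum>i\<in>I. indicator (E i) x) = (1::real)"
  proof -
    have "AE x in \<mu>. \<forall>i\<in>J - I. x \<notin> E i"
    proof (rule AE_finite_allI)
      fix i assume "i \<in> J - I"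
      then have i: "i \<in> J" "measure \<mu> (E i) = 0" by (auto simp: I_def zero_less_measure_iff)
      have "emeasure \<mu> (E i) = 0" by (simp only: mu.emeasure_eq_measure i(2) ennreal_0)
      moreover have "E i \<in> sets \<mu>" using E[OF i(1)] by (simp only: \<mu>(2))
      ultimately have "E i \<in> null_sets \<mu>" by (rule null_setsI)
      then show "AE x in \<mu>. x \<notin> E i" by (rule AE_not_in)
    qed (use J in auto)
    then show ?thesis
    proof eventually_elim
      case (elim x)
      obtain i where i: "i \<in> J" "x \<in> E i" using cover by blast
      then have "i \<in> I" using elim by blast
      moreover have "x \<notin> E j" if "j \<in> I" "j \<noteq> i" for j
        using disj i that I_J by (auto simp: disjoint_family_on_def)
      ultimately have "(\<Sum>i\<in>I. indicator (E i) x) = (\<Sum>j\<in>I. if j = i then 1 else (0::real))"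
        using i by (intro sum.cong) auto
      then show ?case using \<open>i \<in> I\<close> fin_I by simp
    qed
  qed
  \<comment> \<open>The shares sum to at most 1, not exactly 1, because \<open>I\<close> is empty
    when \<mu> is zero.\<close>
  have ex_\<phi>: "\<exists>\<phi> :: 'i \<Rightarrow> real \<Rightarrow> real. (\<forall>i\<in>I. \<phi> i \<in> borel_measurable borel) \<and> (\<forall>i\<in>I. \<forall>y. 0 \<le> \<phi> i y) \<and>
      (\<forall>y. (\<Sum>i\<in>I. \<phi> i y) \<le> 1) \<and> (\<forall>i\<in>I. \<bar>(\<integral>y. \<phi> i y \<partial>\<nu>) - m i\<bar> \<le> \<delta> * m i) \<and>
      (\<forall>i\<in>I. \<bar>(\<integral>y. y * \<phi> i y \<partial>\<nu>) - b i\<bar> \<le> \<delta> * m i)" if \<delta>: "0 < \<delta>" for \<delta>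
  proof (cases "I = {}")
    case False
    \<comment> \<open>The convex order enters here: the left side integrates over \<mu> the affine
      piece attached to the cell of \<open>x\<close>, which is at most the convex maximum of all
      pieces.\<close>
    have dom: "(\<Sum>i\<in>I. a i * m i + c i * b i) \<le> (\<integral>y. Max ((\<lambda>i. a i + c i * y) ` I) \<partial>\<nu>)" for a c
    proof -
      let ?M = "\<lambda>y. Max ((\<lambda>i. a i + c i * y) ` I)"
      note M_int = integrable_Max_affine[OF fin_I False]
      have "(\<Sum>i\<in>I. a i * m i + c i * b i) = (\<Sum>i\<in>I. \<integral>x. a i * indicator (E i) x + c i * (indicator (E i) x * x) \<partial>\<mu>)"
        using int_E m_eq by (intro sum.cong) (auto simp: b_def)
      also have "\<dots> = (\<integral>x. (\<Sum>i\<in>I. a i * indicator (E i) x + c i * (indicator (E i) x * x)) \<partial>\<mu>)"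
        using int_E by (intro Bochner_Integration.integral_sum[symmetric]) auto
      also have "\<dots> \<le> (\<integral>x. ?M x \<partial>\<mu>)"
      proof (rule integral_mono_AE)
        show "AE x in \<mu>. (\<Sum>i\<in>I. a i * indicator (E i) x + c i * (indicator (E i) x * x)) \<le> ?M x"
          using AE_E
        proof eventually_elim
          case (elim x)
          have "(\<Sum>i\<in>I. a i * indicator (E i) x + c i * (indicator (E i) x * x)) = (\<Sum>i\<in>I. indicator (E i) x * (a i + c i * x))"
            by (intro sum.cong) (auto simp: algebra_simps)
          also have "\<dots> \<le> (\<Sum>i\<in>I. indicator (E i) x * ?M x)"
            using fin_I by (intro sum_mono mult_left_mono Max_ge) auto
          also have "\<dots> = ?M x" using elim by (simp flip: sum_distrib_right)
          finally show ?case .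
        qed
        show "integrable \<mu> (\<lambda>x. \<Sum>i\<in>I. a i * indicator (E i) x + c i * (indicator (E i) x * x))"
          using int_E by auto
      qed (rule M_int[OF mom(1)])
      also have "\<dots> \<le> (\<integral>x. ?M x \<partial>\<nu>)"
        by (rule convex_order_integral_le[OF ord convex_on_Max_affine[OF fin_I False] M_int[OF mom(1)] M_int[OF mom(2)]])
      finally show ?thesis .
    qed
    \<comment> \<open>The least cell mass turns the uniform error of the splitting into an error
      relative to each \<open>m i\<close>.\<close>
    define m0 where "m0 = Min (m ` I)"
    have m0: "0 < m0" "\<And>i. i \<in> I \<Longrightarrow> m0 \<le> m i"
      using fin_I False m_pos by (auto simp: m0_def)
    obtain \<phi> where \<phi>: "\<And>i. i \<in> I \<Longrightarrow> \<phi> i \<in> borel_measurable borel"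
      "\<And>i y. i \<in> I \<Longrightarrow> 0 \<le> \<phi> i y" "\<And>y. (\<Sum>i\<in>I. \<phi> i y) = 1"
      "\<And>i. i \<in> I \<Longrightarrow> \<bar>(\<integral>y. \<phi> i y \<partial>\<nu>) - m i\<bar> \<le> \<delta> * m0" "\<And>i. i \<in> I \<Longrightarrow> \<bar>(\<integral>y. y * \<phi> i y \<partial>\<nu>) - b i\<bar> \<le> \<delta> * m0"
      by (rule approximate_splitting[OF fin_I False mom(2) dom, of "\<delta> * m0"]) (use \<delta> m0 in auto)
    have le: "\<delta> * m0 \<le> \<delta> * m i" if "i \<in> I" for i using m0 \<delta> that by (intro mult_left_mono) auto
    have "\<bar>(\<integral>y. \<phi> i y \<partial>\<nu>) - m i\<bar> \<le> \<delta> * m i" "\<bar>(\<integral>y. y * \<phi> i y \<partial>\<nu>) - b i\<bar> \<le> \<delta> * m i"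
      if "i \<in> I" for i
      using order_trans[OF \<phi>(4)[OF that] le[OF that]] order_trans[OF \<phi>(5)[OF that] le[OF that]] by auto
    then show ?thesis using \<phi>(1-3) by (intro exI[of _ \<phi>]) simp
  qed auto
  \<comment> \<open>The final error is at most \<delta> times the sum of
    \<open>m i + \<bar>b i\<bar>\<close>; adding 1 keeps the divisor positive.\<close>
  define \<delta> where "\<delta> = \<epsilon> / (1 + (\<Sum>i\<in>I. m i + \<bar>b i\<bar>))"
  have S_nonneg: "0 \<le> (\<Sum>i\<in>I. m i + \<bar>b i\<bar>)" using m_pos by (intro sum_nonneg) (simp add: less_imp_le)
  then have \<delta>: "0 < \<delta>" "\<delta> * (\<Sum>i\<in>I. m i + \<bar>b i\<bar>) \<le> \<epsilon>"
    using \<epsilon> by (auto simp: \<delta>_def field_simps)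
  obtain \<phi> :: "'i \<Rightarrow> real \<Rightarrow> real" where \<phi>_meas[measurable]: "\<And>i. i \<in> I \<Longrightarrow> \<phi> i \<in> borel_measurable borel"
    and \<phi>_nonneg: "\<And>i y. i \<in> I \<Longrightarrow> 0 \<le> \<phi> i y" and \<phi>_sum: "\<And>y. (\<Sum>i\<in>I. \<phi> i y) \<le> 1"
    and p_close: "\<And>i. i \<in> I \<Longrightarrow> \<bar>(\<integral>y. \<phi> i y \<partial>\<nu>) - m i\<bar> \<le> \<delta> * m i"
    and Y_close: "\<And>i. i \<in> I \<Longrightarrow> \<bar>(\<integral>y. y * \<phi> i y \<partial>\<nu>) - b i\<bar> \<le> \<delta> * m i"
    using ex_\<phi>[OF \<delta>(1)] by blast
  have \<phi>_le: "\<phi> i y \<le> 1" if "i \<in> I" for i y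
    using member_le_sum[of i I "\<lambda>i. \<phi> i y"] \<phi>_nonneg fin_I that \<phi>_sum[of y] by auto
  have int_\<phi>: "integrable \<nu> (\<lambda>y. y * \<phi> i y)" "integrable \<nu> (\<phi> i)" if "i \<in> I" for i
  proof -
    have "\<phi> i \<in> borel_measurable \<nu>" using \<phi>_meas[OF that] by simp
    from nu.integrable_mult_bounded(2,3)[OF \<nu>(4) this \<phi>_nonneg[OF that] \<phi>_le[OF that]]
    show "integrable \<nu> (\<lambda>y. y * \<phi> i y)" "integrable \<nu> (\<phi> i)" by auto
  qed
  define p where "p i = (\<integral>y. \<phi> i y \<partial>\<nu>)" for i
  define Y where "Y i = (\<integral>y. y * \<phi> i y \<partial>\<nu>)" for i
  \<comment> \<open>Normalising by the larger of the two masses keeps the marginals below both \<mu>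
    and \<nu>; either mass alone would protect only one of them.\<close>
  define w where "w i = max (m i) (p i)" for i
  have p_nonneg: "0 \<le> p i" if "i \<in> I" for i
    unfolding p_def using \<phi>_nonneg[OF that] by (intro Bochner_Integration.integral_nonneg) auto
  have w: "0 < w i" "m i \<le> w i" "p i \<le> w i" if "i \<in> I" for i using m_pos[OF that] by (auto simp: w_def)
  define h where "h z = (\<Sum>i\<in>I. (indicator (E i) (fst z) / w i) * \<phi> i (snd z))" for z :: "real \<times> real"
  have h_nonneg: "0 \<le> h z" for z
    unfolding h_def using w \<phi>_nonneg by (intro sum_nonneg mult_nonneg_nonneg divide_nonneg_nonneg) (auto simp: less_imp_le)
  have h_meas[measurable]: "h \<in> borel_measurable (\<mu> \<Otimes>\<^sub>M \<nu>)"
    unfolding h_def[abs_def] using fin_I by measurable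
  define \<pi> where "\<pi> = density (\<mu> \<Otimes>\<^sub>M \<nu>) (\<lambda>z. ennreal (h z))"
  have sets_pi: "sets \<pi> = sets borel"
    by (simp add: \<pi>_def borel_prod[symmetric] cong: sets_pair_measure_cong) (rule sets_pair_measure_cong; simp add: \<mu>(2) \<nu>(2))
  have I_product: "integrable (\<mu> \<Otimes>\<^sub>M \<nu>) (\<lambda>z. h z * (u (fst z) * v (snd z)))"
    "(\<integral>z. h z * (u (fst z) * v (snd z)) \<partial>(\<mu> \<Otimes>\<^sub>M \<nu>)) =
       (\<Sum>i\<in>I. (\<integral>x. indicator (E i) x * u x \<partial>\<mu>) * (\<integral>y. v y * \<phi> i y \<partial>\<nu>) / w i)"
    if u: "integrable \<mu> u" and v: "integrable \<nu> v" for u v :: "real \<Rightarrow> real"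
  proof -
    have hz: "h z * (u (fst z) * v (snd z)) = (\<Sum>i\<in>I. (indicator (E i) (fst z) * u (fst z)) * (v (snd z) * \<phi> i (snd z)) / w i)" for z
      unfolding h_def sum_distrib_right by (intro sum.cong) (auto simp: field_simps)
    have iu: "integrable \<mu> (\<lambda>x. indicator (E i) x * u x)" if "i \<in> I" for i
      using EI[OF that] by (intro mu.integrable_mult_bounded(1)[OF u]) auto
    have iv: "integrable \<nu> (\<lambda>y. v y * \<phi> i y)" if "i \<in> I" for i
      using \<phi>_meas[OF that] \<phi>_nonneg[OF that] \<phi>_le[OF that] by (intro nu.integrable_mult_bounded(2)[OF v]) auto
    show "integrable (\<mu> \<Otimes>\<^sub>M \<nu>) (\<lambda>z. h z * (u (fst z) * v (snd z)))"
      unfolding hz using P.integrable_pair_product[OF iu iv]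
      by (intro Bochner_Integration.integrable_sum integrable_divide_zero) auto
    show "(\<integral>z. h z * (u (fst z) * v (snd z)) \<partial>(\<mu> \<Otimes>\<^sub>M \<nu>)) =
       (\<Sum>i\<in>I. (\<integral>x. indicator (E i) x * u x \<partial>\<mu>) * (\<integral>y. v y * \<phi> i y \<partial>\<nu>) / w i)"
      unfolding hz using P.integrable_pair_product[OF iu iv] P.integral_pair_product[OF iu iv]
      by (subst Bochner_Integration.integral_sum) (auto intro!: sum.cong)
  qed
  have em_rect: "emeasure \<pi> (A \<times> B) = ennreal (\<Sum>i\<in>I. measure \<mu> (E i \<inter> A) * (\<integral>y. indicator B y * \<phi> i y \<partial>\<nu>) / w i)"
    if A[measurable]: "A \<in> sets borel" and B[measurable]: "B \<in> sets borel" for A B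
  proof -
    have AB: "A \<times> B \<in> sets (\<mu> \<Otimes>\<^sub>M \<nu>)" using A B \<mu>(2) \<nu>(2) by (intro pair_measureI) auto
    have iA: "integrable \<mu> (indicator A :: real \<Rightarrow> real)" and iB: "integrable \<nu> (indicator B :: real \<Rightarrow> real)"
      using A B by (auto simp: \<mu>(2) \<nu>(2) mu.emeasure_eq_measure nu.emeasure_eq_measure)
    have "emeasure \<pi> (A \<times> B) = (\<integral>\<^sup>+z. ennreal (h z * (indicator A (fst z) * indicator B (snd z))) \<partial>(\<mu> \<Otimes>\<^sub>M \<nu>))"
      unfolding \<pi>_def using AB by (auto simp: emeasure_density indicator_times intro!: nn_integral_cong split: split_indicator)
    also have "\<dots> = ennreal (\<Sum>i\<in>I. (\<integral>x. indicator (E i) x * indicator A x \<partial>\<mu>) * (\<integral>y. indicator B y * \<phi> i y \<partial>\<nu>) / w i)"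
      using I_product[OF iA iB] h_nonneg by (subst nn_integral_eq_integral) auto
    also have "(\<Sum>i\<in>I. (\<integral>x. indicator (E i) x * indicator A x \<partial>\<mu>) * (\<integral>y. indicator B y * \<phi> i y \<partial>\<nu>) / w i)
       = (\<Sum>i\<in>I. measure \<mu> (E i \<inter> A) * (\<integral>y. indicator B y * \<phi> i y \<partial>\<nu>) / w i)"
      by (intro sum.cong) (auto simp: \<mu>(3) simp flip: indicator_inter_arith)
    finally show ?thesis .
  qed
  have "\<pi> \<in> sub_couplings \<mu> \<nu>"
    unfolding sub_couplings_def
  proof (safe intro!: sets_pi)
    fix A :: "real set" assume A: "A \<in> sets borel"
    have "(\<Sum>i\<in>I. measure \<mu> (E i \<inter> A) * (\<integral>y. indicator UNIV y * \<phi> i y \<partial>\<nu>) / w i) \<le> (\<Sum>i\<in>I. measure \<mu> (E i \<inter> A))"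
    proof (rule sum_mono)
      fix i assume i: "i \<in> I"
      have "p i / w i \<le> 1" using w[OF i] by simp
      then have "measure \<mu> (E i \<inter> A) * (p i / w i) \<le> measure \<mu> (E i \<inter> A) * 1" by (intro mult_left_mono) auto
      then show "measure \<mu> (E i \<inter> A) * (\<integral>y. indicator UNIV y * \<phi> i y \<partial>\<nu>) / w i \<le> measure \<mu> (E i \<inter> A)"
        by (simp add: p_def)
    qed
    also have "\<dots> = measure \<mu> (\<Union>i\<in>I. E i \<inter> A)"
      using disj I_J EI A by (intro mu.finite_measure_finite_Union[symmetric] fin_I) (auto simp: \<mu>(2) disjoint_family_on_def)
    also have "\<dots> \<le> measure \<mu> A" using A by (intro mu.finite_measure_mono) (auto simp: \<mu>(2))
    finally show "emeasure \<pi> (A \<times> UNIV) \<le> emeasure \<mu> A"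
      using A by (simp add: em_rect mu.emeasure_eq_measure ennreal_leI)
  next
    fix B :: "real set" assume B[measurable]: "B \<in> sets borel"
    have iB: "integrable \<nu> (\<lambda>y. indicator B y * \<phi> i y)" if "i \<in> I" for i
      using B by (intro nu.integrable_mult_bounded(1)[OF int_\<phi>(2)[OF that]]) auto
    have "(\<Sum>i\<in>I. measure \<mu> (E i \<inter> UNIV) * (\<integral>y. indicator B y * \<phi> i y \<partial>\<nu>) / w i) \<le> (\<Sum>i\<in>I. \<integral>y. indicator B y * \<phi> i y \<partial>\<nu>)"
    proof (rule sum_mono)
      fix i assume i: "i \<in> I"
      have "m i / w i \<le> 1" using w[OF i] by simp
      then have "(m i / w i) * (\<integral>y. indicator B y * \<phi> i y \<partial>\<nu>) \<le> 1 * (\<integral>y. indicator B y * \<phi> i y \<partial>\<nu>)"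
        using \<phi>_nonneg[OF i] by (intro mult_right_mono Bochner_Integration.integral_nonneg) auto
      then show "measure \<mu> (E i \<inter> UNIV) * (\<integral>y. indicator B y * \<phi> i y \<partial>\<nu>) / w i \<le> (\<integral>y. indicator B y * \<phi> i y \<partial>\<nu>)"
        by (simp add: m_def)
    qed
    also have "\<dots> = (\<integral>y. (\<Sum>i\<in>I. indicator B y * \<phi> i y) \<partial>\<nu>)"
      using iB by (intro Bochner_Integration.integral_sum[symmetric])
    also have "\<dots> \<le> (\<integral>y. indicator B y \<partial>\<nu>)"
    proof (rule integral_mono)
      show "(\<Sum>i\<in>I. indicator B y * \<phi> i y) \<le> (indicator B y :: real)" for y
        using \<phi>_sum[of y] by (auto simp: indicator_def simp flip: sum_distrib_left)
    qed (use iB B in \<open>auto simp: \<nu>(2) nu.emeasure_eq_measure\<close>)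
    finally show "emeasure \<pi> (UNIV \<times> B) \<le> emeasure \<nu> B"
      using B by (simp add: em_rect nu.emeasure_eq_measure ennreal_leI \<nu>(3))
  qed
  moreover have "measure \<mu> UNIV - \<epsilon> \<le> measure \<pi> UNIV"
  proof -
    have "measure \<mu> UNIV = (\<integral>x. 1 \<partial>\<mu>)" by (simp add: \<mu>(3))
    also have "\<dots> = (\<integral>x. (\<Sum>i\<in>I. indicator (E i) x) \<partial>\<mu>)"
      using AE_E by (intro integral_cong_AE) auto
    also have "\<dots> = (\<Sum>i\<in>I. m i)"
      using int_E(2) m_eq by (subst Bochner_Integration.integral_sum) auto
    finally have mass: "measure \<mu> UNIV = (\<Sum>i\<in>I. m i)" .
    have "(\<Sum>i\<in>I. m i - \<delta> * m i) \<le> (\<Sum>i\<in>I. m i * p i / w i)"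
    proof (rule sum_mono)
      fix i assume i: "i \<in> I"
      show "m i - \<delta> * m i \<le> m i * p i / w i"
      proof (cases "m i \<le> p i")
        case True
        then have "w i = p i" by (simp add: w_def)
        then show ?thesis using w[OF i] m_pos[OF i] \<delta> by simp
      next
        case False
        then have "w i = m i" by (simp add: w_def)
        then show ?thesis using p_close[OF i] m_pos[OF i] by (simp add: p_def)
      qed
    qed
    moreover have "(\<Sum>i\<in>I. m i - \<delta> * m i) = measure \<mu> UNIV - \<delta> * (\<Sum>i\<in>I. m i)"
      by (simp add: mass sum_subtractf sum_distrib_left)
    moreover have "\<delta> * (\<Sum>i\<in>I. m i) \<le> \<epsilon>"
    proof -
      have "\<delta> * (\<Sum>i\<in>I. m i) \<le> \<delta> * (\<Sum>i\<in>I. m i + \<bar>b i\<bar>)"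
        using \<delta>(1) by (intro mult_left_mono sum_mono) auto
      then show ?thesis using \<delta>(2) by linarith
    qed
    moreover have "measure \<pi> UNIV = (\<Sum>i\<in>I. m i * p i / w i)"
    proof -
      have "0 \<le> (\<Sum>i\<in>I. m i * p i / w i)" using m_pos p_nonneg w by (intro sum_nonneg) (simp add: less_imp_le)
      then show ?thesis using em_rect[of UNIV UNIV] by (simp add: measure_def m_def p_def)
    qed
    ultimately show ?thesis by linarith
  qed
  moreover have "\<bar>\<integral>z. indicator (\<Union>i\<in>K. E i) (fst z) * (snd z - fst z) \<partial>\<pi>\<bar> \<le> \<epsilon>" if K: "K \<subseteq> J" for K
  proof -
    let ?H = "\<Union>i\<in>K. E i"
    have H[measurable]: "?H \<in> sets borel" using E K J by (intro sets.finite_UN finite_subset[OF K]) auto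
    have ind: "indicator (E i) x * indicator ?H x = (if i \<in> K then indicator (E i) x else (0::real))" if "i \<in> I" for i x
    proof -
      have "E i \<inter> E j = {}" if "j \<in> K" "i \<notin> K" for j
      proof (rule disjoint_family_onD[OF disj])
        show "i \<in> J" "j \<in> J" "i \<noteq> j" using I_J K \<open>i \<in> I\<close> that by auto
      qed
      then show ?thesis by (auto simp: indicator_def)
    qed
    have i1: "integrable \<mu> (indicator ?H :: real \<Rightarrow> real)" using H by (simp add: \<mu>(2) mu.emeasure_eq_measure)
    have i2: "integrable \<mu> (\<lambda>x. indicator ?H x * x)" using H by (intro mu.integrable_mult_bounded(1)[OF \<mu>(4)]) auto
    have i3: "integrable \<nu> (\<lambda>y. 1 :: real)" by simp
    have "(\<integral>z. indicator ?H (fst z) * (snd z - fst z) \<partial>\<pi>) =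
        (\<integral>z. h z * (indicator ?H (fst z) * (snd z - fst z)) \<partial>(\<mu> \<Otimes>\<^sub>M \<nu>))"
      unfolding \<pi>_def using h_nonneg by (subst integral_density) auto
    also have "\<dots> = (\<integral>z. h z * (indicator ?H (fst z) * snd z) - h z * ((indicator ?H (fst z) * fst z) * 1) \<partial>(\<mu> \<Otimes>\<^sub>M \<nu>))"
      by (intro Bochner_Integration.integral_cong) (auto simp: algebra_simps)
    also have "\<dots> = (\<Sum>i\<in>I. (\<integral>x. indicator (E i) x * indicator ?H x \<partial>\<mu>) * (\<integral>y. y * \<phi> i y \<partial>\<nu>) / w i) -
        (\<Sum>i\<in>I. (\<integral>x. indicator (E i) x * (indicator ?H x * x) \<partial>\<mu>) * (\<integral>y. 1 * \<phi> i y \<partial>\<nu>) / w i)"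
      using I_product[OF i1 \<nu>(4)] I_product[OF i2 i3] by simp
    also have "\<dots> = (\<Sum>i\<in>I. if i \<in> K then (m i * Y i - b i * p i) / w i else 0)"
      unfolding sum_subtractf[symmetric]
    proof (rule sum.cong)
      fix i assume i: "i \<in> I"
      have "(\<integral>x. indicator (E i) x * indicator ?H x \<partial>\<mu>) = (if i \<in> K then m i else 0)"
        using m_eq[OF i] by (simp add: ind[OF i])
      moreover have "(\<integral>x. indicator (E i) x * (indicator ?H x * x) \<partial>\<mu>) = (if i \<in> K then b i else 0)"
        unfolding mult.assoc[symmetric] by (simp add: ind[OF i] b_def)
      ultimately show "(\<integral>x. indicator (E i) x * indicator ?H x \<partial>\<mu>) * (\<integral>y. y * \<phi> i y \<partial>\<nu>) / w i -
          (\<integral>x. indicator (E i) x * (indicator ?H x * x) \<partial>\<mu>) * (\<integral>y. 1 * \<phi> i y \<partial>\<nu>) / w i =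
          (if i \<in> K then (m i * Y i - b i * p i) / w i else 0)"
        by (simp add: Y_def p_def diff_divide_distrib)
    qed simp
    finally have eq: "(\<integral>z. indicator ?H (fst z) * (snd z - fst z) \<partial>\<pi>) =
        (\<Sum>i\<in>I. if i \<in> K then (m i * Y i - b i * p i) / w i else 0)" .
    have "\<bar>\<Sum>i\<in>I. if i \<in> K then (m i * Y i - b i * p i) / w i else 0\<bar> \<le> (\<Sum>i\<in>I. \<delta> * (m i + \<bar>b i\<bar>))"
    proof (rule order_trans[OF sum_abs], rule sum_mono)
      fix i assume i: "i \<in> I"
      \<comment> \<open>The error of a cell would vanish for \<open>Y i = b i\<close> and
        \<open>p i = m i\<close>; it is separated into the two deviations.\<close>
      have "m i * Y i - b i * p i = m i * (Y i - b i) + b i * (m i - p i)" by (simp add: algebra_simps)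
      then have "\<bar>m i * Y i - b i * p i\<bar> \<le> \<bar>m i\<bar> * \<bar>Y i - b i\<bar> + \<bar>b i\<bar> * \<bar>m i - p i\<bar>"
        by (metis abs_mult abs_triangle_ineq)
      also have "\<dots> \<le> w i * (\<delta> * m i) + \<bar>b i\<bar> * (\<delta> * w i)"
      proof (intro add_mono mult_mono)
        show "\<bar>m i - p i\<bar> \<le> \<delta> * w i"
          using p_close[OF i] mult_left_mono[OF w(2)[OF i] less_imp_le[OF \<delta>(1)]] by (simp add: p_def)
      qed (use Y_close[OF i] m_pos[OF i] w[OF i] in \<open>auto simp: Y_def\<close>)
      also have "\<dots> = \<delta> * (m i + \<bar>b i\<bar>) * w i" by (simp add: algebra_simps)
      finally have "\<bar>m i * Y i - b i * p i\<bar> / w i \<le> \<delta> * (m i + \<bar>b i\<bar>)" using w(1)[OF i] by (simp add: pos_divide_le_eq)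
      moreover have "0 \<le> \<delta> * (m i + \<bar>b i\<bar>)" using \<delta>(1) m_pos[OF i] by (intro mult_nonneg_nonneg) auto
      ultimately show "\<bar>if i \<in> K then (m i * Y i - b i * p i) / w i else 0\<bar> \<le> \<delta> * (m i + \<bar>b i\<bar>)"
        using w(1)[OF i] by simp
    qed
    also have "\<dots> \<le> \<epsilon>" using \<delta>(2) by (simp add: sum_distrib_left)
    finally show ?thesis unfolding eq .
  qed
  ultimately show ?thesis by (rule that)
qed

text \<open>The cells are cut out by the first \<open>n\<close> rationals, so each fixed rational
  ray is a union of cells once \<open>n\<close> exceeds its index. Every constraint therefore holds
  in the limit.\<close>

theorem martingale_plan_exists:
  assumes mom: "finite_first_moment \<mu>" "finite_first_moment \<nu>" and ord: "\<mu> \<preceq>\<^sub>C \<nu>"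
  shows "martingale_plans \<mu> \<nu> \<noteq> {}"
proof -
  define r :: "nat \<Rightarrow> real" where "r k = of_rat (from_nat k)" for k
  \<comment> \<open>A cell is labelled by the indices of those rationals that lie strictly below its
    points; the ray up to a rational is then the union of the cells whose label omits its
    index.\<close>
  define E where "E n i = {x. {k. k < n \<and> r k < x} = i}" for n and i :: "nat set"
  have E_borel: "E n i \<in> sets borel" for n i
  proof -
    have "E n i = {x. \<forall>k. (k < n \<and> r k < x) = (k \<in> i)}" by (auto simp: E_def)
    also have "\<dots> \<in> sets borel" by measurable
    finally show ?thesis .
  qed
  define P where "P n \<pi> \<longleftrightarrow> \<pi> \<in> sub_couplings \<mu> \<nu> \<and> measure \<mu> UNIV - 1 / Suc n \<le> measure \<pi> UNIV \<and>
      (\<forall>K\<subseteq>Pow {..<n}. \<bar>\<integral>z. indicator (\<Union>i\<in>K. E n i) (fst z) * (snd z - fst z) \<partial>\<pi>\<bar> \<le> 1 / Suc n)" for n \<pi>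
  have "\<exists>\<pi>. P n \<pi>" for n
  proof -
    have disj: "disjoint_family_on (E n) (Pow {..<n})" by (auto simp: disjoint_family_on_def E_def)
    have cover: "(\<Union>i\<in>Pow {..<n}. E n i) = UNIV" by (auto simp: E_def)
    have pos: "0 < 1 / real (Suc n)" by simp
    obtain \<pi> where "\<pi> \<in> sub_couplings \<mu> \<nu>" "measure \<mu> UNIV - 1 / Suc n \<le> measure \<pi> UNIV"
      "\<And>K. K \<subseteq> Pow {..<n} \<Longrightarrow> \<bar>\<integral>z. indicator (\<Union>i\<in>K. E n i) (fst z) * (snd z - fst z) \<partial>\<pi>\<bar> \<le> 1 / Suc n"
      by (rule approximate_martingale[OF mom ord _ E_borel disj cover pos], simp) (rule that; blast)
    then show ?thesis unfolding P_def by blast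
  qed
  then obtain \<pi>n where "\<And>n. P n (\<pi>n n)" by metis
  then have \<pi>n: "\<And>n. \<pi>n n \<in> sub_couplings \<mu> \<nu>"
    and big: "\<And>n. measure \<mu> UNIV - 1 / Suc n \<le> measure (\<pi>n n) UNIV"
    and small: "\<And>n K. K \<subseteq> Pow {..<n} \<Longrightarrow> \<bar>\<integral>z. indicator (\<Union>i\<in>K. E n i) (fst z) * (snd z - fst z) \<partial>\<pi>n n\<bar> \<le> 1 / Suc n"
    unfolding P_def by blast+
  have lim_inv: "(\<lambda>n. 1 / real (Suc n)) \<longlonglongrightarrow> 0" using LIMSEQ_inverse_real_of_nat by (simp add: inverse_eq_divide)
  have total: "(\<lambda>n. measure (\<pi>n n) UNIV) \<longlonglongrightarrow> measure \<mu> UNIV"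
  proof (rule real_tendsto_sandwich[OF _ _ _ tendsto_const])
    show "(\<lambda>n. measure \<mu> UNIV - 1 / Suc n) \<longlonglongrightarrow> measure \<mu> UNIV"
      using tendsto_diff[OF tendsto_const lim_inv, of "measure \<mu> UNIV"] by simp
    have "measure (\<pi>n n) UNIV \<le> measure \<mu> UNIV" for n
      using sub_coupling_deficit(2)[OF mom \<pi>n, of UNIV n] by simp
    then show "\<forall>\<^sub>F n in sequentially. measure (\<pi>n n) UNIV \<le> measure \<mu> UNIV" by simp
  qed (use big in simp)
  obtain s \<pi> where s: "strict_mono s" and \<pi>: "\<pi> \<in> couplings \<mu> \<nu>"
    and conv: "\<And>A t. A \<in> sets borel \<Longrightarrow> (\<lambda>n. measure (\<pi>n (s n)) (A \<times> {..t})) \<longlonglongrightarrow> measure \<pi> (A \<times> {..t})"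
    and convU: "\<And>A. A \<in> sets borel \<Longrightarrow> (\<lambda>n. measure (\<pi>n (s n)) (A \<times> UNIV)) \<longlonglongrightarrow> measure \<pi> (A \<times> UNIV)"
    by (rule sub_couplings_sequentially_compact[OF mom \<pi>n convex_order_mass[OF mom ord] total]) blast
  have "\<pi> \<in> martingale_plans \<mu> \<nu>"
  proof (rule martingale_planI[OF mom \<pi>])
    fix q :: rat
    let ?H = "{..real_of_rat q}"
    have "(\<lambda>n. \<integral>z. indicator ?H (fst z) * (snd z - fst z) \<partial>\<pi>n (s n)) \<longlonglongrightarrow> (\<integral>z. indicator ?H (fst z) * (snd z - fst z) \<partial>\<pi>)"
      by (rule tendsto_integral_diff[OF mom _ \<pi> conv convU]) (auto intro: \<pi>n)
    moreover have "(\<lambda>n. \<integral>z. indicator ?H (fst z) * (snd z - fst z) \<partial>\<pi>n (s n)) \<longlonglongrightarrow> 0"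
    proof (rule Lim_null_comparison)
      show "(\<lambda>n. 1 / real (Suc (s n))) \<longlonglongrightarrow> 0"
        using LIMSEQ_subseq_LIMSEQ[OF lim_inv s] by (simp add: comp_def)
      show "\<forall>\<^sub>F n in sequentially. norm (\<integral>z. indicator ?H (fst z) * (snd z - fst z) \<partial>\<pi>n (s n)) \<le> 1 / real (Suc (s n))"
      proof (rule eventually_sequentiallyI)
        fix n assume "Suc (to_nat q) \<le> n"
        then have n: "to_nat q < s n" using seq_suble[OF s, of n] by linarith
        have "?H = (\<Union>i\<in>{i\<in>Pow {..<s n}. to_nat q \<notin> i}. E (s n) i)"
          using n by (auto simp: E_def r_def not_less)
        moreover have "{i\<in>Pow {..<s n}. to_nat q \<notin> i} \<subseteq> Pow {..<s n}" by blast
        ultimately show "norm (\<integral>z. indicator ?H (fst z) * (snd z - fst z) \<partial>\<pi>n (s n)) \<le> 1 / real (Suc (s n))"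
          using small by (simp only: real_norm_def)
      qed
    qed
    ultimately show "(\<integral>z. indicator ?H (fst z) * (snd z - fst z) \<partial>\<pi>) = 0" by (rule LIMSEQ_unique)
  qed
  then show ?thesis by blast
qed

section \<open>The direct method for the expected distance\<close>

definition maximises_distance :: "real measure \<Rightarrow> real measure \<Rightarrow> (real \<times> real) measure \<Rightarrow> bool" where
  "maximises_distance \<mu> \<nu> \<pi> \<longleftrightarrow> \<pi> \<in> martingale_plans \<mu> \<nu> \<and>
     (\<forall>\<rho>\<in>martingale_plans \<mu> \<nu>. (\<integral>z. \<bar>snd z - fst z\<bar> \<partial>\<rho>) \<le> (\<integral>z. \<bar>snd z - fst z\<bar> \<partial>\<pi>))"

text \<open>Along the convergent subsequence the expected distance converges, and not merely
  semicontinuously, because the layers of all couplings share one integrable majorant.\<close>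

theorem distance_maximiser_exists:
  assumes mom: "finite_first_moment \<mu>" "finite_first_moment \<nu>" and ord: "\<mu> \<preceq>\<^sub>C \<nu>"
  shows "\<exists>\<pi>. maximises_distance \<mu> \<nu> \<pi>"
proof -
  note \<mu> = finite_first_momentD[OF mom(1)] and \<nu> = finite_first_momentD[OF mom(2)]
  define G where "G \<rho> = (\<integral>z. \<bar>snd z - fst z\<bar> \<partial>\<rho>)" for \<rho> :: "(real \<times> real) measure"
  have coup: "\<rho> \<in> couplings \<mu> \<nu>" if "\<rho> \<in> martingale_plans \<mu> \<nu>" for \<rho>
    using that by (auto simp: martingale_plans_def couplings_def)
  have bound: "G \<rho> \<le> (\<integral>y. \<bar>y\<bar> \<partial>\<nu>) + (\<integral>x. \<bar>x\<bar> \<partial>\<mu>)" if "\<rho> \<in> martingale_plans \<mu> \<nu>" for \<rho>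
  proof -
    note c = coup[OF that]
    note i = integrable_coupling_fst[OF mom c] integrable_coupling_snd[OF mom c]
    have "G \<rho> \<le> (\<integral>z. \<bar>snd z\<bar> + \<bar>fst z\<bar> \<partial>\<rho>)"
      unfolding G_def using i by (intro integral_mono) auto
    also have "\<dots> = (\<integral>z. \<bar>snd z\<bar> \<partial>\<rho>) + (\<integral>z. \<bar>fst z\<bar> \<partial>\<rho>)" using i by simp
    also have "(\<integral>z. \<bar>snd z\<bar> \<partial>\<rho>) = (\<integral>y. \<bar>y\<bar> \<partial>\<nu>)"
      unfolding distr_snd_coupling[OF mom c, symmetric]
      by (rule integral_distr[symmetric]) (use measurable_coupling[OF mom c] in auto)
    also have "(\<integral>z. \<bar>fst z\<bar> \<partial>\<rho>) = (\<integral>x. \<bar>x\<bar> \<partial>\<mu>)"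
      unfolding distr_fst_coupling[OF mom c, symmetric]
      by (rule integral_distr[symmetric]) (use measurable_coupling[OF mom c] in auto)
    finally show ?thesis .
  qed
  have ne: "martingale_plans \<mu> \<nu> \<noteq> {}" by (rule martingale_plan_exists[OF mom ord])
  have bdd: "bdd_above (G ` martingale_plans \<mu> \<nu>)" using bound by (intro bdd_aboveI) auto
  define S where "S = (SUP \<rho>\<in>martingale_plans \<mu> \<nu>. G \<rho>)"
  have le_S: "G \<rho> \<le> S" if "\<rho> \<in> martingale_plans \<mu> \<nu>" for \<rho>
    unfolding S_def using that bdd by (rule cSUP_upper)
  have "\<exists>\<rho>\<in>martingale_plans \<mu> \<nu>. S - 1 / Suc n < G \<rho>" for n
    using less_cSUP_iff[OF ne bdd, of "S - 1 / Suc n"] by (simp add: S_def)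
  then obtain \<pi>n where \<pi>n: "\<And>n. \<pi>n n \<in> martingale_plans \<mu> \<nu>" and near: "\<And>n. S - 1 / Suc n < G (\<pi>n n)"
    by metis
  have sub: "\<pi>n n \<in> sub_couplings \<mu> \<nu>" for n by (rule coupling_is_sub_coupling[OF mom coup[OF \<pi>n]])
  have total: "(\<lambda>n. measure (\<pi>n n) UNIV) \<longlonglongrightarrow> measure \<mu> UNIV"
    using emeasure_coupling_fst[OF mom coup[OF \<pi>n], of UNIV] by (simp add: measure_def)
  obtain s \<pi> where s: "strict_mono s" and \<pi>: "\<pi> \<in> couplings \<mu> \<nu>"
    and conv: "\<And>A t. A \<in> sets borel \<Longrightarrow> (\<lambda>n. measure (\<pi>n (s n)) (A \<times> {..t})) \<longlonglongrightarrow> measure \<pi> (A \<times> {..t})"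
    and convU: "\<And>A. A \<in> sets borel \<Longrightarrow> (\<lambda>n. measure (\<pi>n (s n)) (A \<times> UNIV)) \<longlonglongrightarrow> measure \<pi> (A \<times> UNIV)"
    by (rule sub_couplings_sequentially_compact[OF mom sub convex_order_mass[OF mom ord] total]) blast
  have mart: "\<pi> \<in> martingale_plans \<mu> \<nu>"
  proof (rule martingale_planI[OF mom \<pi>])
    fix q :: rat
    let ?H = "{..real_of_rat q}"
    have "(\<lambda>n. \<integral>z. indicator ?H (fst z) * (snd z - fst z) \<partial>\<pi>n (s n)) \<longlonglongrightarrow> (\<integral>z. indicator ?H (fst z) * (snd z - fst z) \<partial>\<pi>)"
      by (rule tendsto_integral_diff[OF mom _ \<pi> conv convU]) (auto intro: sub)
    then show "(\<integral>z. indicator ?H (fst z) * (snd z - fst z) \<partial>\<pi>) = 0"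
      by (simp add: martingale_plan_integral_zero[OF mom \<pi>n] LIMSEQ_const_iff)
  qed
  have "(\<lambda>n. G (\<pi>n (s n))) \<longlonglongrightarrow> G \<pi>"
    unfolding G_def by (rule tendsto_integral_abs_diff[OF mom _ \<pi> conv convU, of UNIV]) (auto intro: sub)
  moreover have "(\<lambda>n. S - 1 / real (Suc (s n))) \<longlonglongrightarrow> S"
    using LIMSEQ_subseq_LIMSEQ[OF tendsto_diff[OF tendsto_const LIMSEQ_inverse_real_of_nat, of S] s]
    by (simp add: comp_def inverse_eq_divide)
  ultimately have "S \<le> G \<pi>"
    using near by (intro LIMSEQ_le) (auto intro!: less_imp_le)
  then show ?thesis
    using mart le_S by (intro exI[of _ \<pi>]) (auto simp: maximises_distance_def G_def intro: order_trans)
qed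

section \<open>Exchanging images of independent points\<close>

lemma fst_snd_borel[measurable]:
  "fst \<in> borel_measurable (borel :: (real \<times> real) measure)" "snd \<in> borel_measurable (borel :: (real \<times> real) measure)"
  by (rule measurable_fst_snd_borel[OF refl])+

text \<open>Given independent points \<open>\<omega> = ((x, y), (x', y'))\<close>, the first component of \<open>b\<close> decides whether
  \<open>y\<close> and \<open>y'\<close> are exchanged, and the second one which of the two resulting points is taken.\<close>

definition swap_point :: "((real \<times> real) \<times> (real \<times> real)) \<times> (bool \<times> bool) \<Rightarrow> real \<times> real" where
  "swap_point = (\<lambda>(\<omega>, b). (fst (if snd b then fst \<omega> else snd \<omega>), snd (if snd b \<noteq> fst b then fst \<omega> else snd \<omega>)))"

definition swap_gain :: "(real \<times> real \<Rightarrow> real) \<Rightarrow> (real \<times> real) \<times> (real \<times> real) \<Rightarrow> real" where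
  "swap_gain f \<omega> = f (fst (fst \<omega>), snd (snd \<omega>)) + f (fst (snd \<omega>), snd (fst \<omega>)) - f (fst \<omega>) - f (snd \<omega>)"

text \<open>Exchanged pairs get weight \<open>r\<close>, the others the rest of
  \<open>1 / (2 * c)\<close>. Each pair yields two points and integrating out the partner costs the
  total mass \<open>c\<close>, so \<open>r = 0\<close> returns \<pi>.\<close>

definition swap_plan :: "(real \<times> real) measure \<Rightarrow> real \<Rightarrow> ((real \<times> real) \<times> (real \<times> real) \<Rightarrow> real) \<Rightarrow> (real \<times> real) measure" where
  "swap_plan \<pi> c r = distr (density ((\<pi> \<Otimes>\<^sub>M \<pi>) \<Otimes>\<^sub>M count_space UNIV)
     (\<lambda>(\<omega>, b). ennreal (if fst b then r \<omega> else 1 / (2 * c) - r \<omega>))) borel swap_point"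

text \<open>The part \<open>1 / (2 * c)\<close> of the weights reproduces \<pi>, and the terms with
  \<open>r\<close> add up to the gain. The growth bound covers all functions to be tested:
  indicators, martingale constraints and the distance.\<close>

lemma swap_plan_integral:
  fixes \<pi> :: "(real \<times> real) measure" and f :: "real \<times> real \<Rightarrow> real"
  assumes fin: "finite_measure \<pi>" and sets_pi[measurable_cong]: "sets \<pi> = sets borel"
    and i1: "integrable \<pi> fst" and i2: "integrable \<pi> snd"
    and c: "c = measure \<pi> UNIV" "0 < c"
    and r[measurable]: "r \<in> borel_measurable (borel \<Otimes>\<^sub>M borel)" and r_bnd: "\<And>\<omega>. 0 \<le> r \<omega>" "\<And>\<omega>. r \<omega> \<le> 1 / (2 * c)"
    and f[measurable]: "f \<in> borel_measurable borel" and growth: "\<And>x y. \<bar>f (x, y)\<bar> \<le> 1 + \<bar>x\<bar> + \<bar>y\<bar>"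
  shows "integrable (swap_plan \<pi> c r) f"
    and "integrable (\<pi> \<Otimes>\<^sub>M \<pi>) (\<lambda>\<omega>. r \<omega> * swap_gain f \<omega>)"
    and "(\<integral>z. f z \<partial>swap_plan \<pi> c r) = (\<integral>z. f z \<partial>\<pi>) + (\<integral>\<omega>. r \<omega> * swap_gain f \<omega> \<partial>(\<pi> \<Otimes>\<^sub>M \<pi>))"
proof -
  interpret pi: finite_measure \<pi> by fact
  interpret PP: pair_sigma_finite \<pi> \<pi> ..
  have space_pi: "space \<pi> = UNIV" using sets_eq_imp_space_eq[OF sets_pi] by simp
  interpret C: sigma_finite_measure "count_space (UNIV :: (bool \<times> bool) set)"
    by (rule sigma_finite_measure_count_space_finite) simp
  interpret PC: pair_sigma_finite "\<pi> \<Otimes>\<^sub>M \<pi>" "count_space (UNIV :: (bool \<times> bool) set)" ..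
  have [measurable]: "r \<in> borel_measurable (\<pi> \<Otimes>\<^sub>M \<pi>)"
    using r by (simp cong: measurable_cong_sets sets_pair_measure_cong add: sets_pi)
  define W where "W \<omega> b = (if fst b then r \<omega> else 1 / (2 * c) - r \<omega>)" for \<omega> and b :: "bool \<times> bool"
  have W: "0 \<le> W \<omega> b" "W \<omega> b \<le> 1 / (2 * c)" for \<omega> b using r_bnd by (auto simp: W_def)
  define \<Omega> where "\<Omega> = (\<pi> \<Otimes>\<^sub>M \<pi>) \<Otimes>\<^sub>M count_space (UNIV :: (bool \<times> bool) set)"
  \<comment> \<open>The last factor is finite, so measurability may be checked for each value of
    \<open>b\<close> separately.\<close>
  have W_meas[measurable]: "(\<lambda>z. W (fst z) (snd z)) \<in> borel_measurable \<Omega>"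
    unfolding \<Omega>_def
  proof (rule measurable_compose_countable[where g=snd and f="\<lambda>b z. W (fst z) b"])
    fix b
    have "(\<lambda>\<omega>. W \<omega> b) \<in> borel_measurable (\<pi> \<Otimes>\<^sub>M \<pi>)" by (cases "fst b") (simp_all add: W_def)
    then show "(\<lambda>z. W (fst z) b) \<in> borel_measurable ((\<pi> \<Otimes>\<^sub>M \<pi>) \<Otimes>\<^sub>M count_space UNIV)"
      by (rule measurable_compose[OF measurable_fst])
  qed simp
  have T_meas[measurable]: "swap_point \<in> \<Omega> \<rightarrow>\<^sub>M borel"
  proof -
    have "(\<lambda>z. swap_point (fst z, snd z)) \<in> \<Omega> \<rightarrow>\<^sub>M borel \<Otimes>\<^sub>M borel"
      unfolding \<Omega>_def
    proof (rule measurable_compose_countable[where g=snd and f="\<lambda>b z. swap_point (fst z, b)"])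
      fix b
      have [measurable]: "(\<lambda>\<omega>. if p then fst \<omega> else snd \<omega>) \<in> \<pi> \<Otimes>\<^sub>M \<pi> \<rightarrow>\<^sub>M borel" for p
        by (cases p) (simp_all add: measurable_cong_sets[OF refl sets_pi[symmetric]])
      have "(\<lambda>\<omega>. swap_point (\<omega>, b)) \<in> \<pi> \<Otimes>\<^sub>M \<pi> \<rightarrow>\<^sub>M borel \<Otimes>\<^sub>M borel"
        unfolding swap_point_def case_prod_conv
        by (intro measurable_Pair measurable_compose[OF _ fst_snd_borel(1)] measurable_compose[OF _ fst_snd_borel(2)]) measurable
      then show "(\<lambda>z. swap_point (fst z, b)) \<in> (\<pi> \<Otimes>\<^sub>M \<pi>) \<Otimes>\<^sub>M count_space UNIV \<rightarrow>\<^sub>M borel \<Otimes>\<^sub>M borel"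
        by (rule measurable_compose[OF measurable_fst])
    qed simp
    then show ?thesis by (simp add: borel_prod)
  qed
  have sp_eq: "swap_plan \<pi> c r = distr (density \<Omega> (\<lambda>z. ennreal (W (fst z) (snd z)))) borel swap_point"
    by (simp add: swap_plan_def \<Omega>_def W_def case_prod_beta')
  have [measurable]: "fst \<in> borel_measurable \<pi>" "snd \<in> borel_measurable \<pi>" using i1 i2 by auto
  have one: "integrable \<pi> (\<lambda>_. 1 :: real)" by simp
  define bd where "bd \<omega> = (1 + \<bar>fst (fst \<omega>)\<bar> + \<bar>snd (fst \<omega>)\<bar>) + (1 + \<bar>fst (snd \<omega>)\<bar> + \<bar>snd (snd \<omega>)\<bar>)"
    for \<omega> :: "(real \<times> real) \<times> (real \<times> real)"
  define g where "g z = 1 + \<bar>fst z\<bar> + \<bar>snd z\<bar>" for z :: "real \<times> real"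
  have g: "integrable \<pi> g" unfolding g_def[abs_def] using i1 i2 by simp
  have int_bd: "integrable (\<pi> \<Otimes>\<^sub>M \<pi>) bd"
    using PP.integrable_pair_product[OF g one] PP.integrable_pair_product[OF one g]
    unfolding bd_def[abs_def] g_def[symmetric] by simp
  have f_T_le: "\<bar>f (swap_point (\<omega>, b))\<bar> \<le> bd \<omega>" for \<omega> b
    using growth[of "fst (swap_point (\<omega>, b))" "snd (swap_point (\<omega>, b))"]
    by (auto simp: swap_point_def bd_def split: if_splits)
  have meas_fT: "(\<lambda>\<omega>. f (swap_point (\<omega>, b))) \<in> borel_measurable (\<pi> \<Otimes>\<^sub>M \<pi>)" for b
  proof -
    have "(\<lambda>\<omega>. (\<omega>, b)) \<in> \<pi> \<Otimes>\<^sub>M \<pi> \<rightarrow>\<^sub>M \<Omega>" unfolding \<Omega>_def by measurable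
    from measurable_compose[OF measurable_compose[OF this T_meas] f] show ?thesis by simp
  qed
  have meas_W: "(\<lambda>\<omega>. W \<omega> b) \<in> borel_measurable (\<pi> \<Otimes>\<^sub>M \<pi>)" for b
    unfolding W_def by measurable
  have int_fT: "integrable (\<pi> \<Otimes>\<^sub>M \<pi>) (\<lambda>\<omega>. u \<omega> * f (swap_point (\<omega>, b)))"
    if u: "u \<in> borel_measurable (\<pi> \<Otimes>\<^sub>M \<pi>)" "\<And>\<omega>. 0 \<le> u \<omega>" "\<And>\<omega>. u \<omega> \<le> 1 / (2 * c)" for u b
  proof (rule Bochner_Integration.integrable_bound[OF integrable_mult_right[OF int_bd, of "1 / (2 * c)"]])
    show "(\<lambda>\<omega>. u \<omega> * f (swap_point (\<omega>, b))) \<in> borel_measurable (\<pi> \<Otimes>\<^sub>M \<pi>)"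
      using u(1) meas_fT by (rule borel_measurable_times)
    have "\<bar>u \<omega>\<bar> * \<bar>f (swap_point (\<omega>, b))\<bar> \<le> \<bar>1 / (2 * c)\<bar> * \<bar>bd \<omega>\<bar>" for \<omega>
    proof (rule mult_mono)
      show "\<bar>u \<omega>\<bar> \<le> \<bar>1 / (2 * c)\<bar>" using u(2,3)[of \<omega>] c by simp
      show "\<bar>f (swap_point (\<omega>, b))\<bar> \<le> \<bar>bd \<omega>\<bar>" using f_T_le[of \<omega> b] by linarith
    qed auto
    then show "AE \<omega> in \<pi> \<Otimes>\<^sub>M \<pi>. norm (u \<omega> * f (swap_point (\<omega>, b))) \<le> norm (1 / (2 * c) * bd \<omega>)"
      by (simp only: real_norm_def abs_mult) simp
  qed
  note int_WfT = int_fT[OF meas_W W]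
  define F where "F z = W (fst z) (snd z) * f (swap_point z)" for z
  have F_meas[measurable]: "F \<in> borel_measurable \<Omega>" unfolding F_def[abs_def] by measurable
  have UNIV_bb: "(UNIV :: (bool \<times> bool) set) = {(True, True), (True, False), (False, True), (False, False)}"
    by (auto simp: UNIV_bool)
  have inner: "(\<integral>b. h b \<partial>count_space UNIV) = h (True, True) + h (True, False) + h (False, True) + h (False, False)"
    for h :: "bool \<times> bool \<Rightarrow> real"
    by (subst lebesgue_integral_count_space_finite) (simp_all add: UNIV_bb)
  have int_F: "integrable \<Omega> F"
    unfolding \<Omega>_def
  proof (rule PC.Fubini_integrable)
    show "F \<in> borel_measurable ((\<pi> \<Otimes>\<^sub>M \<pi>) \<Otimes>\<^sub>M count_space UNIV)" using F_meas by (simp add: \<Omega>_def)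
    show "integrable (\<pi> \<Otimes>\<^sub>M \<pi>) (\<lambda>\<omega>. \<integral>b. norm (F (\<omega>, b)) \<partial>count_space UNIV)"
      unfolding inner F_def using int_WfT by (intro Bochner_Integration.integrable_add integrable_norm) auto
    show "AE \<omega> in \<pi> \<Otimes>\<^sub>M \<pi>. integrable (count_space UNIV) (\<lambda>b. F (\<omega>, b))"
      by (intro AE_I2 integrable_count_space) simp
  qed
  have "integrable (density \<Omega> (\<lambda>z. ennreal (W (fst z) (snd z)))) (\<lambda>z. f (swap_point z))"
    using int_F W by (subst integrable_density) (auto simp: F_def[abs_def])
  then show int_sp: "integrable (swap_plan \<pi> c r) f"
    unfolding sp_eq by (subst integrable_distr_eq) auto
  have f_int: "integrable \<pi> f"
    by (rule Bochner_Integration.integrable_bound[OF g]) (use growth in \<open>auto simp: g_def split_paired_all\<close>)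
  have "integrable (\<pi> \<Otimes>\<^sub>M \<pi>) (\<lambda>\<omega>. r \<omega> * f (swap_point (\<omega>, (True, True))) + r \<omega> * f (swap_point (\<omega>, (True, False)))
      - r \<omega> * f (swap_point (\<omega>, (False, True))) - r \<omega> * f (swap_point (\<omega>, (False, False))))"
    by (intro Bochner_Integration.integrable_add Bochner_Integration.integrable_diff int_fT r_bnd) measurable
  then show gain: "integrable (\<pi> \<Otimes>\<^sub>M \<pi>) (\<lambda>\<omega>. r \<omega> * swap_gain f \<omega>)"
    by (simp add: swap_point_def swap_gain_def algebra_simps)
  have "(\<integral>z. f z \<partial>swap_plan \<pi> c r) = (\<integral>z. F z \<partial>\<Omega>)"
    unfolding sp_eq using W by (subst integral_distr; simp?) (subst integral_density; simp add: F_def[abs_def])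
  also have "\<dots> = (\<integral>\<omega>. \<integral>b. F (\<omega>, b) \<partial>count_space UNIV \<partial>(\<pi> \<Otimes>\<^sub>M \<pi>))"
    using PC.integral_fst'[OF int_F[unfolded \<Omega>_def]] by (simp add: \<Omega>_def)
  also have "\<dots> = (\<integral>\<omega>. (1 / (2 * c)) * (f (fst \<omega>) * 1) + (1 / (2 * c)) * (1 * f (snd \<omega>)) + r \<omega> * swap_gain f \<omega> \<partial>(\<pi> \<Otimes>\<^sub>M \<pi>))"
    unfolding inner by (intro Bochner_Integration.integral_cong)
      (simp_all add: F_def W_def swap_point_def swap_gain_def algebra_simps)
  also have "\<dots> = (1 / (2 * c)) * ((\<integral>z. f z \<partial>\<pi>) * c) + (1 / (2 * c)) * (c * (\<integral>z. f z \<partial>\<pi>)) + (\<integral>\<omega>. r \<omega> * swap_gain f \<omega> \<partial>(\<pi> \<Otimes>\<^sub>M \<pi>))"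
  proof -
    have c': "(\<integral>z. 1 \<partial>\<pi>) = c" by (simp add: space_pi c)
    show ?thesis
      using PP.integrable_pair_product[OF f_int one] PP.integrable_pair_product[OF one f_int] gain
      by (simp add: PP.integral_pair_product[OF f_int one, simplified] PP.integral_pair_product[OF one f_int, simplified]
          space_pi c)
  qed
  also have "\<dots> = (\<integral>z. f z \<partial>\<pi>) + (\<integral>\<omega>. r \<omega> * swap_gain f \<omega> \<partial>(\<pi> \<Otimes>\<^sub>M \<pi>))"
    using c by simp
  finally show "(\<integral>z. f z \<partial>swap_plan \<pi> c r) = (\<integral>z. f z \<partial>\<pi>) + (\<integral>\<omega>. r \<omega> * swap_gain f \<omega> \<partial>(\<pi> \<Otimes>\<^sub>M \<pi>))" .
qed

text \<open>A first-order condition: for small \<epsilon> the exchange with density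
  \<open>\<epsilon> * r\<close> yields a competitor, whose expected distance differs from that of
  \<pi> by \<epsilon> times the gain. Its martingale property is the hypothesis
  \<open>bal\<close>.\<close>

lemma swap_gain_le_zero:
  assumes mom: "finite_first_moment \<mu>" "finite_first_moment \<nu>" and \<pi>: "\<pi> \<in> martingale_plans \<mu> \<nu>"
    and opt: "\<And>\<rho>. \<rho> \<in> martingale_plans \<mu> \<nu> \<Longrightarrow> (\<integral>z. \<bar>snd z - fst z\<bar> \<partial>\<rho>) \<le> (\<integral>z. \<bar>snd z - fst z\<bar> \<partial>\<pi>)"
    and r[measurable]: "r \<in> borel_measurable (borel \<Otimes>\<^sub>M borel)" and r_bnd: "\<And>\<omega>. 0 \<le> r \<omega>" "\<And>\<omega>. r \<omega> \<le> R"
    and bal: "\<And>H. H \<in> sets borel \<Longrightarrow> (\<integral>\<omega>. r \<omega> * swap_gain (\<lambda>z. indicator H (fst z) * (snd z - fst z)) \<omega> \<partial>(\<pi> \<Otimes>\<^sub>M \<pi>)) = 0"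
  shows "(\<integral>\<omega>. r \<omega> * swap_gain (\<lambda>z. \<bar>snd z - fst z\<bar>) \<omega> \<partial>(\<pi> \<Otimes>\<^sub>M \<pi>)) \<le> 0"
    and "integrable (\<pi> \<Otimes>\<^sub>M \<pi>) (\<lambda>\<omega>. r \<omega> * swap_gain (\<lambda>z. \<bar>snd z - fst z\<bar>) \<omega>)"
proof -
  have coup: "\<pi> \<in> couplings \<mu> \<nu>" using \<pi> by (auto simp: martingale_plans_def couplings_def)
  interpret pi: finite_measure \<pi> by (rule finite_measure_coupling[OF mom coup])
  note sets_pi[measurable_cong] = sets_coupling[OF mom coup]
  note space_pi = space_coupling[OF mom coup]
  note i = integrable_coupling_fst[OF mom coup] integrable_coupling_snd[OF mom coup]
  define c where "c = measure \<pi> UNIV"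
  have "(\<integral>\<omega>. r \<omega> * swap_gain (\<lambda>z. \<bar>snd z - fst z\<bar>) \<omega> \<partial>(\<pi> \<Otimes>\<^sub>M \<pi>)) \<le> 0 \<and>
      integrable (\<pi> \<Otimes>\<^sub>M \<pi>) (\<lambda>\<omega>. r \<omega> * swap_gain (\<lambda>z. \<bar>snd z - fst z\<bar>) \<omega>)"
  proof (cases "c = 0")
    \<comment> \<open>For the zero plan the normalisation \<open>1 / (2 * c)\<close> degenerates,
      but then all integrals vanish.\<close>
    case True
    interpret PP: pair_sigma_finite \<pi> \<pi> ..
    have "emeasure (\<pi> \<Otimes>\<^sub>M \<pi>) (UNIV \<times> UNIV) = 0"
      using True by (subst pi.emeasure_pair_measure_Times) (simp_all add: sets_pi c_def pi.emeasure_eq_measure)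
    then have null: "space (\<pi> \<Otimes>\<^sub>M \<pi>) \<in> null_sets (\<pi> \<Otimes>\<^sub>M \<pi>)"
      by (intro null_setsI sets.top) (simp add: space_pair_measure space_pi)
    have AE0: "AE \<omega> in \<pi> \<Otimes>\<^sub>M \<pi>. r \<omega> * swap_gain (\<lambda>z. \<bar>snd z - fst z\<bar>) \<omega> = 0"
      using AE_not_in[OF null] by (rule AE_mp) (auto intro!: AE_I2)
    have [measurable]: "fst \<in> borel_measurable \<pi>" "snd \<in> borel_measurable \<pi>" using i by auto
    have m: "(\<lambda>\<omega>. r \<omega> * swap_gain (\<lambda>z. \<bar>snd z - fst z\<bar>) \<omega>) \<in> borel_measurable (\<pi> \<Otimes>\<^sub>M \<pi>)"
    proof -
      have "r \<in> borel_measurable (\<pi> \<Otimes>\<^sub>M \<pi>)"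
        using r by (simp cong: measurable_cong_sets sets_pair_measure_cong add: sets_pi)
      then show ?thesis unfolding swap_gain_def by measurable
    qed
    have "integrable (\<pi> \<Otimes>\<^sub>M \<pi>) (\<lambda>\<omega>. r \<omega> * swap_gain (\<lambda>z. \<bar>snd z - fst z\<bar>) \<omega>)"
      using integrable_cong_AE[OF m _ AE0] by simp
    moreover have "(\<integral>\<omega>. r \<omega> * swap_gain (\<lambda>z. \<bar>snd z - fst z\<bar>) \<omega> \<partial>(\<pi> \<Otimes>\<^sub>M \<pi>)) = 0"
      using integral_cong_AE[OF m _ AE0] by simp
    ultimately show ?thesis by simp
  next
    case False
    then have c: "0 < c" by (simp add: c_def zero_less_measure_iff)
    \<comment> \<open>A bound of at least 1 keeps the divisor in \<epsilon> positive.\<close>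
    define R' where "R' = max R 1"
    have R': "0 < R'" "r \<omega> \<le> R'" for \<omega> using r_bnd(2)[of \<omega>] by (auto simp: R'_def)
    define \<epsilon> where "\<epsilon> = 1 / (2 * c * R')"
    have \<epsilon>: "0 < \<epsilon>" using c R' by (simp add: \<epsilon>_def)
    have er_bnd: "0 \<le> \<epsilon> * r \<omega>" "\<epsilon> * r \<omega> \<le> 1 / (2 * c)" for \<omega>
      using r_bnd(1)[of \<omega>] R'(2)[of \<omega>] R'(1) c by (auto simp: \<epsilon>_def field_simps)
    have er_meas: "(\<lambda>\<omega>. \<epsilon> * r \<omega>) \<in> borel_measurable (borel \<Otimes>\<^sub>M borel)" by measurable
    define \<pi>' where "\<pi>' = swap_plan \<pi> c (\<lambda>\<omega>. \<epsilon> * r \<omega>)"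
    note S = swap_plan_integral[OF pi.finite_measure_axioms sets_pi i c_def c er_meas er_bnd, folded \<pi>'_def]
    have S_eq: "(\<integral>z. f z \<partial>\<pi>') = (\<integral>z. f z \<partial>\<pi>) + \<epsilon> * (\<integral>\<omega>. r \<omega> * swap_gain f \<omega> \<partial>(\<pi> \<Otimes>\<^sub>M \<pi>))"
      if "f \<in> borel_measurable borel" "\<And>x y. \<bar>f (x, y)\<bar> \<le> 1 + \<bar>x\<bar> + \<bar>y\<bar>" for f
      using S(3)[OF that] by (simp add: mult.assoc)
    have sets_pi': "sets \<pi>' = sets borel" by (simp add: \<pi>'_def swap_plan_def)
    have space_pi': "space \<pi>' = UNIV" using sets_eq_imp_space_eq[OF sets_pi'] by simp
    have fin': "finite_measure \<pi>'"
    proof (rule finite_measureI)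
      have "integrable \<pi>' (\<lambda>_. 1 :: real)" by (rule S(1)) auto
      then show "emeasure \<pi>' (space \<pi>') \<noteq> \<infinity>"
        by (simp add: integrable_iff_bounded less_top[symmetric])
    qed
    interpret pi': finite_measure \<pi>' by (rule fin')
    have "\<pi>' \<in> couplings \<mu> \<nu>"
    proof (rule couplingsI[OF sets_pi'])
      fix A :: "real set" assume [measurable]: "A \<in> sets borel"
      have A1: "A \<times> UNIV \<in> sets (borel :: (real \<times> real) measure)" "UNIV \<times> A \<in> sets (borel :: (real \<times> real) measure)"
        by (auto intro!: borel_Times)
      \<comment> \<open>An exchange permutes the second coordinates of a pair, so functions of one
        coordinate have no gain and both marginals survive.\<close>
      have g: "swap_gain (indicator (A \<times> UNIV)) \<omega> = 0" "swap_gain (indicator (UNIV \<times> A)) \<omega> = 0" for \<omega>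
        by (auto simp: swap_gain_def indicator_times split: prod.split)
      have b: "\<bar>indicator B (x, y)\<bar> \<le> 1 + \<bar>x\<bar> + \<bar>y\<bar>" for B and x y :: real
        by (auto simp: indicator_def)
      have "measure \<pi>' (A \<times> UNIV) = measure \<pi> (A \<times> UNIV)" "measure \<pi>' (UNIV \<times> A) = measure \<pi> (UNIV \<times> A)"
        using S_eq[OF borel_measurable_indicator[OF A1(1)] b] S_eq[OF borel_measurable_indicator[OF A1(2)] b] g
        by (simp_all add: space_pi space_pi' del: mult_eq_0_iff)
      then show "emeasure \<pi>' (A \<times> UNIV) = emeasure \<mu> A" "emeasure \<pi>' (UNIV \<times> A) = emeasure \<nu> A"
        using emeasure_coupling_fst[OF mom coup, of A] emeasure_coupling_snd[OF mom coup, of A]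
        by (simp_all add: pi.emeasure_eq_measure pi'.emeasure_eq_measure)
    qed (use finite_first_momentD[OF mom(1)] finite_first_momentD[OF mom(2)] in auto)
    then have "\<pi>' \<in> martingale_plans \<mu> \<nu>"
    proof (rule martingale_planI[OF mom])
      fix q :: rat
      let ?f = "\<lambda>z. indicator {..of_rat q} (fst z) * (snd z - fst z) :: real"
      have "(\<integral>z. ?f z \<partial>\<pi>') = (\<integral>z. ?f z \<partial>\<pi>) + \<epsilon> * (\<integral>\<omega>. r \<omega> * swap_gain ?f \<omega> \<partial>(\<pi> \<Otimes>\<^sub>M \<pi>))"
        by (rule S_eq) (auto simp: indicator_def)
      then show "(\<integral>z. ?f z \<partial>\<pi>') = 0"
        using bal[of "{..of_rat q}"] martingale_plan_integral_zero[OF mom \<pi>, of "{..of_rat q}"] by simp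
    qed
    from opt[OF this] have "(\<integral>z. \<bar>snd z - fst z\<bar> \<partial>\<pi>') \<le> (\<integral>z. \<bar>snd z - fst z\<bar> \<partial>\<pi>)" .
    moreover have "(\<integral>z. \<bar>snd z - fst z\<bar> \<partial>\<pi>') = (\<integral>z. \<bar>snd z - fst z\<bar> \<partial>\<pi>) + \<epsilon> * (\<integral>\<omega>. r \<omega> * swap_gain (\<lambda>z. \<bar>snd z - fst z\<bar>) \<omega> \<partial>(\<pi> \<Otimes>\<^sub>M \<pi>))"
      by (rule S_eq) auto
    ultimately have "\<epsilon> * (\<integral>\<omega>. r \<omega> * swap_gain (\<lambda>z. \<bar>snd z - fst z\<bar>) \<omega> \<partial>(\<pi> \<Otimes>\<^sub>M \<pi>)) \<le> 0" by linarith
    then have "(\<integral>\<omega>. r \<omega> * swap_gain (\<lambda>z. \<bar>snd z - fst z\<bar>) \<omega> \<partial>(\<pi> \<Otimes>\<^sub>M \<pi>)) \<le> 0"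
      using \<epsilon> by (simp add: mult_le_0_iff)
    moreover have "integrable (\<pi> \<Otimes>\<^sub>M \<pi>) (\<lambda>\<omega>. \<epsilon> * r \<omega> * swap_gain (\<lambda>z. \<bar>snd z - fst z\<bar>) \<omega>)"
      by (rule S(2)) auto
    ultimately show ?thesis using \<epsilon> by (simp add: mult.assoc)
  qed
  then show "(\<integral>\<omega>. r \<omega> * swap_gain (\<lambda>z. \<bar>snd z - fst z\<bar>) \<omega> \<partial>(\<pi> \<Otimes>\<^sub>M \<pi>)) \<le> 0"
    "integrable (\<pi> \<Otimes>\<^sub>M \<pi>) (\<lambda>\<omega>. r \<omega> * swap_gain (\<lambda>z. \<bar>snd z - fst z\<bar>) \<omega>)" by auto
qed

section \<open>Exclusion of crossings\<close>

lemma kernel_plan_null_iff: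
  assumes sets_mu: "sets \<mu> = sets borel" and ker: "\<kappa> \<in> borel \<rightarrow>\<^sub>M prob_algebra borel"
    and S: "S \<in> sets borel"
  shows "emeasure (kernel_plan \<mu> \<kappa>) S = 0 \<longleftrightarrow> (AE x in \<mu>. emeasure (\<kappa> x) {y. (x, y) \<in> S} = 0)"
proof -
  have sk: "sets (\<kappa> x) = sets borel" for x by (rule sets_kernel[OF sets_mu ker])
  have sect: "{y. (x, y) \<in> S} \<in> sets (\<kappa> x)" for x
    using sets_Pair1[of S borel borel x] S unfolding sk by (simp add: borel_prod vimage_def)
  have ind: "indicator S \<in> borel_measurable (borel :: (real \<times> real) measure)"
    using S by simp
  have inner: "(\<integral>\<^sup>+y. indicator S (x, y) \<partial>\<kappa> x) = emeasure (\<kappa> x) {y. (x, y) \<in> S}" for x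
  proof -
    have "(\<integral>\<^sup>+y. indicator S (x, y) \<partial>\<kappa> x) = (\<integral>\<^sup>+y. indicator {y. (x, y) \<in> S} y \<partial>\<kappa> x)"
      by (intro nn_integral_cong) (auto simp: indicator_def)
    then show ?thesis using sect by simp
  qed
  have "(\<lambda>(x, y). indicator S (x, y) :: ennreal) \<in> borel_measurable (borel \<Otimes>\<^sub>M borel)"
    using ind by (simp add: borel_prod)
  from nn_integral_measurable_subprob_algebra2[OF this measurable_prob_algebraD[OF ker]]
  have meas: "(\<lambda>x. emeasure (\<kappa> x) {y. (x, y) \<in> S}) \<in> borel_measurable \<mu>"
    using sets_mu by (simp cong: measurable_cong_sets add: inner)
  have "emeasure (kernel_plan \<mu> \<kappa>) S = (\<integral>\<^sup>+z. indicator S z \<partial>kernel_plan \<mu> \<kappa>)"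
    using S sets_kernel_plan[OF sets_mu ker] by simp
  also have "\<dots> = (\<integral>\<^sup>+x. emeasure (\<kappa> x) {y. (x, y) \<in> S} \<partial>\<mu>)"
    by (simp add: nn_integral_kernel_plan[OF sets_mu ker ind] inner)
  finally show ?thesis using nn_integral_0_iff_AE[OF meas] by simp
qed

text \<open>Otherwise \<open>\<sigma> * (y - x)\<close> would be positive almost everywhere with
  integral zero. It supplies the mass on the far side of \<open>x\<close> at which an exchange gains
  strictly.\<close>

lemma barycentre_not_below:
  fixes \<sigma> x :: real
  assumes "prob_space K" and sets_K: "sets K = sets borel" and int: "integrable K (\<lambda>y. y)" and mean: "(\<integral>y. y \<partial>K) = x"
  shows "measure K {y. \<sigma> * y \<le> \<sigma> * x} \<noteq> 0"
proof
  assume 0: "measure K {y. \<sigma> * y \<le> \<sigma> * x} = 0"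
  interpret prob_space K by fact
  have "{y. \<sigma> * y \<le> \<sigma> * x} \<in> null_sets K"
    using 0 by (intro null_setsI) (simp_all add: emeasure_eq_measure sets_K)
  from AE_not_in[OF this] have pos: "AE y in K. 0 < \<sigma> * y - \<sigma> * x" by eventually_elim simp
  have i: "integrable K (\<lambda>y. \<sigma> * y - \<sigma> * x)" using int by simp
  have "(\<integral>y. \<sigma> * y - \<sigma> * x \<partial>K) = 0" using int mean by (simp add: prob_space)
  moreover have "AE y in K. 0 \<le> \<sigma> * y - \<sigma> * x" using pos by eventually_elim simp
  ultimately have "AE y in K. \<sigma> * y - \<sigma> * x = 0"
    using integral_nonneg_eq_0_iff_AE[OF i] by blast
  then have "AE y in K. False" using pos by eventually_elim linarith
  then show False by simp
qed

text \<open>For \<open>\<sigma> = 1\<close>: exchanging the images of \<open>x < x'\<close>, where \<open>x' \<le> y'\<close> and some mass of \<open>x\<close> lies above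
  \<open>y'\<close>, would increase the expected distance.  The density \<open>r\<close> of the exchange is tilted towards
  the mass of \<open>x\<close> above \<open>d\<close> so that the exchanged part of \<open>\<kappa> x\<close> has barycentre \<open>y'\<close>.
  The case \<open>\<sigma> = -1\<close> is the mirror image.\<close>

lemma no_crossing:
  fixes \<sigma> c d :: real
  assumes mom: "finite_first_moment \<mu>" "finite_first_moment \<nu>" and \<pi>: "\<pi> \<in> martingale_plans \<mu> \<nu>"
    and opt: "\<And>\<rho>. \<rho> \<in> martingale_plans \<mu> \<nu> \<Longrightarrow> (\<integral>z. \<bar>snd z - fst z\<bar> \<partial>\<rho>) \<le> (\<integral>z. \<bar>snd z - fst z\<bar> \<partial>\<pi>)"
    and ker: "\<kappa> \<in> borel \<rightarrow>\<^sub>M prob_algebra borel" and eq: "\<pi> = kernel_plan \<mu> \<kappa>"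
    and bary: "AE x in \<mu>. integrable (\<kappa> x) (\<lambda>y. y) \<and> (\<integral>y. y \<partial>\<kappa> x) = x"
    and \<sigma>: "\<sigma> = 1 \<or> \<sigma> = -1"
  shows "(AE x in \<mu>. \<sigma> * x < c \<longrightarrow> emeasure (\<kappa> x) {y. d < \<sigma> * y} = 0) \<or>
         (AE x in \<mu>. c < \<sigma> * x \<longrightarrow> emeasure (\<kappa> x) {y. \<sigma> * x \<le> \<sigma> * y \<and> \<sigma> * y < d} = 0)"
proof -
  note \<mu> = finite_first_momentD[OF mom(1)]
  have coup: "\<pi> \<in> couplings \<mu> \<nu>" using \<pi> by (auto simp: martingale_plans_def couplings_def)
  interpret pi: finite_measure \<pi> by (rule finite_measure_coupling[OF mom coup])
  interpret PP: pair_sigma_finite \<pi> \<pi> ..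
  note sets_pi[measurable_cong] = sets_coupling[OF mom coup]
  note sub = measurable_prob_algebraD[OF ker]
  have sk: "sets (\<kappa> x) = sets borel" and prob: "prob_space (\<kappa> x)" for x
    using sets_kernel[OF \<mu>(2) ker] prob_space_kernel[OF \<mu>(2) ker] by auto
  have spk: "space (\<kappa> x) = UNIV" for x using sets_eq_imp_space_eq[OF sk] by simp
  define B where "B = {z. c < \<sigma> * fst z \<and> \<sigma> * fst z \<le> \<sigma> * snd z \<and> \<sigma> * snd z < d}"
  have B[measurable]: "B \<in> sets borel"
  proof -
    have "B = {z \<in> space borel. c < \<sigma> * fst z \<and> \<sigma> * fst z \<le> \<sigma> * snd z \<and> \<sigma> * snd z < d}" by (simp add: B_def)
    also have "\<dots> \<in> sets borel" by measurable
    finally show ?thesis .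
  qed
  show ?thesis
  \<comment> \<open>If \<open>B\<close> carries no mass, the second alternative holds. Otherwise its
    points are partners for an exchange with any \<open>x\<close> before \<open>c\<close>, which
    yields the first.\<close>
  proof (cases "emeasure \<pi> B = 0")
    case True
    then have "AE x in \<mu>. emeasure (\<kappa> x) {y. (x, y) \<in> B} = 0"
      unfolding eq by (simp add: kernel_plan_null_iff[OF \<mu>(2) ker B])
    then have "AE x in \<mu>. c < \<sigma> * x \<longrightarrow> emeasure (\<kappa> x) {y. \<sigma> * x \<le> \<sigma> * y \<and> \<sigma> * y < d} = 0"
      by eventually_elim (auto simp: B_def)
    then show ?thesis ..
  next
    case False
    \<comment> \<open>\<open>R\<close> and \<open>D\<close> confine \<open>x\<close> and the far
      part of \<open>\<kappa> x\<close>, so that \<open>r\<close> is bounded; countable unions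
      remove them at the end.\<close>
    have "AE x in \<mu>. - R \<le> \<sigma> * x \<and> \<sigma> * x < c \<longrightarrow> emeasure (\<kappa> x) {y. d < \<sigma> * y \<and> \<sigma> * y \<le> D} = 0" for R D :: real
    proof -
      define A where "A = {x. - R \<le> \<sigma> * x \<and> \<sigma> * x < c}"
      define G where "G = {y. d < \<sigma> * y \<and> \<sigma> * y \<le> D}"
      have A[measurable]: "A \<in> sets borel" unfolding A_def by measurable
      have G[measurable]: "G \<in> sets borel" unfolding G_def by measurable
      define k :: "real \<Rightarrow> real" where "k x = (\<integral>y. indicator G y \<partial>\<kappa> x)" for x
      define e :: "real \<Rightarrow> real" where "e x = (\<integral>y. y * indicator G y \<partial>\<kappa> x)" for x
      have k_meas[measurable]: "k \<in> borel_measurable borel" and e_meas[measurable]: "e \<in> borel_measurable borel"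
        unfolding k_def[abs_def] e_def[abs_def]
        by (rule measurable_compose[OF sub integral_measurable_subprob_algebra]; measurable)+
      define M where "M = \<bar>c\<bar> + \<bar>d\<bar> + \<bar>D\<bar> + \<bar>R\<bar>"
      have M: "0 \<le> M" by (simp add: M_def)
      have abs_\<sigma>: "\<bar>\<sigma> * y\<bar> = \<bar>y\<bar>" for y using \<sigma> by auto
      have G_bnd: "\<bar>y * indicator G y\<bar> \<le> M" for y
        using abs_\<sigma>[of y] by (auto simp: G_def M_def indicator_def)
      have A_bnd: "\<bar>x\<bar> \<le> M" if "x \<in> A" for x
        using that abs_\<sigma>[of x] by (auto simp: A_def M_def)
      have B_bnd: "\<bar>snd z\<bar> \<le> M" if "z \<in> B" for z
        using that abs_\<sigma>[of "snd z"] by (auto simp: B_def M_def)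
      have int_k: "integrable (\<kappa> x) (indicator G :: real \<Rightarrow> real)" and int_e: "integrable (\<kappa> x) (\<lambda>y. y * indicator G y)" for x
      proof -
        interpret prob_space "\<kappa> x" by (rule prob)
        note [measurable_cong] = sk
        show "integrable (\<kappa> x) (indicator G :: real \<Rightarrow> real)" by (rule integrable_const_bound[where B=1]) auto
        show "integrable (\<kappa> x) (\<lambda>y. y * indicator G y)"
          by (rule integrable_const_bound[where B=M]) (use G_bnd in \<open>auto simp del: abs_mult\<close>)
      qed
      have k_eq: "k x = measure (\<kappa> x) G" for x by (simp add: k_def spk)
      have k_bnd: "0 \<le> k x" "k x \<le> 1" for x
        using prob_space.prob_le_1[OF prob] by (auto simp: k_eq)
      have e_bnd: "\<bar>e x\<bar> \<le> M" for x
      proof -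
        interpret prob_space "\<kappa> x" by (rule prob)
        have "\<bar>e x\<bar> \<le> (\<integral>y. \<bar>y * indicator G y\<bar> \<partial>\<kappa> x)" unfolding e_def by (rule integral_abs_bound)
        also have "\<dots> \<le> (\<integral>y. M \<partial>\<kappa> x)" using int_e G_bnd by (intro integral_mono integrable_abs) auto
        finally show ?thesis by (simp add: prob_space)
      qed
      \<comment> \<open>The quantity is the integral of \<open>\<sigma> * (y - y')\<close> over
        \<open>G\<close>, and on \<open>G\<close> the integrand exceeds
        \<open>d - \<sigma> * y'\<close>.\<close>
      have tilt: "0 \<le> \<sigma> * (e x - y' * k x)" "0 < k x \<Longrightarrow> 0 < \<sigma> * (e x - y' * k x)" if y': "\<sigma> * y' < d" for x y'
      proof -
        have "(d - \<sigma> * y') * k x = (\<integral>y. (d - \<sigma> * y') * indicator G y \<partial>\<kappa> x)" by (simp add: k_def)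
        also have "\<dots> \<le> (\<integral>y. \<sigma> * (y * indicator G y) - \<sigma> * y' * indicator G y \<partial>\<kappa> x)"
        proof (rule integral_mono)
          show "integrable (\<kappa> x) (\<lambda>y. \<sigma> * (y * indicator G y) - \<sigma> * y' * indicator G y)"
            by (intro Bochner_Integration.integrable_diff integrable_mult_right int_k int_e)
          show "(d - \<sigma> * y') * indicator G y \<le> \<sigma> * (y * indicator G y) - \<sigma> * y' * indicator G y" for y
            by (auto simp: G_def indicator_def)
        qed (intro integrable_mult_right int_k)
        also have "\<dots> = \<sigma> * (e x - y' * k x)"
          using int_k[of x] int_e[of x] by (simp add: k_def e_def right_diff_distrib)
        finally have *: "(d - \<sigma> * y') * k x \<le> \<sigma> * (e x - y' * k x)" .
        have "0 \<le> (d - \<sigma> * y') * k x" using y' k_bnd by simp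
        then show "0 \<le> \<sigma> * (e x - y' * k x)" using * by linarith
        have "0 < (d - \<sigma> * y') * k x" if "0 < k x" using y' that by simp
        then show "0 < \<sigma> * (e x - y' * k x)" if "0 < k x" using * that by fastforce
      qed
      \<comment> \<open>The constant weight \<open>\<sigma> * (e x - y' * k x)\<close> displaces the
        barycentre in proportion to \<open>y' - x\<close>, and the weight
        \<open>\<sigma> * (y' - x)\<close> on \<open>G\<close> displaces it back by the same amount:
        the two coefficients solve one linear equation.\<close>
      define r where "r \<omega> = indicator A (fst (fst \<omega>)) * indicator B (snd \<omega>) *
         (\<sigma> * (e (fst (fst \<omega>)) - snd (snd \<omega>) * k (fst (fst \<omega>))) +
          \<sigma> * (snd (snd \<omega>) - fst (fst \<omega>)) * indicator G (snd (fst \<omega>)))" for \<omega>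
      have r_eq: "r ((x, y), (x', y')) = (if x \<in> A \<and> (x', y') \<in> B then
          \<sigma> * (e x - y' * k x) + \<sigma> * (y' - x) * indicator G y else 0)" for x y x' y'
        by (auto simp: r_def indicator_def)
      have r_meas[measurable]: "r \<in> borel_measurable (borel \<Otimes>\<^sub>M borel)"
      proof -
        have [measurable]: "(\<lambda>\<omega>. indicator A (fst (fst \<omega>)) :: real) \<in> borel_measurable ((borel :: (real \<times> real) measure) \<Otimes>\<^sub>M (borel :: (real \<times> real) measure))"
          "(\<lambda>\<omega>. indicator G (snd (fst \<omega>)) :: real) \<in> borel_measurable ((borel :: (real \<times> real) measure) \<Otimes>\<^sub>M (borel :: (real \<times> real) measure))"
          "(\<lambda>\<omega>. indicator B (snd \<omega>) :: real) \<in> borel_measurable ((borel :: (real \<times> real) measure) \<Otimes>\<^sub>M (borel :: (real \<times> real) measure))"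
          "(\<lambda>\<omega>. e (fst (fst \<omega>))) \<in> borel_measurable ((borel :: (real \<times> real) measure) \<Otimes>\<^sub>M (borel :: (real \<times> real) measure))"
          "(\<lambda>\<omega>. k (fst (fst \<omega>))) \<in> borel_measurable ((borel :: (real \<times> real) measure) \<Otimes>\<^sub>M (borel :: (real \<times> real) measure))"
          by measurable
        show ?thesis unfolding r_def[abs_def] by measurable
      qed
      have order: "\<sigma> * x < \<sigma> * x' \<and> \<sigma> * x' \<le> \<sigma> * y' \<and> \<sigma> * y' < d" if "x \<in> A" "(x', y') \<in> B" for x x' y'
        using that by (auto simp: A_def B_def)
      have r_nonneg: "0 \<le> r \<omega>" for \<omega>
      proof -
        obtain x y x' y' where \<omega>: "\<omega> = ((x, y), (x', y'))" by (metis surj_pair)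
        show ?thesis
          unfolding \<omega> r_eq using tilt(1)[of y' x] order[of x x' y']
          by (auto intro!: add_nonneg_nonneg simp: right_diff_distrib)
      qed
      \<comment> \<open>One \<open>M\<close> for each of \<open>e x\<close>,
        \<open>y' * k x\<close>, \<open>y'\<close> and \<open>x\<close>.\<close>
      have r_le: "r \<omega> \<le> 4 * M" for \<omega>
      proof -
        obtain x y x' y' where \<omega>: "\<omega> = ((x, y), (x', y'))" by (metis surj_pair)
        show ?thesis
        proof (cases "x \<in> A \<and> (x', y') \<in> B")
          case True
          have "\<bar>y' * k x\<bar> \<le> M * 1"
            unfolding abs_mult using B_bnd[of "(x', y')"] True k_bnd[of x] M by (intro mult_mono) auto
          moreover have "\<sigma> * (e x - y' * k x) \<le> \<bar>e x\<bar> + \<bar>y' * k x\<bar>"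
            using \<sigma> by auto
          moreover have "\<sigma> * (y' - x) * indicator G y \<le> \<bar>y'\<bar> + \<bar>x\<bar>"
            using \<sigma> by (auto simp: indicator_def)
          ultimately show ?thesis
            using e_bnd[of x] A_bnd[of x] B_bnd[of "(x', y')"] True by (simp add: \<omega> r_eq)
        next
          case False
          then show ?thesis using M unfolding \<omega> r_eq by auto
        qed
      qed
      note ints = integrable_coupling_fst[OF mom coup] integrable_coupling_snd[OF mom coup]
      have [measurable]: "fst \<in> borel_measurable \<pi>" "snd \<in> borel_measurable \<pi>" using ints by auto
      have r_meas'[measurable]: "r \<in> borel_measurable (\<pi> \<Otimes>\<^sub>M \<pi>)"
        using r_meas by (simp cong: measurable_cong_sets sets_pair_measure_cong add: sets_pi)
      have balance: "(\<integral>\<omega>. r \<omega> * swap_gain (\<lambda>z. indicator H (fst z) * (snd z - fst z)) \<omega> \<partial>(\<pi> \<Otimes>\<^sub>M \<pi>)) = 0"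
        if H[measurable]: "H \<in> sets borel" for H
      proof -
        define F where "F z z' = r (z, z') * ((indicator H (fst z) - indicator H (fst z')) * (snd z' - snd z))" for z z' :: "real \<times> real"
        have F_gain: "r \<omega> * swap_gain (\<lambda>z. indicator H (fst z) * (snd z - fst z)) \<omega> = F (fst \<omega>) (snd \<omega>)" for \<omega>
          by (simp add: F_def swap_gain_def algebra_simps)
        have F_le: "\<bar>F z z'\<bar> \<le> 4 * M * (\<bar>snd z'\<bar> + \<bar>snd z\<bar>)" for z z'
        proof -
          have "\<bar>(indicator H (fst z) - indicator H (fst z')) * (snd z' - snd z)\<bar> \<le> \<bar>snd z'\<bar> + \<bar>snd z\<bar>"
            by (auto simp: indicator_def)
          then show ?thesis unfolding F_def abs_mult[of "r _"]
            using r_nonneg r_le M by (intro mult_mono) auto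
        qed
        have F_meas[measurable]: "(\<lambda>\<omega>. F (fst \<omega>) (snd \<omega>)) \<in> borel_measurable (\<pi> \<Otimes>\<^sub>M \<pi>)"
        proof -
          have [measurable]: "(\<lambda>\<omega>. indicator H (fst (fst \<omega>)) :: real) \<in> borel_measurable (\<pi> \<Otimes>\<^sub>M \<pi>)"
            "(\<lambda>\<omega>. indicator H (fst (snd \<omega>)) :: real) \<in> borel_measurable (\<pi> \<Otimes>\<^sub>M \<pi>)" by measurable
          show ?thesis unfolding F_def by measurable
        qed
        have one: "integrable \<pi> (\<lambda>_. 1 :: real)" by simp
        have abs_snd: "integrable \<pi> (\<lambda>z. \<bar>snd z\<bar>)" using ints(2) by simp
        have int_F: "integrable (\<pi> \<Otimes>\<^sub>M \<pi>) (\<lambda>\<omega>. F (fst \<omega>) (snd \<omega>))"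
        proof (rule Bochner_Integration.integrable_bound)
          show "integrable (\<pi> \<Otimes>\<^sub>M \<pi>) (\<lambda>\<omega>. 4 * M * (1 * \<bar>snd (snd \<omega>)\<bar> + \<bar>snd (fst \<omega>)\<bar> * 1))"
            using PP.integrable_pair_product[OF one abs_snd] PP.integrable_pair_product[OF abs_snd one]
            by (intro integrable_mult_right Bochner_Integration.integrable_add) auto
          show "AE \<omega> in \<pi> \<Otimes>\<^sub>M \<pi>. norm (F (fst \<omega>) (snd \<omega>)) \<le> norm (4 * M * (1 * \<bar>snd (snd \<omega>)\<bar> + \<bar>snd (fst \<omega>)\<bar> * 1))"
            using F_le M by (intro AE_I2) (auto intro: order_trans[OF _ abs_ge_self])
        qed simp
        \<comment> \<open>Balance holds for each fixed partner \<open>z'\<close>: integrating the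
          image \<open>y\<close> over \<open>\<kappa> x\<close> already gives zero for almost every
          \<open>x\<close>.\<close>
        have "(\<integral>z. F z z' \<partial>\<pi>) = 0" for z'
        proof -
          have F_borel: "(\<lambda>z. F z z') \<in> borel_measurable borel"
          proof -
            have "(\<lambda>z. r (z, z')) \<in> borel_measurable borel"
              by (rule measurable_compose[OF measurable_Pair2' r_meas]) simp
            moreover have "(\<lambda>z. (indicator H (fst z) - indicator H (fst z')) * (snd z' - snd z) :: real) \<in> borel_measurable borel"
              by measurable
            ultimately show ?thesis unfolding F_def by (rule borel_measurable_times)
          qed
          have "integrable \<pi> (\<lambda>z. F z z')"
          proof (rule Bochner_Integration.integrable_bound)
            show "integrable \<pi> (\<lambda>z. 4 * M * (\<bar>snd z'\<bar> + \<bar>snd z\<bar>))" using abs_snd by simp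
            show "(\<lambda>z. F z z') \<in> borel_measurable \<pi>" using F_borel by (simp cong: measurable_cong_sets add: sets_pi)
            show "AE z in \<pi>. norm (F z z') \<le> norm (4 * M * (\<bar>snd z'\<bar> + \<bar>snd z\<bar>))"
              using F_le M by (intro AE_I2) (auto intro: order_trans[OF _ abs_ge_self])
          qed
          note I = integral_kernel_plan[OF \<mu>(2) ker F_borel, folded eq, OF this]
          obtain x' y' where z': "z' = (x', y')" by (metis surj_pair)
          have "(\<integral>z. F z z' \<partial>\<pi>) = (\<integral>x. \<integral>y. F (x, y) z' \<partial>\<kappa> x \<partial>\<mu>)" by (rule I(3))
          also have "\<dots> = (\<integral>x. 0 \<partial>\<mu>)"
          proof (rule integral_cong_AE)
            show "AE x in \<mu>. (\<integral>y. F (x, y) z' \<partial>\<kappa> x) = 0"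
              using bary
            proof eventually_elim
              case (elim x)
              interpret prob_space "\<kappa> x" by (rule prob)
              show ?case
              proof (cases "x \<in> A \<and> z' \<in> B")
                case True
                let ?C = "\<sigma> * (indicator H x - indicator H x')" and ?a = "e x - y' * k x" and ?b = "y' - x"
                have "(\<integral>y. F (x, y) z' \<partial>\<kappa> x) = (\<integral>y. ?C * (?a * (y' - y) + ?b * (y' * indicator G y - y * indicator G y)) \<partial>\<kappa> x)"
                  using True unfolding F_def z' r_eq
                  by (intro Bochner_Integration.integral_cong) (auto simp: algebra_simps)
                also have "\<dots> = ?C * (?a * (y' - x) + ?b * (y' * k x - e x))"
                  using elim int_k[of x] int_e[of x] by (simp add: prob_space k_def e_def)
                also have "\<dots> = 0" by (simp add: algebra_simps)
                finally show ?thesis .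
              qed (auto simp: F_def z' r_eq)
            qed
          qed (use I(2) in auto)
          finally show ?thesis by simp
        qed
        then have "(\<integral>z'. \<integral>z. F z z' \<partial>\<pi> \<partial>\<pi>) = 0" by simp
        moreover have "(\<integral>z'. \<integral>z. F z z' \<partial>\<pi> \<partial>\<pi>) = (\<integral>\<omega>. F (fst \<omega>) (snd \<omega>) \<partial>(\<pi> \<Otimes>\<^sub>M \<pi>))"
          using PP.integral_snd[of F] int_F by (simp add: case_prod_beta')
        ultimately show ?thesis by (simp add: F_gain)
      qed
      note gain = swap_gain_le_zero[OF mom \<pi> opt r_meas r_nonneg r_le balance]
      let ?g = "swap_gain (\<lambda>z. \<bar>snd z - fst z\<bar>)"
      \<comment> \<open>For admissible pairs the gain is twice the positive part of
        \<open>\<sigma> * x' - max (\<sigma> * x) (\<sigma> * y)\<close>.\<close>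
      have gain_nonneg: "0 \<le> r \<omega> * ?g \<omega>" for \<omega>
      proof -
        obtain x y x' y' where \<omega>: "\<omega> = ((x, y), (x', y'))" by (metis surj_pair)
        show ?thesis
        proof (cases "x \<in> A \<and> (x', y') \<in> B")
          case True
          then have "0 \<le> ?g \<omega>"
            using order[of x x' y'] \<sigma> by (auto simp: \<omega> swap_gain_def)
          then show ?thesis using r_nonneg by simp
        next
          case False
          then have "r \<omega> = 0" unfolding \<omega> r_eq by (rule if_not_P)
          then show ?thesis by simp
        qed
      qed
      have "AE \<omega> in \<pi> \<Otimes>\<^sub>M \<pi>. r \<omega> * ?g \<omega> = 0"
        using gain gain_nonneg integral_nonneg_eq_0_iff_AE[OF gain(2)]
        by (simp add: antisym[OF gain(1) Bochner_Integration.integral_nonneg])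
      \<comment> \<open>On \<open>S \<times> B\<close> both \<open>r\<close> and the gain are
        strictly positive, so this product is null; as \<open>B\<close> is not null,
        \<open>S\<close> must be.\<close>
      define S where "S = {z. fst z \<in> A \<and> 0 < k (fst z) \<and> \<sigma> * snd z \<le> \<sigma> * fst z}"
      have S: "S \<in> sets borel"
      proof -
        have [measurable]: "Measurable.pred borel (\<lambda>z::real \<times> real. fst z \<in> A)" by measurable
        have "S = {z \<in> space borel. fst z \<in> A \<and> 0 < k (fst z) \<and> \<sigma> * snd z \<le> \<sigma> * fst z}" by (simp add: S_def)
        also have "\<dots> \<in> sets borel" by measurable
        finally show ?thesis .
      qed
      have "S \<times> B \<in> sets (\<pi> \<Otimes>\<^sub>M \<pi>)" using S B sets_pi by (intro pair_measureI) auto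
      moreover have "AE \<omega> in \<pi> \<Otimes>\<^sub>M \<pi>. \<omega> \<notin> S \<times> B"
        using \<open>AE \<omega> in \<pi> \<Otimes>\<^sub>M \<pi>. r \<omega> * ?g \<omega> = 0\<close>
      proof eventually_elim
        case (elim \<omega>)
        obtain x y x' y' where \<omega>: "\<omega> = ((x, y), (x', y'))" by (metis surj_pair)
        show ?case
        proof
          assume "\<omega> \<in> S \<times> B"
          then have *: "x \<in> A" "0 < k x" "\<sigma> * y \<le> \<sigma> * x" "(x', y') \<in> B" by (auto simp: \<omega> S_def)
          have o: "\<sigma> * x < \<sigma> * x'" "\<sigma> * x' \<le> \<sigma> * y'" "\<sigma> * y' < d" using order[OF *(1,4)] by auto
          have "0 \<le> \<sigma> * (y' - x) * indicator G y" using o by (auto simp: right_diff_distrib indicator_def)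
          then have "0 < r \<omega>" using tilt(2)[OF o(3) *(2)] * by (simp add: \<omega> r_eq)
          moreover have "0 < ?g \<omega>" using o *(3) \<sigma> by (auto simp: \<omega> swap_gain_def)
          ultimately show False using elim by simp
        qed
      qed
      ultimately have "emeasure (\<pi> \<Otimes>\<^sub>M \<pi>) (S \<times> B) = 0"
        by (subst (asm) AE_iff_null_sets[symmetric]) auto
      then have "emeasure \<pi> S * emeasure \<pi> B = 0"
        using pi.emeasure_pair_measure_Times[of S \<pi> B] S B sets_pi by simp
      then have "emeasure \<pi> S = 0" using False by simp
      then have "AE x in \<mu>. emeasure (\<kappa> x) {y. (x, y) \<in> S} = 0"
        unfolding eq by (simp add: kernel_plan_null_iff[OF \<mu>(2) ker S])
      then have "AE x in \<mu>. x \<in> A \<longrightarrow> emeasure (\<kappa> x) G = 0"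
        using bary
      proof eventually_elim
        case (elim x)
        interpret prob_space "\<kappa> x" by (rule prob)
        show ?case
        proof (intro impI, rule ccontr)
          assume "x \<in> A" and "emeasure (\<kappa> x) G \<noteq> 0"
          then have "0 < k x" using k_bnd(1)[of x] by (simp add: k_eq emeasure_eq_measure less_le)
          then have "{y. (x, y) \<in> S} = {y. \<sigma> * y \<le> \<sigma> * x}" using \<open>x \<in> A\<close> by (auto simp: S_def)
          then have "measure (\<kappa> x) {y. \<sigma> * y \<le> \<sigma> * x} = 0" using elim(1) by (simp add: measure_def)
          moreover have "measure (\<kappa> x) {y. \<sigma> * y \<le> \<sigma> * x} \<noteq> 0"
            using elim(2) by (intro barycentre_not_below[OF prob sk]) auto
          ultimately show False by simp
        qed
      qed
      then show ?thesis by (simp add: A_def G_def)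
    qed
    then have "AE x in \<mu>. \<forall>n m :: nat. - real n \<le> \<sigma> * x \<and> \<sigma> * x < c \<longrightarrow>
        emeasure (\<kappa> x) {y. d < \<sigma> * y \<and> \<sigma> * y \<le> real m} = 0"
      unfolding AE_all_countable by blast
    then have "AE x in \<mu>. \<sigma> * x < c \<longrightarrow> emeasure (\<kappa> x) {y. d < \<sigma> * y} = 0"
    proof eventually_elim
      case (elim x)
      show ?case
      proof
        assume x: "\<sigma> * x < c"
        obtain n :: nat where "- (\<sigma> * x) \<le> real n" using real_arch_simple by blast
        then have "- real n \<le> \<sigma> * x" by linarith
        then have "emeasure (\<kappa> x) {y. d < \<sigma> * y \<and> \<sigma> * y \<le> real m} = 0" for m :: nat
          using elim x by auto
        moreover have "{y. d < \<sigma> * y} = (\<Union>m::nat. {y. d < \<sigma> * y \<and> \<sigma> * y \<le> real m})"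
          using real_arch_simple by auto
        moreover have "{y. d < \<sigma> * y \<and> \<sigma> * y \<le> real m} \<in> sets (\<kappa> x)" for m :: nat
          unfolding sk by measurable
        ultimately show "emeasure (\<kappa> x) {y. d < \<sigma> * y} = 0"
          by (auto intro: emeasure_UN_eq_0)
      qed
    qed
    then show ?thesis ..
  qed
qed

section \<open>Structure of optimal couplings\<close>

lemma martingale_kernel_barycentre:
  assumes mom: "finite_first_moment \<mu>" "finite_first_moment \<nu>" and \<pi>: "\<pi> \<in> martingale_plans \<mu> \<nu>"
    and ker: "\<kappa> \<in> borel \<rightarrow>\<^sub>M prob_algebra borel" and eq: "\<pi> = kernel_plan \<mu> \<kappa>"
  shows "AE x in \<mu>. integrable (\<kappa> x) (\<lambda>y. y) \<and> (\<integral>y. y \<partial>\<kappa> x) = x"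
proof -
  have coup: "\<pi> \<in> couplings \<mu> \<nu>" using \<pi> by (auto simp: martingale_plans_def couplings_def)
  show ?thesis
    by (rule kernel_barycentre[OF mom coup ker eq]) (simp add: martingale_plan_integral_zero[OF mom \<pi>])
qed

text \<open>By rational levels, \<open>hi x\<close> records the top of \<open>\<kappa> x\<close> and
  \<open>lo x\<close> the bottom of its part beyond \<open>x\<close>. The inclusion
  \<open>hi x \<subseteq> lo x'\<close> orders these parts along the line. Where top and bottom
  differ, a rational can be chosen that no other such point shares; everywhere else the common level
  is the branch.\<close>

lemma one_sided_branch:
  fixes \<sigma> :: real
  assumes mom: "finite_first_moment \<mu>" "finite_first_moment \<nu>" and \<pi>: "\<pi> \<in> martingale_plans \<mu> \<nu>"
    and opt: "\<And>\<rho>. \<rho> \<in> martingale_plans \<mu> \<nu> \<Longrightarrow> (\<integral>z. \<bar>snd z - fst z\<bar> \<partial>\<rho>) \<le> (\<integral>z. \<bar>snd z - fst z\<bar> \<partial>\<pi>)"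
    and ker: "\<kappa> \<in> borel \<rightarrow>\<^sub>M prob_algebra borel" and eq: "\<pi> = kernel_plan \<mu> \<kappa>"
    and bary: "AE x in \<mu>. integrable (\<kappa> x) (\<lambda>y. y) \<and> (\<integral>y. y \<partial>\<kappa> x) = x"
    and cont: "\<And>x. emeasure \<mu> {x} = 0" and \<sigma>: "\<sigma> = 1 \<or> \<sigma> = -1"
  shows "\<exists>X (T :: real \<Rightarrow> real). (AE x in \<mu>. x \<in> X) \<and> (\<forall>x\<in>X. \<sigma> * x \<le> \<sigma> * T x) \<and>
    (\<forall>x\<in>X. emeasure (\<kappa> x) {y. \<sigma> * x \<le> \<sigma> * y \<and> y \<noteq> T x} = 0) \<and>
    (\<forall>x\<in>X. \<forall>x'\<in>X. x < x' \<longrightarrow> T x \<le> T x')"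
proof -
  note \<mu> = finite_first_momentD[OF mom(1)]
  have sk: "sets (\<kappa> x) = sets borel" and prob: "prob_space (\<kappa> x)" for x
    using sets_kernel[OF \<mu>(2) ker] prob_space_kernel[OF \<mu>(2) ker] by auto
  define m where "m x S = emeasure (\<kappa> x) S" for x S
  have m_mono: "m x S = 0" if "m x S' = 0" "S \<subseteq> S'" "S' \<in> sets borel" for x S S'
    using emeasure_mono[of S S' "\<kappa> x"] that by (simp add: m_def sk)
  have sets: "{y. a < \<sigma> * y} \<in> sets borel" "{y. a \<le> \<sigma> * y} \<in> sets borel" "{y. a \<le> \<sigma> * y \<and> \<sigma> * y < b} \<in> sets borel" for a b
    by measurable
  \<comment> \<open>For each pair of levels the alternative of \<open>no_crossing\<close> is decided
    once and for all \<open>x\<close>; this lets it compare two different points.\<close>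
  define P where "P c d \<longleftrightarrow> (AE x in \<mu>. \<sigma> * x < of_rat c \<longrightarrow> m x {y. of_rat d < \<sigma> * y} = 0)" for c d :: rat
  \<comment> \<open>The last condition says that \<open>\<kappa> x\<close> charges the side beyond
    \<open>x\<close>; it keeps \<open>lo x\<close> bounded and the branch finite.\<close>
  define good where "good x \<longleftrightarrow> (\<forall>c d. P c d \<longrightarrow> \<sigma> * x < of_rat c \<longrightarrow> m x {y. of_rat d < \<sigma> * y} = 0) \<and>
    (\<forall>c d. \<not> P c d \<longrightarrow> of_rat c < \<sigma> * x \<longrightarrow> m x {y. \<sigma> * x \<le> \<sigma> * y \<and> \<sigma> * y < of_rat d} = 0) \<and>
    m x {y. \<sigma> * x \<le> \<sigma> * y} \<noteq> 0" for x
  have AE_good: "AE x in \<mu>. good x"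
  proof -
    have "AE x in \<mu>. P c d \<longrightarrow> \<sigma> * x < of_rat c \<longrightarrow> m x {y. of_rat d < \<sigma> * y} = 0" for c d
      by (cases "P c d") (auto simp: P_def)
    then have 1: "AE x in \<mu>. \<forall>c d. P c d \<longrightarrow> \<sigma> * x < of_rat c \<longrightarrow> m x {y. of_rat d < \<sigma> * y} = 0"
      unfolding AE_all_countable by blast
    have "AE x in \<mu>. \<not> P c d \<longrightarrow> of_rat c < \<sigma> * x \<longrightarrow> m x {y. \<sigma> * x \<le> \<sigma> * y \<and> \<sigma> * y < of_rat d} = 0" for c d
      using no_crossing[OF mom \<pi> opt ker eq bary \<sigma>, of "of_rat c" "of_rat d"]
      by (cases "P c d") (auto simp: P_def m_def)
    then have 2: "AE x in \<mu>. \<forall>c d. \<not> P c d \<longrightarrow> of_rat c < \<sigma> * x \<longrightarrow> m x {y. \<sigma> * x \<le> \<sigma> * y \<and> \<sigma> * y < of_rat d} = 0"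
      unfolding AE_all_countable by blast
    show ?thesis
      using 1 2 bary
    proof eventually_elim
      case (elim x)
      have "measure (\<kappa> x) {y. (- \<sigma>) * y \<le> (- \<sigma>) * x} \<noteq> 0"
        using elim(3) by (intro barycentre_not_below[OF prob sk]) auto
      then have "m x {y. \<sigma> * x \<le> \<sigma> * y} \<noteq> 0" by (auto simp: m_def measure_def)
      then show ?case using elim(1,2) unfolding good_def by blast
    qed
  qed
  define hi where "hi x = {d::rat. m x {y. of_rat d < \<sigma> * y} \<noteq> 0}" for x
  define lo where "lo x = {d::rat. m x {y. \<sigma> * x \<le> \<sigma> * y \<and> \<sigma> * y < of_rat d} = 0}" for x
  have hi_lo: "hi x \<subseteq> lo x'" if g: "good x" "good x'" "\<sigma> * x < \<sigma> * x'" for x x'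
  proof
    fix d assume d: "d \<in> hi x"
    \<comment> \<open>\<open>P c d\<close> would contradict the mass of \<open>\<kappa> x\<close>
      above \<open>d\<close>, so the other alternative holds and applies at
      \<open>x'\<close>.\<close>
    obtain c where c: "\<sigma> * x < of_rat c" "of_rat c < \<sigma> * x'" using of_rat_dense[OF g(3)] by blast
    have "\<not> P c d" using g(1) c(1) d unfolding good_def hi_def by blast
    then show "d \<in> lo x'" using g(2) c(2) unfolding good_def lo_def by blast
  qed
  have lo_down: "d' \<in> lo x" if "d \<in> lo x" "d' \<le> d" for d d' x
  proof -
    have "real_of_rat d' \<le> of_rat d" using that(2) by (simp add: of_rat_less_eq)
    then show ?thesis using that(1) unfolding lo_def mem_Collect_eq by (elim m_mono) (auto intro: sets)
  qed
  \<comment> \<open>The part beyond \<open>x\<close> has positive mass and lies at or above every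
    level in \<open>lo x\<close>, hence strictly above any smaller level.\<close>
  have lo_hi: "d' \<in> hi x" if "good x" "d \<in> lo x" "d' < d" for d d' x
  proof -
    have r: "real_of_rat d' < of_rat d" using that(3) by (simp add: of_rat_less)
    show "d' \<in> hi x" unfolding hi_def
    proof (intro CollectI notI)
      assume "m x {y. of_rat d' < \<sigma> * y} = 0"
      then have "{y. of_rat d' < \<sigma> * y} \<in> null_sets (\<kappa> x)" by (intro null_setsI) (auto simp: m_def sk sets)
      moreover have "{y. \<sigma> * x \<le> \<sigma> * y \<and> \<sigma> * y < of_rat d} \<in> null_sets (\<kappa> x)"
        using that(2) by (intro null_setsI) (auto simp: lo_def m_def sk sets)
      ultimately have N: "{y. of_rat d' < \<sigma> * y} \<union> {y. \<sigma> * x \<le> \<sigma> * y \<and> \<sigma> * y < of_rat d} \<in> null_sets (\<kappa> x)"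
        by (rule null_sets.Un)
      have "{y. \<sigma> * x \<le> \<sigma> * y} \<subseteq> {y. of_rat d' < \<sigma> * y} \<union> {y. \<sigma> * x \<le> \<sigma> * y \<and> \<sigma> * y < of_rat d}"
        using r by auto
      then have "{y. \<sigma> * x \<le> \<sigma> * y} \<in> null_sets (\<kappa> x)"
        by (rule null_sets_subset[OF N, rotated]) (simp add: sk sets)
      then show False using that(1) by (auto simp: good_def m_def)
    qed
  qed
  \<comment> \<open>\<open>a\<close> and \<open>b\<close> witness a gap: beyond \<open>x\<close>
    there is mass below \<open>a\<close> and mass above \<open>b\<close>.\<close>
  define E where "E = {x. good x \<and> (\<exists>a b. a < b \<and> b \<in> hi x \<and> a \<notin> lo x)}"
  have "countable E"
  proof -
    have "\<exists>a. \<forall>x\<in>E. (\<exists>b. a x < b \<and> b \<in> hi x \<and> a x \<notin> lo x)"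
      by (rule bchoice) (auto simp: E_def)
    then obtain a where a: "\<And>x. x \<in> E \<Longrightarrow> \<exists>b. a x < b \<and> b \<in> hi x \<and> a x \<notin> lo x" by blast
    \<comment> \<open>For a later point \<open>x'\<close> the level \<open>a x\<close> has entered
      \<open>lo x'\<close>, whereas \<open>a x'\<close> by its choice has not.\<close>
    have ne: "a x \<noteq> a x'" if x: "x \<in> E" "x' \<in> E" "\<sigma> * x < \<sigma> * x'" for x x'
    proof -
      obtain b where b: "a x < b" "b \<in> hi x" using a[OF x(1)] by blast
      have "b \<in> lo x'" using hi_lo[of x x'] x b(2) by (auto simp: E_def)
      then have "a x \<in> lo x'" using b(1) by (intro lo_down[of b x' "a x"]) auto
      then show ?thesis using a[OF x(2)] by auto
    qed
    have "inj_on a E"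
    proof (rule inj_onI, rule ccontr)
      fix x x' assume x: "x \<in> E" "x' \<in> E" "a x = a x'" "x \<noteq> x'"
      then have "\<sigma> * x < \<sigma> * x' \<or> \<sigma> * x' < \<sigma> * x" using \<sigma> by auto
      then show False using ne x by metis
    qed
    then show ?thesis using countableI'[of a E] by (metis countable_image_inj_on countableI_type)
  qed
  define X where "X = {x. good x} - E"
  have "AE x in \<mu>. \<forall>e\<in>E. x \<noteq> e"
  proof (subst AE_ball_countable[OF \<open>countable E\<close>], intro ballI)
    fix e
    have "{e} \<in> null_sets \<mu>" using cont by (intro null_setsI) (auto simp: \<mu>(2))
    from AE_not_in[OF this] show "AE x in \<mu>. x \<noteq> e" by simp
  qed
  then have AE_X: "AE x in \<mu>. x \<in> X"
    using AE_good by eventually_elim (auto simp: X_def)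
  define t where "t x = Sup (real_of_rat ` lo x)" for x
  have lo_small: "d \<in> lo x" if "of_rat d \<le> \<sigma> * x" for d x
  proof -
    have "{y. \<sigma> * x \<le> \<sigma> * y \<and> \<sigma> * y < real_of_rat d} = {}" using that by auto
    then show ?thesis unfolding lo_def m_def mem_Collect_eq by (simp only: emeasure_empty)
  qed
  have lo_ne: "real_of_rat ` lo x \<noteq> {}" for x
    using lo_small of_rat_dense[of "\<sigma> * x - 1" "\<sigma> * x"] by (auto dest: less_imp_le)
  have lo_bdd: "bdd_above (real_of_rat ` lo x)" if "good x" for x
  proof -
    have "\<exists>n::nat. of_nat n \<notin> lo x"
    proof (rule ccontr)
      assume "\<not> ?thesis"
      then have "of_nat n \<in> lo x" for n by blast
      then have "m x {y. \<sigma> * x \<le> \<sigma> * y \<and> \<sigma> * y < real n} = 0" for n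
        unfolding lo_def mem_Collect_eq of_rat_of_nat_eq by blast
      then have "emeasure (\<kappa> x) (\<Union>n. {y. \<sigma> * x \<le> \<sigma> * y \<and> \<sigma> * y < real n}) = 0"
        by (intro emeasure_UN_eq_0) (auto simp: m_def sk sets)
      moreover have "(\<Union>n. {y. \<sigma> * x \<le> \<sigma> * y \<and> \<sigma> * y < real n}) = {y. \<sigma> * x \<le> \<sigma> * y}"
        using reals_Archimedean2 by auto
      ultimately show False using that by (simp add: good_def m_def)
    qed
    then obtain n :: nat where n: "of_nat n \<notin> lo x" by blast
    have "d \<le> of_nat n" if "d \<in> lo x" for d using lo_down[OF that, of "of_nat n"] n by force
    then have "real_of_rat d \<le> of_rat (of_nat n)" if "d \<in> lo x" for d using that by (subst of_rat_less_eq)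
    then show ?thesis by (intro bdd_aboveI) auto
  qed
  have lo_le: "of_rat d \<le> t x" if "good x" "d \<in> lo x" for d x
    unfolding t_def using that lo_bdd by (intro cSup_upper) auto
  have t_ge: "\<sigma> * x \<le> t x" if "good x" for x
  proof (rule ccontr)
    assume "\<not> ?thesis"
    then obtain d where "t x < of_rat d" "real_of_rat d < \<sigma> * x" using of_rat_dense[of "t x" "\<sigma> * x"] by auto
    then show False using lo_le[OF that lo_small[of d x]] by simp
  qed
  have t_null: "m x {y. \<sigma> * x \<le> \<sigma> * y \<and> \<sigma> * y \<noteq> t x} = 0" if x: "x \<in> X" for x
  proof -
    have good: "good x" and notE: "\<And>a b. a < b \<Longrightarrow> b \<in> hi x \<Longrightarrow> a \<in> lo x"
      using x by (auto simp: X_def E_def)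
    have "{y. \<sigma> * x \<le> \<sigma> * y \<and> \<sigma> * y < of_rat d} \<in> null_sets (\<kappa> x)" if "d \<in> lo x" for d
      using that by (intro null_setsI) (auto simp: lo_def m_def sk sets)
    then have 1: "(\<Union>d\<in>lo x. {y. \<sigma> * x \<le> \<sigma> * y \<and> \<sigma> * y < of_rat d}) \<in> null_sets (\<kappa> x)"
      by (intro null_sets_UN') auto
    have "{y. of_rat d < \<sigma> * y} \<in> null_sets (\<kappa> x)" if d: "t x < of_rat d" for d
    proof -
      obtain a where a: "t x < of_rat a" "real_of_rat a < of_rat d" using of_rat_dense[OF d] by blast
      then have "a < d" by (simp add: of_rat_less)
      moreover have "a \<notin> lo x" using lo_le[OF good, of a] a(1) by auto
      ultimately have "d \<notin> hi x" using notE by blast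
      then show ?thesis by (intro null_setsI) (auto simp: hi_def m_def sk sets)
    qed
    then have 2: "(\<Union>d\<in>{d. t x < of_rat d}. {y. of_rat d < \<sigma> * y}) \<in> null_sets (\<kappa> x)"
      by (intro null_sets_UN') auto
    have "{y. \<sigma> * x \<le> \<sigma> * y \<and> \<sigma> * y \<noteq> t x} \<subseteq>
        (\<Union>d\<in>lo x. {y. \<sigma> * x \<le> \<sigma> * y \<and> \<sigma> * y < of_rat d}) \<union> (\<Union>d\<in>{d. t x < of_rat d}. {y. of_rat d < \<sigma> * y})"
    proof
      fix y assume y: "y \<in> {y. \<sigma> * x \<le> \<sigma> * y \<and> \<sigma> * y \<noteq> t x}"
      show "y \<in> (\<Union>d\<in>lo x. {y. \<sigma> * x \<le> \<sigma> * y \<and> \<sigma> * y < of_rat d}) \<union> (\<Union>d\<in>{d. t x < of_rat d}. {y. of_rat d < \<sigma> * y})"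
      proof (cases "\<sigma> * y < t x")
        case True
        then obtain d where "d \<in> lo x" "\<sigma> * y < of_rat d"
          unfolding t_def using less_cSup_iff[OF lo_ne lo_bdd[OF good]] by auto
        then show ?thesis using y by auto
      next
        case False
        then have "t x < \<sigma> * y" using y by auto
        then show ?thesis using of_rat_dense by force
      qed
    qed
    moreover have "{y. \<sigma> * x \<le> \<sigma> * y \<and> \<sigma> * y \<noteq> t x} \<in> sets (\<kappa> x)" unfolding sk by measurable
    ultimately have "{y. \<sigma> * x \<le> \<sigma> * y \<and> \<sigma> * y \<noteq> t x} \<in> null_sets (\<kappa> x)"
      by (intro null_sets_subset[OF null_sets.Un[OF 1 2]])
    then show ?thesis by (auto simp: m_def)
  qed
  have t_mono: "t x \<le> t x'" if "good x" "good x'" "\<sigma> * x < \<sigma> * x'" for x x'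
    unfolding t_def[of x]
  proof (rule cSup_least[OF lo_ne])
    fix u assume "u \<in> real_of_rat ` lo x"
    then obtain d where d: "d \<in> lo x" "u = of_rat d" by blast
    show "u \<le> t x'"
    proof (rule ccontr)
      assume "\<not> u \<le> t x'"
      then obtain d' where d': "t x' < of_rat d'" "real_of_rat d' < of_rat d"
        using d(2) of_rat_dense[of "t x'" u] by auto
      then have "d' < d" by (simp add: of_rat_less)
      then have "d' \<in> lo x'" using lo_hi[OF that(1) d(1)] hi_lo[OF that] by blast
      then show False using lo_le[OF that(2), of d'] d'(1) by simp
    qed
  qed
  \<comment> \<open>\<sigma> is its own inverse, so \<open>\<sigma> * t x\<close> translates a level
    back into a point.\<close>
  have \<sigma>\<sigma>: "\<sigma> * (\<sigma> * u) = u" for u using \<sigma> by auto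
  show ?thesis
  proof (intro exI[of _ X] exI[of _ "\<lambda>x. \<sigma> * t x"] conjI ballI impI)
    show "AE x in \<mu>. x \<in> X" by (rule AE_X)
    show "\<sigma> * x \<le> \<sigma> * (\<sigma> * t x)" if "x \<in> X" for x using t_ge that by (simp add: \<sigma>\<sigma> X_def)
    show "emeasure (\<kappa> x) {y. \<sigma> * x \<le> \<sigma> * y \<and> y \<noteq> \<sigma> * t x} = 0" if "x \<in> X" for x
    proof -
      have "y \<noteq> \<sigma> * t x \<longleftrightarrow> \<sigma> * y \<noteq> t x" for y using \<sigma>\<sigma> by metis
      then show ?thesis using t_null[OF that] by (simp add: m_def)
    qed
    show "\<sigma> * t x \<le> \<sigma> * t x'" if "x \<in> X" "x' \<in> X" "x < x'" for x x'
      using that t_mono[of x x'] t_mono[of x' x] \<sigma> by (auto simp: X_def)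
  qed
qed

text \<open>The sign 1 treats the half-line \<open>{x..}\<close> and the sign -1 treats
  \<open>{..x}\<close>; together they cover the line.\<close>

lemma optimal_kernel_structure:
  assumes mom: "finite_first_moment \<mu>" "finite_first_moment \<nu>" and \<pi>: "\<pi> \<in> martingale_plans \<mu> \<nu>"
    and opt: "\<And>\<rho>. \<rho> \<in> martingale_plans \<mu> \<nu> \<Longrightarrow> (\<integral>z. \<bar>snd z - fst z\<bar> \<partial>\<rho>) \<le> (\<integral>z. \<bar>snd z - fst z\<bar> \<partial>\<pi>)"
    and ker: "\<kappa> \<in> borel \<rightarrow>\<^sub>M prob_algebra borel" and eq: "\<pi> = kernel_plan \<mu> \<kappa>"
    and cont: "\<And>x. emeasure \<mu> {x} = 0"
  shows "\<exists>X (t\<^sub>1 :: real \<Rightarrow> real) (t\<^sub>2 :: real \<Rightarrow> real). (AE x in \<mu>. x \<in> X) \<and>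
    (\<forall>x\<in>X. t\<^sub>1 x \<le> x \<and> x \<le> t\<^sub>2 x \<and> emeasure (\<kappa> x) {y. y \<noteq> t\<^sub>1 x \<and> y \<noteq> t\<^sub>2 x} = 0) \<and>
    (\<forall>x\<in>X. \<forall>x'\<in>X. x < x' \<longrightarrow> t\<^sub>1 x \<le> t\<^sub>1 x' \<and> t\<^sub>2 x \<le> t\<^sub>2 x')"
proof -
  note \<mu> = finite_first_momentD[OF mom(1)]
  have sk: "sets (\<kappa> x) = sets borel" for x by (rule sets_kernel[OF \<mu>(2) ker])
  have bary: "AE x in \<mu>. integrable (\<kappa> x) (\<lambda>y. y) \<and> (\<integral>y. y \<partial>\<kappa> x) = x"
    by (rule martingale_kernel_barycentre[OF mom \<pi> ker eq])
  note branch = one_sided_branch[OF mom \<pi> opt ker eq bary cont]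
  obtain X2 t2 where 2: "AE x in \<mu>. x \<in> X2" "\<And>x. x \<in> X2 \<Longrightarrow> 1 * x \<le> 1 * t2 x"
    "\<And>x. x \<in> X2 \<Longrightarrow> emeasure (\<kappa> x) {y. 1 * x \<le> 1 * y \<and> y \<noteq> t2 x} = 0"
    "\<And>x x'. x \<in> X2 \<Longrightarrow> x' \<in> X2 \<Longrightarrow> x < x' \<Longrightarrow> t2 x \<le> t2 x'"
    using branch[of 1] by blast
  obtain X1 t1 where 1: "AE x in \<mu>. x \<in> X1" "\<And>x. x \<in> X1 \<Longrightarrow> -1 * x \<le> -1 * t1 x"
    "\<And>x. x \<in> X1 \<Longrightarrow> emeasure (\<kappa> x) {y. -1 * x \<le> -1 * y \<and> y \<noteq> t1 x} = 0"
    "\<And>x x'. x \<in> X1 \<Longrightarrow> x' \<in> X1 \<Longrightarrow> x < x' \<Longrightarrow> t1 x \<le> t1 x'"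
    using branch[of "-1"] by blast
  show ?thesis
  proof (rule exI[of _ "X1 \<inter> X2"], rule exI[of _ t1], rule exI[of _ t2], intro conjI ballI impI)
    show "AE x in \<mu>. x \<in> X1 \<inter> X2" using 1(1) 2(1) by eventually_elim simp
    fix x assume x: "x \<in> X1 \<inter> X2"
    have "{y. 1 * x \<le> 1 * y \<and> y \<noteq> t2 x} \<in> sets borel" "{y. -1 * x \<le> -1 * y \<and> y \<noteq> t1 x} \<in> sets borel" by measurable
    then have "{y. 1 * x \<le> 1 * y \<and> y \<noteq> t2 x} \<in> null_sets (\<kappa> x)" "{y. -1 * x \<le> -1 * y \<and> y \<noteq> t1 x} \<in> null_sets (\<kappa> x)"
      using 1(3)[of x] 2(3)[of x] x by (auto simp: null_sets_def sk)
    then have "{y. 1 * x \<le> 1 * y \<and> y \<noteq> t2 x} \<union> {y. -1 * x \<le> -1 * y \<and> y \<noteq> t1 x} \<in> null_sets (\<kappa> x)" by (rule null_sets.Un)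
    moreover have "{y. y \<noteq> t1 x \<and> y \<noteq> t2 x} \<in> sets (\<kappa> x)" unfolding sk by measurable
    ultimately have "{y. y \<noteq> t1 x \<and> y \<noteq> t2 x} \<in> null_sets (\<kappa> x)"
      by (rule null_sets_subset) auto
    then show "emeasure (\<kappa> x) {y. y \<noteq> t1 x \<and> y \<noteq> t2 x} = 0" by auto
  next
    fix x assume "x \<in> X1 \<inter> X2"
    then show "t1 x \<le> x" "x \<le> t2 x" using 1(2)[of x] 2(2)[of x] by auto
  next
    fix x x' assume "x \<in> X1 \<inter> X2" "x' \<in> X1 \<inter> X2" "x < x'"
    then show "t1 x \<le> t1 x'" "t2 x \<le> t2 x'" using 1(4) 2(4) by auto
  qed
qed

section \<open>Uniqueness\<close>

text \<open>On two points every indicator coincides with an affine function, and the integral of an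
  affine function depends only on the barycentre.\<close>

lemma two_point_measure_unique:
  assumes K: "prob_space K" "sets K = sets borel" "integrable K (\<lambda>y. y)" "(\<integral>y. y \<partial>K) = x" "emeasure K {y. y \<noteq> a \<and> y \<noteq> b} = 0"
    and K': "prob_space K'" "sets K' = sets borel" "integrable K' (\<lambda>y. y)" "(\<integral>y. y \<partial>K') = x" "emeasure K' {y. y \<noteq> a \<and> y \<noteq> b} = 0"
    and B: "B \<in> sets borel"
  shows "emeasure K B = emeasure K' (B :: real set)"
proof -
  define \<beta> :: real where "\<beta> = (if a = b then 0 else (indicator B b - indicator B a) / (b - a))"
  define \<alpha> :: real where "\<alpha> = indicator B a - \<beta> * a"
  have ind: "indicator B y = \<alpha> + \<beta> * y" if "y = a \<or> y = b" for y
    using that by (auto simp: \<alpha>_def \<beta>_def field_simps)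
  have "measure Q B = \<alpha> + \<beta> * x"
    if Q: "prob_space Q" "sets Q = sets borel" "integrable Q (\<lambda>y. y)" "(\<integral>y. y \<partial>Q) = x" "emeasure Q {y. y \<noteq> a \<and> y \<noteq> b} = 0"
    for Q
  proof -
    interpret prob_space Q by (rule Q)
    note [measurable_cong] = Q(2)
    have "{y. y \<noteq> a \<and> y \<noteq> b} \<in> sets borel" by measurable
    then have "{y. y \<noteq> a \<and> y \<noteq> b} \<in> null_sets Q" using Q(5) by (intro null_setsI) (simp_all add: Q(2))
    from AE_not_in[OF this] have AE: "AE y in Q. indicator B y = \<alpha> + \<beta> * y"
      by eventually_elim (auto intro: ind)
    have "measure Q B = (\<integral>y. indicator B y \<partial>Q)"
      using sets_eq_imp_space_eq[OF Q(2)] by simp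
    also have "\<dots> = (\<integral>y. \<alpha> + \<beta> * y \<partial>Q)"
    proof (rule integral_cong_AE[OF _ _ AE])
      show "(\<lambda>y. indicator B y :: real) \<in> borel_measurable Q" using B by measurable
    qed measurable
    also have "\<dots> = \<alpha> + \<beta> * x" using Q(3,4) by (simp add: prob_space)
    finally show ?thesis .
  qed
  from this[OF K] this[OF K'] show ?thesis
    using K(1) K'(1) by (simp add: prob_space_def finite_measure.emeasure_eq_measure)
qed

lemma ennreal_half_half: "x * ennreal (1 / 2) + x * ennreal (1 / 2) = x"
proof -
  have "ennreal (1 / 2) + ennreal (1 / 2) = 1" by (subst ennreal_plus[symmetric]) auto
  then show ?thesis by (simp flip: distrib_left)
qed

lemma average_integral:
  fixes f :: "'a \<Rightarrow> real"
  assumes sets_eq: "sets A = sets M" "sets B = sets M"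
    and nn: "\<And>f. f \<in> borel_measurable M \<Longrightarrow>
      (\<integral>\<^sup>+z. f z \<partial>M) = (\<integral>\<^sup>+z. f z \<partial>A) * ennreal (1 / 2) + (\<integral>\<^sup>+z. f z \<partial>B) * ennreal (1 / 2)"
    and f: "integrable A f" "integrable B f"
  shows "integrable M f" "(\<integral>z. f z \<partial>M) = ((\<integral>z. f z \<partial>A) + (\<integral>z. f z \<partial>B)) / 2"
proof -
  have [measurable]: "f \<in> borel_measurable M"
    using borel_measurable_integrable[OF f(1)] measurable_cong_sets[OF sets_eq(1) refl] by blast
  have fin: "(\<integral>\<^sup>+z. ennreal (f z) \<partial>A) \<noteq> \<infinity>" "(\<integral>\<^sup>+z. ennreal (- f z) \<partial>A) \<noteq> \<infinity>"
    "(\<integral>\<^sup>+z. ennreal (f z) \<partial>B) \<noteq> \<infinity>" "(\<integral>\<^sup>+z. ennreal (- f z) \<partial>B) \<noteq> \<infinity>"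
    using f by (simp_all add: real_integrable_def)
  have e: "(\<integral>\<^sup>+z. ennreal (f z) \<partial>M) = (\<integral>\<^sup>+z. ennreal (f z) \<partial>A) * ennreal (1 / 2) + (\<integral>\<^sup>+z. ennreal (f z) \<partial>B) * ennreal (1 / 2)"
    "(\<integral>\<^sup>+z. ennreal (- f z) \<partial>M) = (\<integral>\<^sup>+z. ennreal (- f z) \<partial>A) * ennreal (1 / 2) + (\<integral>\<^sup>+z. ennreal (- f z) \<partial>B) * ennreal (1 / 2)"
    by (rule nn; measurable)+
  show i: "integrable M f"
    unfolding real_integrable_def using fin by (simp add: e ennreal_mult_eq_top_iff)
  have half: "enn2real (a * ennreal (1 / 2) + b * ennreal (1 / 2)) = (enn2real a + enn2real b) / 2" if ab: "a \<noteq> \<infinity>" "b \<noteq> \<infinity>" for a b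
  proof -
    obtain r s where rs: "a = ennreal r" "0 \<le> r" "b = ennreal s" "0 \<le> s"
      using ab by (cases a; cases b) auto
    have "a * ennreal (1 / 2) = ennreal (r * (1 / 2))" "b * ennreal (1 / 2) = ennreal (s * (1 / 2))"
      unfolding rs by (rule ennreal_mult[symmetric]; use rs in simp)+
    then have "a * ennreal (1 / 2) + b * ennreal (1 / 2) = ennreal (r * (1 / 2) + s * (1 / 2))"
      using rs by (simp only: ennreal_plus[symmetric])
    then show ?thesis using rs by (simp only: enn2real_ennreal) simp
  qed
  show "(\<integral>z. f z \<partial>M) = ((\<integral>z. f z \<partial>A) + (\<integral>z. f z \<partial>B)) / 2"
    unfolding real_lebesgue_integral_def[OF i] real_lebesgue_integral_def[OF f(1)] real_lebesgue_integral_def[OF f(2)] e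
      half[OF fin(1,3)] half[OF fin(2,4)] by (simp add: field_simps)
qed

text \<open>Written as a fair coin toss, so that the average is a probability kernel whose integrals
  follow from the rule for \<open>\<bind>\<close>.\<close>

definition mix_kernel :: "(real \<Rightarrow> real measure) \<Rightarrow> (real \<Rightarrow> real measure) \<Rightarrow> real \<Rightarrow> real measure" where
  "mix_kernel \<kappa> \<kappa>' x = measure_pmf (bernoulli_pmf (1 / 2)) \<bind> (\<lambda>b. if b then \<kappa> x else \<kappa>' x)"

context
  fixes \<mu> :: "real measure" and \<kappa> \<kappa>' :: "real \<Rightarrow> real measure"
  assumes mu: "sets \<mu> = sets borel"
    and ker: "\<kappa> \<in> borel \<rightarrow>\<^sub>M prob_algebra borel" and ker': "\<kappa>' \<in> borel \<rightarrow>\<^sub>M prob_algebra borel"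
begin

lemma mix_choice_measurable: "(\<lambda>b. if b then \<kappa> x else \<kappa>' x) \<in> measure_pmf (bernoulli_pmf (1 / 2)) \<rightarrow>\<^sub>M subprob_algebra borel"
  using sets_kernel[OF mu ker] sets_kernel[OF mu ker'] prob_space_kernel[OF mu ker] prob_space_kernel[OF mu ker']
  by (auto simp: measurable_pmf_measure1 space_subprob_algebra prob_space_imp_subprob_space)

lemma nn_integral_mix_kernel:
  "f \<in> borel_measurable borel \<Longrightarrow>
    (\<integral>\<^sup>+y. f y \<partial>mix_kernel \<kappa> \<kappa>' x) = (\<integral>\<^sup>+y. f y \<partial>\<kappa> x) * ennreal (1 / 2) + (\<integral>\<^sup>+y. f y \<partial>\<kappa>' x) * ennreal (1 / 2)"
  unfolding mix_kernel_def by (subst nn_integral_bind[OF _ mix_choice_measurable]) simp_all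

lemma sets_mix_kernel: "sets (mix_kernel \<kappa> \<kappa>' x) = sets borel"
  unfolding mix_kernel_def using sets_kernel[OF mu ker] sets_kernel[OF mu ker'] by (intro sets_bind) auto

lemma emeasure_mix_kernel:
  "B \<in> sets borel \<Longrightarrow> emeasure (mix_kernel \<kappa> \<kappa>' x) B = emeasure (\<kappa> x) B * ennreal (1 / 2) + emeasure (\<kappa>' x) B * ennreal (1 / 2)"
  using nn_integral_mix_kernel[of "indicator B"] sets_mix_kernel sets_kernel[OF mu ker] sets_kernel[OF mu ker'] by simp

lemma mix_kernel_measurable: "mix_kernel \<kappa> \<kappa>' \<in> borel \<rightarrow>\<^sub>M prob_algebra borel"
proof (rule measurable_prob_algebra_generated[where \<Omega>=UNIV and G="sets borel"])
  show "sets borel = sigma_sets UNIV (sets (borel :: real measure))"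
    using sets.sigma_sets_eq[of "borel :: real measure"] by simp
  show "Int_stable (sets (borel :: real measure))" by (auto simp: Int_stable_def)
  show "prob_space (mix_kernel \<kappa> \<kappa>' x)" for x
  proof (rule prob_spaceI)
    have "emeasure (\<kappa> x) UNIV = 1" "emeasure (\<kappa>' x) UNIV = 1"
      using prob_space.emeasure_space_1[OF prob_space_kernel[OF mu ker, of x]] sets_eq_imp_space_eq[OF sets_kernel[OF mu ker, of x]]
        prob_space.emeasure_space_1[OF prob_space_kernel[OF mu ker', of x]] sets_eq_imp_space_eq[OF sets_kernel[OF mu ker', of x]]
      by simp_all
    then show "emeasure (mix_kernel \<kappa> \<kappa>' x) (space (mix_kernel \<kappa> \<kappa>' x)) = 1"
      using sets_eq_imp_space_eq[OF sets_mix_kernel, of x] ennreal_half_half[of 1] by (simp add: emeasure_mix_kernel)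
  qed
  show "(\<lambda>x. emeasure (mix_kernel \<kappa> \<kappa>' x) A) \<in> borel_measurable borel" if A: "A \<in> sets borel" for A
  proof -
    have [measurable]: "(\<lambda>x. emeasure (\<kappa> x) A) \<in> borel_measurable borel" "(\<lambda>x. emeasure (\<kappa>' x) A) \<in> borel_measurable borel"
      by (rule measurable_compose[OF measurable_prob_algebraD[OF ker] measurable_emeasure_subprob_algebra[OF A]]
          measurable_compose[OF measurable_prob_algebraD[OF ker'] measurable_emeasure_subprob_algebra[OF A]])+
    show ?thesis unfolding emeasure_mix_kernel[OF A] by measurable
  qed
qed (simp_all add: sets_mix_kernel)

lemma nn_integral_mix_plan:
  assumes f: "f \<in> borel_measurable borel"
  shows "(\<integral>\<^sup>+z. f z \<partial>kernel_plan \<mu> (mix_kernel \<kappa> \<kappa>')) =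
    (\<integral>\<^sup>+z. f z \<partial>kernel_plan \<mu> \<kappa>) * ennreal (1 / 2) + (\<integral>\<^sup>+z. f z \<partial>kernel_plan \<mu> \<kappa>') * ennreal (1 / 2)"
proof -
  have f': "(\<lambda>(x, y). f (x, y)) \<in> borel_measurable (borel \<Otimes>\<^sub>M borel)" using f by (simp add: borel_prod)
  have m: "(\<lambda>x. \<integral>\<^sup>+y. f (x, y) \<partial>K x) \<in> borel_measurable \<mu>" if "K \<in> borel \<rightarrow>\<^sub>M prob_algebra borel" for K
    using nn_integral_measurable_subprob_algebra2[OF f' measurable_prob_algebraD[OF that]]
    by (simp cong: measurable_cong_sets add: mu)
  have sect: "(\<lambda>y. f (x, y)) \<in> borel_measurable borel" for x
    by (rule measurable_compose[OF measurable_Pair1' f[unfolded borel_prod[symmetric]]]) simp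
  show ?thesis
    unfolding nn_integral_kernel_plan[OF mu mix_kernel_measurable f] nn_integral_kernel_plan[OF mu ker f]
      nn_integral_kernel_plan[OF mu ker' f] nn_integral_mix_kernel[OF sect]
    using m[OF ker] m[OF ker'] by (simp add: nn_integral_add nn_integral_multc)
qed

end

lemma optimal_iff_maximises_distance:
  "optimal_martingale_plan (\<lambda>x y. - \<bar>y - x\<bar>) \<mu> \<nu> \<pi> \<longleftrightarrow> maximises_distance \<mu> \<nu> \<pi>"
  by (simp add: optimal_martingale_plan_def maximises_distance_def case_prod_beta')

lemma maximiser_unique:
  assumes mom: "finite_first_moment \<mu>" "finite_first_moment \<nu>" and cont: "\<And>x. emeasure \<mu> {x} = 0"
    and \<pi>: "maximises_distance \<mu> \<nu> \<pi>" and \<rho>: "maximises_distance \<mu> \<nu> \<rho>"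
  shows "\<pi> = \<rho>"
proof -
  note \<mu> = finite_first_momentD[OF mom(1)]
  have m\<pi>: "\<pi> \<in> martingale_plans \<mu> \<nu>" and m\<rho>: "\<rho> \<in> martingale_plans \<mu> \<nu>"
    using \<pi> \<rho> by (auto simp: maximises_distance_def)
  obtain \<kappa> where c: "\<pi> \<in> couplings \<mu> \<nu>" and ker: "\<kappa> \<in> borel \<rightarrow>\<^sub>M prob_algebra borel" and eq: "\<pi> = kernel_plan \<mu> \<kappa>"
    and bary: "AE x in \<mu>. integrable (\<kappa> x) (\<lambda>y. y) \<and> (\<integral>y. y \<partial>\<kappa> x) = x"
    by (rule martingale_planD[OF mom m\<pi>])
  obtain \<kappa>' where c': "\<rho> \<in> couplings \<mu> \<nu>" and ker': "\<kappa>' \<in> borel \<rightarrow>\<^sub>M prob_algebra borel" and eq': "\<rho> = kernel_plan \<mu> \<kappa>'"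
    and bary': "AE x in \<mu>. integrable (\<kappa>' x) (\<lambda>y. y) \<and> (\<integral>y. y \<partial>\<kappa>' x) = x"
    by (rule martingale_planD[OF mom m\<rho>])
  define K where "K = mix_kernel \<kappa> \<kappa>'"
  have kerK: "K \<in> borel \<rightarrow>\<^sub>M prob_algebra borel" unfolding K_def by (rule mix_kernel_measurable[OF \<mu>(2) ker ker'])
  define \<alpha> where "\<alpha> = kernel_plan \<mu> K"
  have sets_\<alpha>: "sets \<alpha> = sets borel" unfolding \<alpha>_def by (rule sets_kernel_plan[OF \<mu>(2) kerK])
  note nn = nn_integral_mix_plan[OF \<mu>(2) ker ker', folded K_def \<alpha>_def eq eq']
  have nn': "(\<integral>\<^sup>+z. f z \<partial>\<alpha>) = (\<integral>\<^sup>+z. f z \<partial>\<pi>) * ennreal (1 / 2) + (\<integral>\<^sup>+z. f z \<partial>\<rho>) * ennreal (1 / 2)"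
    if "f \<in> borel_measurable \<alpha>" for f
    using nn[of f] that by (simp cong: measurable_cong_sets add: sets_\<alpha>)
  have sets_eq: "sets \<pi> = sets \<alpha>" "sets \<rho> = sets \<alpha>"
    using sets_coupling[OF mom c] sets_coupling[OF mom c'] sets_\<alpha> by simp_all
  note avg = average_integral[OF sets_eq nn']
  have coup: "\<alpha> \<in> couplings \<mu> \<nu>"
  proof (rule couplingsI[OF sets_\<alpha>])
    fix A :: "real set" assume A: "A \<in> sets borel"
    have AU: "A \<times> UNIV \<in> sets (borel :: (real \<times> real) measure)" "UNIV \<times> A \<in> sets (borel :: (real \<times> real) measure)"
      using A by (auto intro!: borel_Times)
    have "emeasure \<alpha> C = emeasure \<pi> C * ennreal (1 / 2) + emeasure \<rho> C * ennreal (1 / 2)" if "C \<in> sets borel" for C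
      using nn[of "indicator C"] that sets_\<alpha> sets_eq by simp
    from this[OF AU(1)] this[OF AU(2)]
    show "emeasure \<alpha> (A \<times> UNIV) = emeasure \<mu> A" "emeasure \<alpha> (UNIV \<times> A) = emeasure \<nu> A"
      using emeasure_coupling_fst[OF mom c A] emeasure_coupling_fst[OF mom c' A]
        emeasure_coupling_snd[OF mom c A] emeasure_coupling_snd[OF mom c' A] by (simp_all only: ennreal_half_half)
  qed (use \<mu>(2) finite_first_momentD(2)[OF mom(2)] in auto)
  have m\<alpha>: "\<alpha> \<in> martingale_plans \<mu> \<nu>"
  proof (rule martingale_planI[OF mom coup])
    fix q :: rat
    have q: "{..real_of_rat q} \<in> sets borel" by simp
    show "(\<integral>z. indicator {..real_of_rat q} (fst z) * (snd z - fst z) \<partial>\<alpha>) = 0"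
      using avg(2)[OF _ integrable_coupling_indicator_diff[OF mom c q] integrable_coupling_indicator_diff[OF mom c' q]]
        martingale_plan_integral_zero[OF mom m\<pi> q] martingale_plan_integral_zero[OF mom m\<rho> q] by simp
  qed
  have opt: "(\<integral>z. \<bar>snd z - fst z\<bar> \<partial>\<tau>) \<le> (\<integral>z. \<bar>snd z - fst z\<bar> \<partial>\<alpha>)" if \<tau>: "\<tau> \<in> martingale_plans \<mu> \<nu>" for \<tau>
  proof -
    define G where "G \<tau> = (\<integral>z. \<bar>snd z - fst z\<bar> \<partial>\<tau>)" for \<tau> :: "(real \<times> real) measure"
    have "G \<alpha> = (G \<pi> + G \<rho>) / 2"
      using avg(2)[OF _ integrable_abs[OF integrable_coupling_diff[OF mom c]] integrable_abs[OF integrable_coupling_diff[OF mom c']]]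
      by (simp add: G_def)
    moreover have "G \<tau> \<le> G \<pi>" "G \<tau> \<le> G \<rho>"
      using \<pi> \<rho> \<tau> by (auto simp: maximises_distance_def G_def)
    ultimately have "G \<tau> \<le> G \<alpha>" by (simp add: field_simps)
    then show ?thesis by (simp only: G_def)
  qed
  \<comment> \<open>Applied to the average rather than to each plan: one pair \<open>t1 x\<close>,
    \<open>t2 x\<close> then carries both \<open>\<kappa> x\<close> and \<open>\<kappa>' x\<close>,
    each being at most twice the average.\<close>
  obtain X t1 t2 where X: "AE x in \<mu>. x \<in> X" and null: "\<And>x. x \<in> X \<Longrightarrow> emeasure (K x) {y. y \<noteq> t1 x \<and> y \<noteq> t2 x} = 0"
    using optimal_kernel_structure[OF mom m\<alpha> opt kerK \<alpha>_def cont] by blast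
  have AE_eq: "AE x in \<mu>. \<forall>B\<in>sets borel. emeasure (\<kappa> x) B = emeasure (\<kappa>' x) B"
    using X bary bary'
  proof eventually_elim
    case (elim x)
    have "{y. y \<noteq> t1 x \<and> y \<noteq> t2 x} \<in> sets borel" by measurable
    from emeasure_mix_kernel[OF \<mu>(2) ker ker' this, of x] null[OF elim(1)]
    have "emeasure (\<kappa> x) {y. y \<noteq> t1 x \<and> y \<noteq> t2 x} = 0" "emeasure (\<kappa>' x) {y. y \<noteq> t1 x \<and> y \<noteq> t2 x} = 0"
      by (simp_all add: K_def)
    then show ?case
      using elim(2,3) sets_kernel[OF \<mu>(2) ker] sets_kernel[OF \<mu>(2) ker'] prob_space_kernel[OF \<mu>(2) ker] prob_space_kernel[OF \<mu>(2) ker']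
      by (intro ballI two_point_measure_unique[where a="t1 x" and b="t2 x" and x=x]) auto
  qed
  show ?thesis
  proof (rule measure_eqI_rectangles[OF finite_measure_coupling[OF mom c] sets_coupling[OF mom c] sets_coupling[OF mom c']])
    fix A B :: "real set" assume AB: "A \<in> sets borel" "B \<in> sets borel"
    have "(\<integral>\<^sup>+x\<in>A. emeasure (\<kappa> x) B \<partial>\<mu>) = (\<integral>\<^sup>+x\<in>A. emeasure (\<kappa>' x) B \<partial>\<mu>)"
      using AE_eq AB(2) by (intro nn_integral_cong_AE) (auto elim: eventually_mono)
    then show "emeasure \<pi> (A \<times> B) = emeasure \<rho> (A \<times> B)"
      unfolding eq eq' by (simp add: emeasure_kernel_plan[OF \<mu>(2) ker AB] emeasure_kernel_plan[OF \<mu>(2) ker' AB])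
  qed
qed

section \<open>Monotone extension of the branches to the whole line\<close>

lemma borel_measurable_mono_ereal:
  fixes T :: "real \<Rightarrow> ereal"
  assumes "mono T"
  shows "T \<in> borel_measurable borel"
proof (rule borel_measurableI_greater)
  fix a
  have "is_interval {x. a < T x}"
    unfolding is_interval_1 using monoD[OF assms] less_le_trans by blast
  then show "{x \<in> space borel. a < T x} \<in> sets borel"
    using real_interval_borel_measurable by simp
qed

lemma maximiser_on_graphs:
  assumes mom: "finite_first_moment \<mu>" "finite_first_moment \<nu>" and cont: "\<And>x. emeasure \<mu> {x} = 0"
    and \<pi>: "maximises_distance \<mu> \<nu> \<pi>"
  shows "\<exists>T\<^sub>1 T\<^sub>2 :: real \<Rightarrow> ereal. mono T\<^sub>1 \<and> mono T\<^sub>2 \<and> (\<forall>x. T\<^sub>1 x \<le> ereal x \<and> ereal x \<le> T\<^sub>2 x) \<and>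
    (AE x in \<mu>. \<bar>T\<^sub>1 x\<bar> \<noteq> \<infinity> \<and> \<bar>T\<^sub>2 x\<bar> \<noteq> \<infinity>) \<and> concentrated_on_graphs \<pi> T\<^sub>1 T\<^sub>2"
proof -
  note \<mu> = finite_first_momentD[OF mom(1)]
  have m\<pi>: "\<pi> \<in> martingale_plans \<mu> \<nu>"
    and opt: "\<And>\<rho>. \<rho> \<in> martingale_plans \<mu> \<nu> \<Longrightarrow> (\<integral>z. \<bar>snd z - fst z\<bar> \<partial>\<rho>) \<le> (\<integral>z. \<bar>snd z - fst z\<bar> \<partial>\<pi>)"
    using \<pi> by (auto simp: maximises_distance_def)
  obtain \<kappa> where c: "\<pi> \<in> couplings \<mu> \<nu>" and ker: "\<kappa> \<in> borel \<rightarrow>\<^sub>M prob_algebra borel" and eq: "\<pi> = kernel_plan \<mu> \<kappa>"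
    by (rule martingale_planD[OF mom m\<pi>])
  obtain X t1 t2 where X: "AE x in \<mu>. x \<in> X" and t1: "\<And>x. x \<in> X \<Longrightarrow> t1 x \<le> x" and t2: "\<And>x. x \<in> X \<Longrightarrow> x \<le> t2 x"
    and null: "\<And>x. x \<in> X \<Longrightarrow> emeasure (\<kappa> x) {y. y \<noteq> t1 x \<and> y \<noteq> t2 x} = 0"
    and t1_mono: "\<And>x x'. x \<in> X \<Longrightarrow> x' \<in> X \<Longrightarrow> x < x' \<Longrightarrow> t1 x \<le> t1 x'"
    and t2_mono: "\<And>x x'. x \<in> X \<Longrightarrow> x' \<in> X \<Longrightarrow> x < x' \<Longrightarrow> t2 x \<le> t2 x'"
    using optimal_kernel_structure[OF mom m\<pi> opt ker eq cont] by blast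
  \<comment> \<open>The branches are known to be monotone on \<open>X\<close> only. An infimum over
    points to the right extends the lower one; the cap by \<open>x\<close> also serves where
    \<open>X\<close> has no points to the right and the infimum is \<open>\<infinity>\<close>. To
    the left of \<open>X\<close> the value may be \<open>-\<infinity>\<close>.\<close>
  define T1 where "T1 x = min (ereal x) (INF u\<in>{u\<in>X. x \<le> u}. ereal (t1 u))" for x
  define T2 where "T2 x = max (ereal x) (SUP u\<in>{u\<in>X. u \<le> x}. ereal (t2 u))" for x
  have T1_eq: "T1 x = ereal (t1 x)" if x: "x \<in> X" for x
  proof -
    have "(INF u\<in>{u\<in>X. x \<le> u}. ereal (t1 u)) = ereal (t1 x)"
    proof (rule antisym)
      show "(INF u\<in>{u\<in>X. x \<le> u}. ereal (t1 u)) \<le> ereal (t1 x)" using x by (intro INF_lower) auto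
      show "ereal (t1 x) \<le> (INF u\<in>{u\<in>X. x \<le> u}. ereal (t1 u))"
        using x t1_mono by (intro INF_greatest) (auto simp: le_less)
    qed
    then show ?thesis using t1[OF x] by (simp add: T1_def min_def)
  qed
  have T2_eq: "T2 x = ereal (t2 x)" if x: "x \<in> X" for x
  proof -
    have "(SUP u\<in>{u\<in>X. u \<le> x}. ereal (t2 u)) = ereal (t2 x)"
    proof (rule antisym)
      show "ereal (t2 x) \<le> (SUP u\<in>{u\<in>X. u \<le> x}. ereal (t2 u))" using x by (intro SUP_upper) auto
      show "(SUP u\<in>{u\<in>X. u \<le> x}. ereal (t2 u)) \<le> ereal (t2 x)"
        using x t2_mono by (intro SUP_least) (auto simp: le_less)
    qed
    then show ?thesis using t2[OF x] by (simp add: T2_def max_def)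
  qed
  have mono1: "mono T1"
  proof (rule monoI)
    fix x y :: real assume "x \<le> y"
    then show "T1 x \<le> T1 y" unfolding T1_def by (intro min.mono INF_superset_mono) auto
  qed
  have mono2: "mono T2"
  proof (rule monoI)
    fix x y :: real assume "x \<le> y"
    then show "T2 x \<le> T2 y" unfolding T2_def by (intro max.mono SUP_subset_mono) auto
  qed
  note [measurable] = borel_measurable_mono_ereal[OF mono1] borel_measurable_mono_ereal[OF mono2]
  define N where "N = {z. ereal (snd z) \<noteq> T1 (fst z) \<and> ereal (snd z) \<noteq> T2 (fst z)}"
  have N: "N \<in> sets borel"
  proof -
    have "N = {z \<in> space borel. ereal (snd z) \<noteq> T1 (fst z) \<and> ereal (snd z) \<noteq> T2 (fst z)}" by (simp add: N_def)
    also have "\<dots> \<in> sets borel" by measurable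
    finally show ?thesis .
  qed
  have "AE x in \<mu>. emeasure (\<kappa> x) {y. (x, y) \<in> N} = 0"
    using X by eventually_elim (simp add: N_def T1_eq T2_eq null)
  then have "emeasure \<pi> N = 0" unfolding eq by (simp add: kernel_plan_null_iff[OF \<mu>(2) ker N])
  then have "N \<in> null_sets \<pi>" using N sets_coupling[OF mom c] by (intro null_setsI) auto
  from AE_not_in[OF this] have "concentrated_on_graphs \<pi> T1 T2"
    unfolding concentrated_on_graphs_def by eventually_elim (auto simp: N_def)
  moreover have "AE x in \<mu>. \<bar>T1 x\<bar> \<noteq> \<infinity> \<and> \<bar>T2 x\<bar> \<noteq> \<infinity>"
    using X by eventually_elim (simp add: T1_eq T2_eq)
  moreover have "\<forall>x. T1 x \<le> ereal x \<and> ereal x \<le> T2 x" by (simp add: T1_def T2_def)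
  ultimately show ?thesis using mono1 mono2 by blast
qed

theorem theorem7p3:
  fixes \<mu> \<nu> :: "real measure"
  assumes "finite_first_moment \<mu>" and "finite_first_moment \<nu>"
    and "\<mu> \<preceq>\<^sub>C \<nu>"
    and "\<forall>x. emeasure \<mu> {x} = 0"
  shows "\<exists>\<pi>\<^sub>H\<^sub>N. optimal_martingale_plan (\<lambda>x y. - \<bar>y - x\<bar>) \<mu> \<nu> \<pi>\<^sub>H\<^sub>N \<and>
           (\<forall>\<pi>. optimal_martingale_plan (\<lambda>x y. - \<bar>y - x\<bar>) \<mu> \<nu> \<pi> \<longrightarrow> \<pi> = \<pi>\<^sub>H\<^sub>N) \<and>
           (\<exists>T\<^sub>1 T\<^sub>2 :: real \<Rightarrow> ereal.
              mono T\<^sub>1 \<and> mono T\<^sub>2 \<and> (\<forall>x. T\<^sub>1 x \<le> ereal x \<and> ereal x \<le> T\<^sub>2 x) \<and>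
              (AE x in \<mu>. \<bar>T\<^sub>1 x\<bar> \<noteq> \<infinity> \<and> \<bar>T\<^sub>2 x\<bar> \<noteq> \<infinity>) \<and>
              concentrated_on_graphs \<pi>\<^sub>H\<^sub>N T\<^sub>1 T\<^sub>2)"
proof -
  note mom = assms(1,2)
  have cont: "\<And>x. emeasure \<mu> {x} = 0" using assms(4) by blast
  obtain \<pi> where \<pi>: "maximises_distance \<mu> \<nu> \<pi>"
    using distance_maximiser_exists[OF assms(1-3)] by blast
  show ?thesis
    unfolding optimal_iff_maximises_distance
    using \<pi> maximiser_unique[OF mom cont _ \<pi>] maximiser_on_graphs[OF mom cont \<pi>] by blast
qed

end
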